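(* Let $T>0$. For each $n\ge 0$ let $\lambda^n,\nu^n\ge 0$, let $f^n\in\mathcal C^1(\mathbb R_+,\mathbb R_+)$ be non-decreasing with $f^n(0)=0$ and with derivative of at most linear growth, let $K^n\in L^1_{loc}(\mathbb R_+,\mathbb R_+)$, let $G_0^n:\mathbb R_+\to\mathbb R_+$ be non-decreasing with $G^n_0(0)=0$, and let $(W^n,X^n)$ be a weak solution on $[0,T]$ to $$X^n_t=G^n_0(t)+\int_0^tK^n(t-s)\,\Upsilon^n_s\,ds,\qquad \Upsilon^n_s:=\nu^n W^n_{f^n(X^n_s)}-\lambda^n X^n_s,$$ for the input $(G_0^n,K^n,f^n,\lambda^n,\nu^n)$. Suppose that: - $K^n(t)\,dt\Rightarrow\delta_0(dt)$ weakly on $[0,T]$; - $G_0^n\to G_0$ pointwise on $[0,T]$, where $G_0$ is continuous; - $f^n\to f$ locally uniformly on $\mathbb R_+$ in the sense that, for every $x\in\mathbb R_+$, $\limsup_{n\to\infty}\sup\{|f^n(s)-f(r)|: s,r\in[x-\delta,x+\delta]\cap\mathbb R_+\}\to 0$ as $\delta\to 0$; and $\sup_{n\ge 0}\sup_{x\ge 0}f^n(x)/(1+x^2)<+\infty$; - $\lambda^n\to\lambda$ and $\nu^n\to\nu$. Write $F^n(s):=\nu^nW^n_{f^n(s)}-\lambda^n s$ for $s\ge 0$, so that $\Upsilon^n=F^n\circ X^n$. Then $$(F^n,X^n)\Rightarrow(F^*,X^* )\quad\text{on } D^\circ[0,T]\quad\text{as }n\to\infty,$$ where, for a standard Brownian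 motion $W^*$, $F^*(s)=\nu W^*_{f(s)}-\lambda s$ and $X^*_t=\inf\{s\ge 0:(1+\lambda)s-\nu W^*_{f(s)}>G_0(t)\}$, $t\le T$. In particular, $$\Upsilon^n\Rightarrow(X^*-G_0,I^* )\quad\text{on }\mathfrak D[0,T]\quad\text{as }n\to\infty,$$ with decorations $I^*_t=F^*([X^*_{t-},X^*_t])$ for $t\in D(X^* )$ and $I^*_t=\{X^*_t-G_0(t)\}$ for $t\notin D(X^* )$.
   Context: Weak solution: $(W,X)$ is a weak solution on $[0,T]$ for the input $(G_0,K,f,\lambda,\nu)$ if there is a filtered probability space $(\Omega,\mathcal F,(\mathcal G_t)_{t\ge 0},\mathbb P)$ supporting a $(\mathcal G_t)_{t\ge 0}$-Brownian motion $W$ and a non-decreasing continuous process $(X_t)_{t\le T}$ starting from $0$ such that: (i) for every $t\in[0,T]$, $f(X_t)$ is a $(\mathcal G_s)_{s\ge 0}$-stopping time; (ii) $(W_{f(X_t)})_{t\le T}$ is a martingale with respect to its own filtration; (iii) $X_t=G_0(t)+\int_0^tK(t-s)(-\lambda X_s+\nu W_{f(X_s)})\,ds$ holds $\mathbb P$-almost surely on $[0,T]$. Weak convergence $K^n(t)\,dt\Rightarrow\delta_0(dt)$ on $[0,T]$ means weak convergence of the measures $K^n(t)\,dt$ restricted to $[0,T]$ to the Dirac mass at $0$. $C[0,\infty)$ denotes the continuous paths $[0,\infty)\to\mathbb R$ with uniform convergence on compacts. $D[0,T]$ denotes the càdlàg paths $[0,T]\to\mathbb R$ and $D^\uparrow[0,T]\subset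 D[0,T]$ the non-negative non-decreasing ones, equipped with Skorokhod's $M_1$ topology (for $\tau^n,\tau\in D^\uparrow[0,T]$, $\tau^n\to\tau$ in $M_1$ if and only if $\tau^n(t)\to\tau(t)$ for all $t$ in a dense subset of $[0,T]$ containing $0$ and $T$). $D^\circ[0,T]:=\{(\phi,\tau):\phi\in C[0,\infty),\ \tau\in D^\uparrow[0,T]\}$ carries the product topology. For $z\in D[0,T]$, $D(z):=\{t\in(0,T]:z(t)\ne z(t-)\}$. Decorated Skorokhod space: $\mathfrak D[0,T]$ is the space of pairs $(x,I)$ with $x\in D[0,T]$ and $I=(I_t)_{t\in[0,T]}$ a family of compact subsets of $\mathbb R$ such that for all $t\in[0,T]$, $x(t-),x(t)\in I_t$ (with $x(0-):=x(0)$), $d_{\mathrm H}(I_s,\{x(t)\})\to0$ as $s\downarrow t$ and $d_{\mathrm H}(I_s,\{x(t-)\})\to0$ as $s\uparrow t$, where $d_{\mathrm H}$ is the Hausdorff distance on $\mathbb R$. Here $x$ is the base path and $I_t$ the decoration at time $t$. The graph $\Gamma(I):=\{(t,z)\in[0,T]\times\mathbb R:z\in I_t\}$ is compact, and $\mathfrak D[0,T]$ is equipped with $d_{\mathfrak D}((x,I),(x',I')):=\bar d_{\mathrm H}(\Gamma(I),\Gamma(I'))$, where $\bar d_{\mathrm H}$ is the Hausdorff metric on non-empty compact subsets of $[0,T]\times\mathbb R$ induced by $d_\infty((t,l),(t',l'))=|t-t'|\vee|l-l'|$. A path $x\in D[0,T]$ is identified with $(x,\iota(x))\in\mathfrak D[0,T]$,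 where $\iota(x)_t:=\{x(t-),x(t)\}$. *)

theory Defs
  imports "HOL-Probability.Probability"
begin

section \<open>Processes, Brownian motion and weak solutions\<close>

definition natural_filtration :: "'a measure \<Rightarrow> (real \<Rightarrow> 'a \<Rightarrow> real) \<Rightarrow> real \<Rightarrow> 'a measure" where
  "natural_filtration M Z t =
     sigma (space M) {Z s -` A \<inter> space M | s A. 0 \<le> s \<and> s \<le> t \<and> A \<in> sets borel}"

text \<open>Time runs through \<^typ>\<open>real\<close>, so a filtration also has \<sigma>-algebras at negative times. They
  carry no information: any filtration indexed by \<open>[0,\<infinity>)\<close> extends trivially to the negative
  half-line, and a non-negative \<^const>\<open>stopping_time\<close> imposes nothing there.\<close>

definition filtered_prob_space :: "'a measure \<Rightarrow> (real \<Rightarrow> 'a measure) \<Rightarrow> bool" where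
  "filtered_prob_space M F \<longleftrightarrow>
     prob_space M \<and> filtration (space M) F \<and> (\<forall>t. subalgebra M (F t))"

definition brownian_motion_wrt ::
    "'a measure \<Rightarrow> (real \<Rightarrow> 'a measure) \<Rightarrow> (real \<Rightarrow> 'a \<Rightarrow> real) \<Rightarrow> bool" where
  "brownian_motion_wrt M F W \<longleftrightarrow>
     filtered_prob_space M F \<and>
     (\<forall>t\<ge>0. W t \<in> borel_measurable (F t)) \<and>
     (\<forall>\<omega>\<in>space M. continuous_on {0..} (\<lambda>t. W t \<omega>)) \<and>
     (AE \<omega> in M. W 0 \<omega> = 0) \<and>
     (\<forall>s t. 0 \<le> s \<and> s < t \<longrightarrow>
        distributed M lborel (\<lambda>\<omega>. W t \<omega> - W s \<omega>)
          (\<lambda>x. ennreal (normal_density 0 (sqrt (t - s)) x)) \<and>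
        prob_space.indep_set M (sets (F s))
          (sets (vimage_algebra (space M) (\<lambda>\<omega>. W t \<omega> - W s \<omega>) borel)))"

definition standard_brownian_motion :: "'a measure \<Rightarrow> (real \<Rightarrow> 'a \<Rightarrow> real) \<Rightarrow> bool" where
  "standard_brownian_motion M W \<longleftrightarrow> brownian_motion_wrt M (natural_filtration M W) W"

definition own_martingale :: "'a measure \<Rightarrow> real \<Rightarrow> (real \<Rightarrow> 'a \<Rightarrow> real) \<Rightarrow> bool" where
  "own_martingale M T Z \<longleftrightarrow>
     (\<forall>t\<in>{0..T}. integrable M (Z t)) \<and>
     (\<forall>s t. 0 \<le> s \<and> s \<le> t \<and> t \<le> T \<longrightarrow>
        (AE \<omega> in M. real_cond_exp M (natural_filtration M Z s) (Z t) \<omega> = Z s \<omega>))"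

definition weak_solution ::
    "real \<Rightarrow> (real \<Rightarrow> real) \<Rightarrow> (real \<Rightarrow> real) \<Rightarrow> (real \<Rightarrow> real) \<Rightarrow> real \<Rightarrow> real \<Rightarrow>
     'a measure \<Rightarrow> (real \<Rightarrow> 'a \<Rightarrow> real) \<Rightarrow> (real \<Rightarrow> 'a \<Rightarrow> real) \<Rightarrow> bool" where
  "weak_solution T G\<^sub>0 K f lam nu M W X \<longleftrightarrow>
     (\<exists>F. brownian_motion_wrt M F W \<and>
        (\<forall>t\<in>{0..T}. X t \<in> borel_measurable M) \<and>
        (\<forall>\<omega>\<in>space M. X 0 \<omega> = 0 \<and> mono_on {0..T} (\<lambda>t. X t \<omega>) \<and>
           continuous_on {0..T} (\<lambda>t. X t \<omega>)) \<and>
        (\<forall>t\<in>{0..T}. stopping_time F (\<lambda>\<omega>. f (X t \<omega>))) \<and>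
        own_martingale M T (\<lambda>t \<omega>. W (f (X t \<omega>)) \<omega>) \<and>
        (AE \<omega> in M. \<forall>t\<in>{0..T}.
           X t \<omega> = G\<^sub>0 t + (LINT s:{0..t}|lebesgue.
             K (t - s) * (- lam * X s \<omega> + nu * W (f (X s \<omega>)) \<omega>))))"


section \<open>Assumptions on the coefficients\<close>

definition C1_linear_growth :: "(real \<Rightarrow> real) \<Rightarrow> bool" where
  "C1_linear_growth f \<longleftrightarrow>
     (\<exists>f'. continuous_on {0..} f' \<and>
        (\<forall>x\<ge>0. (f has_real_derivative f' x) (at x within {0..})) \<and>
        (\<exists>C. \<forall>x\<ge>0. \<bar>f' x\<bar> \<le> C * (1 + x)))"

definition locally_uniform_limit :: "(nat \<Rightarrow> real \<Rightarrow> real) \<Rightarrow> (real \<Rightarrow> real) \<Rightarrow> bool" where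
  "locally_uniform_limit fn f \<longleftrightarrow>
     (\<forall>x\<ge>0.
        ((\<lambda>\<delta>. limsup (\<lambda>n. SUP (s, r) \<in> ({x-\<delta>..x+\<delta>} \<inter> {0..}) \<times> ({x-\<delta>..x+\<delta>} \<inter> {0..}).
            ereal \<bar>fn n s - f r\<bar>)) \<longlongrightarrow> 0) (at_right 0))"


section \<open>Weak convergence on topological spaces\<close>

definition weakly_converges ::
    "'b topology \<Rightarrow> (nat \<Rightarrow> 'b measure) \<Rightarrow> 'b measure \<Rightarrow> bool" where
  "weakly_converges E \<mu>n \<mu> \<longleftrightarrow>
     (\<forall>h. continuous_map E euclideanreal h \<and> bounded (h ` topspace E) \<longrightarrow>
        (\<lambda>n. \<integral>x. h x \<partial>\<mu>n n) \<longlonglongrightarrow> (\<integral>x. h x \<partial>\<mu>))"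

definition borel_of :: "'b topology \<Rightarrow> 'b measure" where
  "borel_of E = sigma (topspace E) {U. openin E U}"

text \<open>A map into the state space counts as a random element if it agrees almost surely with a
  Borel measurable one. This matters for first-passage paths, which are real-valued (and
  cadlag) only almost surely.\<close>

definition converges_in_law ::
    "'b topology \<Rightarrow> (nat \<Rightarrow> 'a measure) \<Rightarrow> (nat \<Rightarrow> 'a \<Rightarrow> 'b) \<Rightarrow>
     'c measure \<Rightarrow> ('c \<Rightarrow> 'b) \<Rightarrow> bool" where
  "converges_in_law E M Z N Z' \<longleftrightarrow>
     (\<exists>Y Y'.
        (\<forall>n. Y n \<in> measurable (M n) (borel_of E) \<and> (AE \<omega> in M n. Y n \<omega> = Z n \<omega>)) \<and>
        Y' \<in> measurable N (borel_of E) \<and> (AE \<omega> in N. Y' \<omega> = Z' \<omega>) \<and>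
        weakly_converges E (\<lambda>n. distr (M n) (borel_of E) (Y n)) (distr N (borel_of E) Y'))"

text \<open>The topology of a distance function, without a proof obligation that it is a metric.\<close>

definition dist_topology :: "'b set \<Rightarrow> ('b \<Rightarrow> 'b \<Rightarrow> real) \<Rightarrow> 'b topology" where
  "dist_topology A d =
     topology (\<lambda>U. U \<subseteq> A \<and> (\<forall>x\<in>U. \<exists>e>0. \<forall>y\<in>A. d x y < e \<longrightarrow> y \<in> U))"

lemma openin_dist_topology:
  "openin (dist_topology A d) U \<longleftrightarrow>
     U \<subseteq> A \<and> (\<forall>x\<in>U. \<exists>e>0. \<forall>y\<in>A. d x y < e \<longrightarrow> y \<in> U)"
proof -
  have "istopology (\<lambda>U. U \<subseteq> A \<and> (\<forall>x\<in>U. \<exists>e>0. \<forall>y\<in>A. d x y < e \<longrightarrow> y \<in> U))" (is "istopology ?P")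
    unfolding istopology_def
  proof (intro conjI allI impI)
    fix S T assume S: "?P S" and T: "?P T"
    show "S \<inter> T \<subseteq> A" using S by blast
    show "\<forall>x\<in>S \<inter> T. \<exists>e>0. \<forall>y\<in>A. d x y < e \<longrightarrow> y \<in> S \<inter> T"
    proof
      fix x assume "x \<in> S \<inter> T"
      with S T obtain e1 e2 where "e1 > 0" "e2 > 0"
        "\<forall>y\<in>A. d x y < e1 \<longrightarrow> y \<in> S" "\<forall>y\<in>A. d x y < e2 \<longrightarrow> y \<in> T" by blast
      then show "\<exists>e>0. \<forall>y\<in>A. d x y < e \<longrightarrow> y \<in> S \<inter> T"
        by (intro exI[of _ "min e1 e2"]) auto
    qed
  next
    fix \<K> assume *: "\<forall>K\<in>\<K>. ?P K"
    show "\<Union>\<K> \<subseteq> A" using * by blast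
    show "\<forall>x\<in>\<Union>\<K>. \<exists>e>0. \<forall>y\<in>A. d x y < e \<longrightarrow> y \<in> \<Union>\<K>"
    proof
      fix x assume "x \<in> \<Union>\<K>"
      with * obtain K e where "K \<in> \<K>" "e > 0" "\<forall>y\<in>A. d x y < e \<longrightarrow> y \<in> K" by blast
      then show "\<exists>e>0. \<forall>y\<in>A. d x y < e \<longrightarrow> y \<in> \<Union>\<K>" by blast
    qed
  qed
  then show ?thesis
    by (simp add: dist_topology_def topology_inverse')
qed

lemma topspace_dist_topology [simp]: "topspace (dist_topology A d) = A"
proof
  show "topspace (dist_topology A d) \<subseteq> A"
    using openin_dist_topology[of A d] by (metis openin_topspace)
  have "openin (dist_topology A d) A"
    unfolding openin_dist_topology by (auto intro: exI[of _ 1])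
  then show "A \<subseteq> topspace (dist_topology A d)"
    by (rule openin_subset)
qed

lemma dist_topology_eq_mtopology:
  assumes "Metric_space A d"
  shows "dist_topology A d = Metric_space.mtopology A d"
proof -
  interpret Metric_space A d by fact
  have ball: "(\<forall>y\<in>A. d x y < e \<longrightarrow> y \<in> U) \<longleftrightarrow> mball x e \<subseteq> U" if "x \<in> A" for x e U
    using that unfolding mball_def by blast
  show ?thesis
    unfolding topology_eq
  proof
    fix U
    show "openin (dist_topology A d) U = openin mtopology U"
      unfolding openin_dist_topology openin_mtopology
      by (intro conj_cong refl ball_cong) (metis ball subsetD)
  qed
qed


section \<open>Path spaces\<close>

text \<open>Paths are extensional functions on their time domain.\<close>

definition continuous_paths :: "(real \<Rightarrow> real) set" where
  "continuous_paths = {\<phi> \<in> extensional {0..}. continuous_on {0..} \<phi>}"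

definition locally_uniform_topology :: "(real \<Rightarrow> real) topology" where
  "locally_uniform_topology = topology_generated_by
     {{\<psi> \<in> continuous_paths. \<forall>s\<in>K. \<bar>\<psi> s - \<phi> s\<bar> < e} | \<phi> K e.
        \<phi> \<in> continuous_paths \<and> compact K \<and> K \<subseteq> {0..} \<and> e > 0}"

definition cadlag_paths :: "real \<Rightarrow> (real \<Rightarrow> real) set" where
  "cadlag_paths T = {x \<in> extensional {0..T}.
     (\<forall>t\<in>{0..<T}. (x \<longlongrightarrow> x t) (at_right t)) \<and>
     (\<forall>t\<in>{0<..T}. \<exists>l. (x \<longlongrightarrow> l) (at_left t))}"

definition increasing_cadlag_paths :: "real \<Rightarrow> (real \<Rightarrow> real) set" where
  "increasing_cadlag_paths T =
     {x \<in> cadlag_paths T. (\<forall>t\<in>{0..T}. 0 \<le> x t) \<and> mono_on {0..T} x}"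

definition left_limit :: "(real \<Rightarrow> real) \<Rightarrow> real \<Rightarrow> real" where
  "left_limit x t = (if t = 0 then x 0 else Lim (at_left t) x)"

definition jump_times :: "real \<Rightarrow> (real \<Rightarrow> real) \<Rightarrow> real set" where
  "jump_times T x = {t \<in> {0<..T}. x t \<noteq> left_limit x t}"


subsection \<open>The M1 topology\<close>

text \<open>Skorokhod's M1 metric: the infimum of the uniform distance over all parametric
  representations of the completed graphs, which are ordered by time and, within a jump, by the
  distance from the left limit.\<close>

definition completed_graph :: "real \<Rightarrow> (real \<Rightarrow> real) \<Rightarrow> (real \<times> real) set" where
  "completed_graph T x = {(t, z). t \<in> {0..T} \<and> z \<in> closed_segment (left_limit x t) (x t)}"

definition graph_le :: "(real \<Rightarrow> real) \<Rightarrow> real \<times> real \<Rightarrow> real \<times> real \<Rightarrow> bool" where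
  "graph_le x p q \<longleftrightarrow> fst p < fst q \<or>
     (fst p = fst q \<and> \<bar>left_limit x (fst p) - snd p\<bar> \<le> \<bar>left_limit x (fst p) - snd q\<bar>)"

definition parametric_reps :: "real \<Rightarrow> (real \<Rightarrow> real) \<Rightarrow> (real \<Rightarrow> real \<times> real) set" where
  "parametric_reps T x = {p. continuous_on {0..1} p \<and> p ` {0..1} = completed_graph T x \<and>
     (\<forall>a\<in>{0..1}. \<forall>b\<in>{0..1}. a \<le> b \<longrightarrow> graph_le x (p a) (p b))}"

definition d_max :: "real \<times> real \<Rightarrow> real \<times> real \<Rightarrow> real" where
  "d_max p q = max \<bar>fst p - fst q\<bar> \<bar>snd p - snd q\<bar>"

definition M1_dist :: "real \<Rightarrow> (real \<Rightarrow> real) \<Rightarrow> (real \<Rightarrow> real) \<Rightarrow> real" where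
  "M1_dist T x y =
     (INF (p, q) \<in> parametric_reps T x \<times> parametric_reps T y. SUP a\<in>{0..1}. d_max (p a) (q a))"

definition D_circ_topology :: "real \<Rightarrow> ((real \<Rightarrow> real) \<times> (real \<Rightarrow> real)) topology" where
  "D_circ_topology T = prod_topology locally_uniform_topology
     (dist_topology (increasing_cadlag_paths T) (M1_dist T))"


subsection \<open>The decorated Skorokhod space\<close>

definition hausdorff_dist :: "('b \<Rightarrow> 'b \<Rightarrow> real) \<Rightarrow> 'b set \<Rightarrow> 'b set \<Rightarrow> real" where
  "hausdorff_dist d A B = max (SUP a\<in>A. INF b\<in>B. d a b) (SUP b\<in>B. INF a\<in>A. d a b)"

definition decorated_paths :: "real \<Rightarrow> ((real \<Rightarrow> real) \<times> (real \<Rightarrow> real set)) set" where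
  "decorated_paths T = {(x, I). x \<in> cadlag_paths T \<and> I \<in> extensional {0..T} \<and>
     (\<forall>t\<in>{0..T}. compact (I t) \<and> left_limit x t \<in> I t \<and> x t \<in> I t) \<and>
     (\<forall>t\<in>{0..<T}. ((\<lambda>s. hausdorff_dist dist (I s) {x t}) \<longlongrightarrow> 0) (at_right t)) \<and>
     (\<forall>t\<in>{0<..T}. ((\<lambda>s. hausdorff_dist dist (I s) {left_limit x t}) \<longlongrightarrow> 0) (at_left t))}"

definition decoration_graph :: "real \<Rightarrow> (real \<Rightarrow> real set) \<Rightarrow> (real \<times> real) set" where
  "decoration_graph T I = {(t, z). t \<in> {0..T} \<and> z \<in> I t}"

definition decorated_topology :: "real \<Rightarrow> ((real \<Rightarrow> real) \<times> (real \<Rightarrow> real set)) topology" where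
  "decorated_topology T = dist_topology (decorated_paths T)
     (\<lambda>(x, I) (x', I'). hausdorff_dist d_max (decoration_graph T I) (decoration_graph T I'))"

definition embed_path :: "real \<Rightarrow> (real \<Rightarrow> real) \<Rightarrow> (real \<Rightarrow> real) \<times> (real \<Rightarrow> real set)" where
  "embed_path T x = (x, \<lambda>t\<in>{0..T}. {left_limit x t, x t})"


section \<open>The processes of the limit theorem\<close>

definition forcing :: "real \<Rightarrow> real \<Rightarrow> (real \<Rightarrow> real) \<Rightarrow> (real \<Rightarrow> 'a \<Rightarrow> real) \<Rightarrow> 'a \<Rightarrow> real \<Rightarrow> real" where
  "forcing nu lam f W \<omega> = (\<lambda>s\<in>{0..}. nu * W (f s) \<omega> - lam * s)"

definition first_passage ::
    "real \<Rightarrow> (real \<Rightarrow> real) \<Rightarrow> real \<Rightarrow> real \<Rightarrow> (real \<Rightarrow> real) \<Rightarrow> (real \<Rightarrow> 'a \<Rightarrow> real) \<Rightarrow>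
     'a \<Rightarrow> real \<Rightarrow> real" where
  "first_passage T G\<^sub>0 nu lam f W \<omega> =
     (\<lambda>t\<in>{0..T}. Inf {s. 0 \<le> s \<and> (1 + lam) * s - nu * W (f s) \<omega> > G\<^sub>0 t})"

definition jump_decoration ::
    "real \<Rightarrow> (real \<Rightarrow> real) \<Rightarrow> (real \<Rightarrow> real) \<Rightarrow> (real \<Rightarrow> real) \<Rightarrow> real \<Rightarrow> real set" where
  "jump_decoration T G\<^sub>0 \<phi> x = (\<lambda>t\<in>{0..T}.
     if t \<in> jump_times T x then \<phi> ` {left_limit x t..x t} else {x t - G\<^sub>0 t})"

end

theory Submission
  imports Defs
begin

text \<open>Write \<open>h s = (1 + lam') * s - nu' * W (f' s)\<close>, so that the limit \<open>X\<^sup>*\<close> is the first passage time of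
  \<open>h\<close> above \<open>G' t\<close> and \<open>F\<^sup>* s = s - h s\<close>. When the kernels concentrate at \<open>0\<close>, the equation
  \<open>X = G + K * F(X)\<close> turns into \<open>X\<^sub>t - F(X\<^sub>t) = G t\<close>, that is \<open>h (X\<^sub>t) = G t\<close>: the solution always sits
  at a place where \<open>h\<close> has the right level. The equation alone does not say that it is the first
  such place, because within a short time the solution may run across an excursion of \<open>h\<close> above
  the level. The martingale property rules this out, through a comparison of means.

  Path by path, for large \<open>n\<close> and off an event of small probability, the solution is not smaller
  than the first passage time over any given level \<open>c < G' t\<close> (lemma \<open>passage_below_solution\<close>): the convolution is an average of \<open>F\<close> over the values that \<open>X\<close>
  took just before, so some such value \<open>z\<close> satisfies \<open>F z \<le> X\<^sub>t - G t\<close> up to small errors, and \<open>z\<close> is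
  close to \<open>X\<^sub>t\<close> if the window is one in which \<open>X\<close> hardly grows. In the mean, the solution is
  asymptotically at most \<open>G' t / (1 + lam')\<close> (\<open>upper_mean\<close>), because \<open>W\<close> at the random clock
  has mean zero. And by optional stopping the first passage time over \<open>c\<close> has mean exactly
  \<open>c / (1 + lam')\<close> for \<open>c \<ge> 0\<close> (\<open>passage_mean\<close>); this is where the quadratic growth of the clocks enters, as it
  turns integrability of the passage time into uniform integrability of the stopped Brownian
  motion. A variable that is not smaller than another one and has no larger mean is equal to it,
  and the quantitative form of this remark is \<open>solution_close_to_passage\<close>.

  The comparison takes place on the space of \<open>X\<^sup>n\<close>: there the limit functional is applied to the
  driving path \<open>W\<^sup>n\<close> itself. Its law is the same for every \<open>n\<close>, because the law of a Brownian path
  is unique (\<open>brownian_law_unique\<close>), and so closeness in probability yields convergence in law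
  (\<open>weakly_converges_of_close\<close>), with the fixed law in the part of tightness.

  Closeness of paths is measured by a Levy-type gauge. For the monotone component it follows from
  closeness at the finitely many times of a fine grid, and it controls the M1 distance, since the completed
  graphs of close monotone paths have close canonical parametrisations. The statement on
  decorated paths is the image of the first one under the continuous map \<open>decorate\<close>, which runs
  \<open>F\<close> along the completed graph of \<open>X\<close>.\<close>

section \<open>A gauge on pairs of paths\<close>

definition path_space :: "real \<Rightarrow> ((real \<Rightarrow> real) \<times> (real \<Rightarrow> real)) set" where
  "path_space T = continuous_paths \<times> increasing_cadlag_paths T"

text \<open>Each path lies between two shifts of the other one, where both are extended by constants outside
  \<open>[0, T]\<close>. Letting \<open>t\<close> range over all reals makes the values at the end points count, as they do for
  M1, and makes the relation symmetric.\<close>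

definition levy_close :: "real \<Rightarrow> real \<Rightarrow> (real \<Rightarrow> real) \<Rightarrow> (real \<Rightarrow> real) \<Rightarrow> bool" where
  "levy_close T e x y \<longleftrightarrow> (\<forall>t. x (max 0 (min T (t - e))) - e \<le> y (max 0 (min T t)) \<and>
     y (max 0 (min T t)) \<le> x (max 0 (min T (t + e))) + e)"

text \<open>The single parameter bounds the error and, through \<open>1/e\<close>, the window on which the continuous
  components are compared; both requirements relax as \<open>e\<close> grows.\<close>

definition path_close where
  "path_close T e p q \<longleftrightarrow>
     (\<forall>s\<in>{0..1/e}. \<bar>fst p s - fst q s\<bar> \<le> e) \<and> levy_close T e (snd p) (snd q)"

text \<open>The value \<open>1\<close> is put into the set so that the infimum is over a non-empty set; only small
  distances matter for the topology.\<close>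

definition path_dist where
  "path_dist T p q = Inf (insert (1::real) {e. 0 < e \<and> path_close T e p q})"

text \<open>A shift of \<open>t\<close> by \<open>e\<close> turns each half of the definition into the other one.\<close>

lemma levy_close_sym:
  assumes "levy_close T e x y" shows "levy_close T e y x"
  unfolding levy_close_def
proof (intro allI conjI)
  fix t
  show "y (max 0 (min T (t - e))) - e \<le> x (max 0 (min T t))"
    using assms[unfolded levy_close_def, rule_format, of "t - e"] by simp
  show "x (max 0 (min T t)) \<le> y (max 0 (min T (t + e))) + e"
    using assms[unfolded levy_close_def, rule_format, of "t + e"] by simp
qed

lemma levy_close_trans:
  assumes "levy_close T e x y" "levy_close T e' y z" shows "levy_close T (e + e') x z"
  unfolding levy_close_def
proof (intro allI conjI)
  fix t
  have "x (max 0 (min T ((t - e') - e))) - e \<le> y (max 0 (min T (t - e')))"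
    "y (max 0 (min T (t - e'))) - e' \<le> z (max 0 (min T t))"
    using assms unfolding levy_close_def by blast+
  then show "x (max 0 (min T (t - (e + e')))) - (e + e') \<le> z (max 0 (min T t))"
    by (simp add: algebra_simps)
  have "y (max 0 (min T (t + e'))) \<le> x (max 0 (min T ((t + e') + e))) + e"
    "z (max 0 (min T t)) \<le> y (max 0 (min T (t + e'))) + e'"
    using assms unfolding levy_close_def by blast+
  then show "z (max 0 (min T t)) \<le> x (max 0 (min T (t + (e + e')))) + (e + e')"
    by (simp add: algebra_simps)
qed

lemma path_close_sym: "path_close T e p q \<Longrightarrow> path_close T e q p"
  unfolding path_close_def by (auto simp: levy_close_sym abs_minus_commute)

lemma path_close_trans:
  assumes "path_close T e p q" "path_close T e' q r" "0 < e" "0 < e'"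
  shows "path_close T (e + e') p r"
  unfolding path_close_def
proof (intro conjI ballI)
  show "levy_close T (e + e') (snd p) (snd r)"
    using assms levy_close_trans unfolding path_close_def by blast
  fix s assume s: "s \<in> {0..1 / (e + e')}"
  have "1 / (e + e') \<le> 1 / e" "1 / (e + e') \<le> 1 / e'" using assms by (auto simp: frac_le)
  with s have "s \<in> {0..1/e}" "s \<in> {0..1/e'}" by auto
  then have "\<bar>fst p s - fst q s\<bar> \<le> e" "\<bar>fst q s - fst r s\<bar> \<le> e'"
    using assms unfolding path_close_def by blast+
  then show "\<bar>fst p s - fst r s\<bar> \<le> e + e'" by linarith
qed

lemma increasing_mono: "x \<in> increasing_cadlag_paths T \<Longrightarrow> mono_on {0..T} x"
  by (simp add: increasing_cadlag_paths_def)

lemma increasing_clamp_le: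
  assumes "x \<in> increasing_cadlag_paths T" "0 < T" "s \<le> t"
  shows "x (max 0 (min T s)) \<le> x (max 0 (min T t))"
  by (rule mono_onD[OF increasing_mono[OF assms(1)]]) (use assms in auto)

lemma levy_close_weaken:
  assumes "levy_close T e x y" "e \<le> e'" "x \<in> increasing_cadlag_paths T" "0 < T"
  shows "levy_close T e' x y"
  unfolding levy_close_def
proof (intro allI conjI)
  fix t
  have "x (max 0 (min T (t - e))) - e \<le> y (max 0 (min T t))"
     "y (max 0 (min T t)) \<le> x (max 0 (min T (t + e))) + e"
    using assms unfolding levy_close_def by blast+
  moreover have "x (max 0 (min T (t - e'))) \<le> x (max 0 (min T (t - e)))"
    "x (max 0 (min T (t + e))) \<le> x (max 0 (min T (t + e')))"
    by (rule increasing_clamp_le[OF assms(3,4)], use assms in simp)+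
  ultimately show "x (max 0 (min T (t - e'))) - e' \<le> y (max 0 (min T t))"
     "y (max 0 (min T t)) \<le> x (max 0 (min T (t + e'))) + e'"
    using assms(2) by linarith+
qed

lemma path_close_weaken:
  assumes "path_close T e p q" "0 < e" "e \<le> e'" "p \<in> path_space T" "0 < T"
  shows "path_close T e' p q"
  unfolding path_close_def
proof (intro conjI ballI)
  have "snd p \<in> increasing_cadlag_paths T" using assms by (auto simp: path_space_def)
  then show "levy_close T e' (snd p) (snd q)"
    using assms levy_close_weaken unfolding path_close_def by blast
  fix s assume "s \<in> {0..1 / e'}"
  moreover have "1 / e' \<le> 1 / e" using assms by (auto simp: frac_le)
  ultimately have "\<bar>fst p s - fst q s\<bar> \<le> e" using assms(1) unfolding path_close_def by auto
  then show "\<bar>fst p s - fst q s\<bar> \<le> e'" using assms(3) by linarith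
qed

lemma path_close_refl:
  assumes "p \<in> path_space T" "0 < T" "0 < e" shows "path_close T e p p"
proof -
  have x: "snd p \<in> increasing_cadlag_paths T" using assms by (auto simp: path_space_def)
  have "snd p (max 0 (min T (t - e))) - e \<le> snd p (max 0 (min T t))"
    "snd p (max 0 (min T t)) \<le> snd p (max 0 (min T (t + e))) + e" for t
    using increasing_clamp_le[OF x assms(2), of "t - e" t]
      increasing_clamp_le[OF x assms(2), of t "t + e"] assms(3) by auto
  then show ?thesis using assms(3) unfolding path_close_def levy_close_def by auto
qed

lemma path_dist_bdd: "bdd_below (insert (1::real) {e. 0 < e \<and> path_close T e p q})"
  by (rule bdd_belowI[of _ 0]) auto

lemma path_dist_nonneg: "0 \<le> path_dist T p q"
  unfolding path_dist_def by (rule cInf_greatest) auto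

lemma path_dist_le_1: "path_dist T p q \<le> 1"
  unfolding path_dist_def by (rule cInf_lower) (use path_dist_bdd in auto)

lemma path_dist_le: "path_close T e p q \<Longrightarrow> 0 < e \<Longrightarrow> path_dist T p q \<le> e"
  unfolding path_dist_def by (rule cInf_lower) (use path_dist_bdd in auto)

lemma path_dist_less_imp_close:
  assumes "path_dist T p q < e" "e \<le> 1" "p \<in> path_space T" "0 < T"
  shows "path_close T e p q"
proof -
  obtain e' where "e' \<in> insert 1 {e. 0 < e \<and> path_close T e p q}" "e' < e"
    using assms(1) unfolding path_dist_def by (meson cInf_lessD insert_not_empty)
  then show ?thesis using path_close_weaken[of T e' p q e] assms path_dist_le_1[of T p q] by fastforce
qed

lemma path_dist_sym: "path_dist T p q = path_dist T q p"
proof -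
  have "path_close T e p q = path_close T e q p" for e using path_close_sym by blast
  then show ?thesis unfolding path_dist_def by simp
qed

lemma path_dist_refl:
  assumes "p \<in> path_space T" "0 < T" shows "path_dist T p p = 0"
proof (rule antisym[OF _ path_dist_nonneg], rule field_le_epsilon)
  fix e :: real assume "0 < e"
  then show "path_dist T p p \<le> 0 + e"
    using path_dist_le[OF path_close_refl[OF assms]] by simp
qed

lemma path_dist_triangle: "path_dist T p r \<le> path_dist T p q + path_dist T q r"
proof -
  let ?A = "insert (1::real) {e. 0 < e \<and> path_close T e p q}"
  let ?B = "insert (1::real) {e. 0 < e \<and> path_close T e q r}"
  have *: "path_dist T p r \<le> a + b" if "a \<in> ?A" "b \<in> ?B" for a b
  proof (cases "a = 1 \<or> b = 1")
    case True
    then have "1 \<le> a + b" using that by auto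
    then show ?thesis using path_dist_le_1[of T p r] by linarith
  next
    case False
    then have "0 < a" "0 < b" "path_close T a p q" "path_close T b q r" using that by blast+
    then show ?thesis
      using path_dist_le[OF path_close_trans[of T a p q b r]] by simp
  qed
  have **: "path_dist T p r - b \<le> path_dist T p q" if "b \<in> ?B" for b
    unfolding path_dist_def[of T p q]
  proof (rule cInf_greatest)
    fix a assume "a \<in> ?A"
    from *[OF this that] show "path_dist T p r - b \<le> a" by simp
  qed simp
  have "path_dist T p r - path_dist T p q \<le> path_dist T q r"
    unfolding path_dist_def[of T q r]
  proof (rule cInf_greatest)
    fix b assume "b \<in> ?B"
    from **[OF this] show "path_dist T p r - path_dist T p q \<le> b" by linarith
  qed simp
  then show ?thesis by simp
qed

section \<open>Canonical parametrisation of a monotone graph\<close>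

lemma increasing_nonneg: "x \<in> increasing_cadlag_paths T \<Longrightarrow> t \<in> {0..T} \<Longrightarrow> 0 \<le> x t"
  by (simp add: increasing_cadlag_paths_def)

lemma increasing_le:
  assumes "x \<in> increasing_cadlag_paths T" "0 \<le> s" "s \<le> t" "t \<le> T"
  shows "x s \<le> x t"
  by (rule mono_onD[OF increasing_mono[OF assms(1)]]) (use assms in auto)

lemma increasing_right:
  assumes "x \<in> increasing_cadlag_paths T" "0 \<le> t" "t < T"
  shows "(x \<longlongrightarrow> x t) (at_right t)"
  using assms by (auto simp: increasing_cadlag_paths_def cadlag_paths_def)

lemma cadlag_left_limit:
  assumes "x \<in> cadlag_paths T" "0 < t" "t \<le> T"
  shows "(x \<longlongrightarrow> left_limit x t) (at_left t)"
proof -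
  have "\<exists>l. (x \<longlongrightarrow> l) (at_left t)"
    using assms by (simp add: cadlag_paths_def)
  then obtain l where "(x \<longlongrightarrow> l) (at_left t)" ..
  then show ?thesis using assms(2) tendsto_Lim[of "at_left t" x l]
    by (simp add: left_limit_def trivial_limit_at_left_real)
qed

lemma increasing_left_limit:
  assumes "x \<in> increasing_cadlag_paths T" "0 < t" "t \<le> T"
  shows "(x \<longlongrightarrow> left_limit x t) (at_left t)"
  by (rule cadlag_left_limit) (use assms in \<open>simp_all add: increasing_cadlag_paths_def\<close>)

lemma left_limit_upper:
  assumes "x \<in> increasing_cadlag_paths T" "0 \<le> s" "s < t" "t \<le> T"
  shows "x s \<le> left_limit x t"
proof (rule tendsto_lowerbound[OF increasing_left_limit[OF assms(1)]])
  show "\<forall>\<^sub>F r in at_left t. x s \<le> x r"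
    using eventually_at_left_real[OF assms(3)]
    by eventually_elim (use increasing_le[OF assms(1)] assms in auto)
qed (use assms in \<open>auto simp: trivial_limit_at_left_real\<close>)

text \<open>The slope \<open>b\<close> is there because points of the graph with given time plus height lie on an
  antidiagonal, so heights are compared with affine functions of time.\<close>

lemma left_limit_lower:
  assumes "x \<in> increasing_cadlag_paths T" "0 < t" "t \<le> T" "\<And>s. 0 \<le> s \<Longrightarrow> s < t \<Longrightarrow> x s \<le> c + b * s"
  shows "left_limit x t \<le> c + b * t"
proof (rule tendsto_le[OF _ _ increasing_left_limit[OF assms(1)]])
  show "((\<lambda>s. c + b * s) \<longlongrightarrow> c + b * t) (at_left t)" by (intro tendsto_intros)
  show "\<forall>\<^sub>F r in at_left t. x r \<le> c + b * r"
    using eventually_at_left_real[OF assms(2)]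
    by eventually_elim (use assms in auto)
qed (use assms in \<open>auto simp: trivial_limit_at_left_real\<close>)

lemma left_limit_le:
  assumes "x \<in> increasing_cadlag_paths T" "0 \<le> t" "t \<le> T"
  shows "left_limit x t \<le> x t"
proof (cases "t = 0")
  case False
  then show ?thesis
    using left_limit_lower[OF assms(1), of t "x t" 0] assms increasing_le[OF assms(1)] by auto
qed (simp add: left_limit_def)

text \<open>A monotone path has a distinguished parametrisation of its completed graph, namely by time plus
  height. In it both coordinates are 1-Lipschitz, which is the reason why close paths have uniformly
  close parametrisations.\<close>

definition graph_length :: "real \<Rightarrow> (real \<Rightarrow> real) \<Rightarrow> real" where
  "graph_length T x = T + x T - x 0"

text \<open>The generalised inverse of the strictly increasing function \<open>t + x t - x 0\<close>.\<close>

definition graph_time :: "real \<Rightarrow> (real \<Rightarrow> real) \<Rightarrow> real \<Rightarrow> real" where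
  "graph_time T x u = Inf {t \<in> {0..T}. u \<le> t + x t - x 0}"

definition graph_param :: "real \<Rightarrow> (real \<Rightarrow> real) \<Rightarrow> real \<Rightarrow> real \<times> real" where
  "graph_param T x a = (let u = a * graph_length T x in
     (graph_time T x u, u + x 0 - graph_time T x u))"

context
  fixes T :: real and x :: "real \<Rightarrow> real"
  assumes T: "0 < T" and x: "x \<in> increasing_cadlag_paths T"
begin

lemma graph_length_pos: "0 < graph_length T x"
  using increasing_le[OF x, of 0 T] T by (simp add: graph_length_def)

lemma graph_time_le:
  assumes "0 \<le> t" "t \<le> T" "u \<le> t + x t - x 0"
  shows "graph_time T x u \<le> t"
  unfolding graph_time_def by (rule cInf_lower) (use assms in \<open>auto intro!: bdd_belowI[of _ 0]\<close>)

lemma graph_time_ge: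
  assumes "u \<le> graph_length T x" "\<And>s. 0 \<le> s \<Longrightarrow> s \<le> T \<Longrightarrow> u \<le> s + x s - x 0 \<Longrightarrow> t \<le> s"
  shows "t \<le> graph_time T x u"
  unfolding graph_time_def
proof (rule cInf_greatest)
  have "T \<in> {t \<in> {0..T}. u \<le> t + x t - x 0}" using assms(1) T by (simp add: graph_length_def)
  then show "{t \<in> {0..T}. u \<le> t + x t - x 0} \<noteq> {}" by blast
qed (use assms in auto)

lemma graph_time_range:
  assumes "u \<le> graph_length T x"
  shows "0 \<le> graph_time T x u" "graph_time T x u \<le> T"
  using graph_time_le[of T u] graph_time_ge[of u 0] assms T by (auto simp: graph_length_def)

lemma below_graph_time:
  assumes "0 \<le> s" "s < graph_time T x u" "s \<le> T"
  shows "s + x s - x 0 < u"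
  using graph_time_le[of s u] assms by linarith

text \<open>By right-continuity the infimum that defines \<open>graph_time\<close> is attained.\<close>

lemma at_graph_time:
  assumes "u \<le> graph_length T x"
  shows "u \<le> graph_time T x u + x (graph_time T x u) - x 0"
proof (cases "graph_time T x u = T")
  case True
  then show ?thesis using assms by (simp add: graph_length_def)
next
  case False
  define t where "t = graph_time T x u"
  have t: "0 \<le> t" "t < T" using graph_time_range[OF assms] False by (auto simp: t_def)
  have "u \<le> r + x r - x 0" if "t < r" "r < T" for r
  proof (rule ccontr)
    assume "\<not> ?thesis"
    then have "r \<le> s" if "0 \<le> s" "s \<le> T" "u \<le> s + x s - x 0" for s
      using that increasing_le[OF x, of s r] \<open>r < T\<close> by fastforce
    then have "r \<le> t" unfolding t_def by (intro graph_time_ge assms) auto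
    with that show False by simp
  qed
  then have ev: "\<forall>\<^sub>F r in at_right t. u \<le> r + x r - x 0"
    using eventually_at_right_real[OF t(2)] by (auto elim: eventually_mono)
  have "((\<lambda>r. r + x r - x 0) \<longlongrightarrow> t + x t - x 0) (at_right t)"
    by (intro tendsto_intros increasing_right[OF x] t)
  then have "u \<le> t + x t - x 0"
    by (rule tendsto_lowerbound[OF _ ev]) (simp add: trivial_limit_at_right_real)
  then show ?thesis by (simp add: t_def)
qed

lemma graph_time_mono:
  assumes "u \<le> v" "v \<le> graph_length T x"
  shows "graph_time T x u \<le> graph_time T x v"
  by (rule graph_time_le) (use at_graph_time[OF assms(2)] graph_time_range[OF assms(2)] assms in auto)

text \<open>The function that is being inverted has increments at least as large as those of time.\<close>

lemma graph_time_lipschitz: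
  assumes "u \<le> v" "v \<le> graph_length T x"
  shows "graph_time T x v \<le> graph_time T x u + (v - u)"
proof (cases "graph_time T x u + (v - u) \<le> T")
  case True
  have u: "u \<le> graph_length T x" using assms by simp
  have "x (graph_time T x u) \<le> x (graph_time T x u + (v - u))"
    using graph_time_range[OF u] True assms by (intro increasing_le[OF x]) auto
  then show ?thesis
    using at_graph_time[OF u] graph_time_range[OF u] True assms by (intro graph_time_le) auto
next
  case False
  then show ?thesis using graph_time_range[OF assms(2)] by simp
qed

lemma left_limit_at_graph_time:
  assumes "0 \<le> u" "u \<le> graph_length T x"
  shows "left_limit x (graph_time T x u) \<le> u + x 0 - graph_time T x u"
proof (cases "graph_time T x u = 0")
  case True
  then show ?thesis using assms by (simp add: left_limit_def)
next
  case False
  then have "0 < graph_time T x u" "graph_time T x u \<le> T" using graph_time_range[OF assms(2)] by auto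
  then have "left_limit x (graph_time T x u) \<le> (u + x 0) + (-1) * graph_time T x u"
    by (intro left_limit_lower[OF x]) (use below_graph_time[of _ u] in \<open>force\<close>)+
  then show ?thesis by simp
qed

lemma graph_time_eq:
  assumes "0 \<le> t" "t \<le> T" "left_limit x t \<le> z" "z \<le> x t"
  shows "graph_time T x (t + z - x 0) = t"
proof (rule antisym)
  have "t + x t - x 0 \<le> graph_length T x"
    using increasing_le[OF x, of t T] assms by (simp add: graph_length_def)
  then have le: "t + z - x 0 \<le> graph_length T x" using assms by simp
  show "graph_time T x (t + z - x 0) \<le> t" by (rule graph_time_le) (use assms in auto)
  show "t \<le> graph_time T x (t + z - x 0)"
  proof (rule graph_time_ge[OF le], rule ccontr)
    fix s assume s: "0 \<le> s" "s \<le> T" "t + z - x 0 \<le> s + x s - x 0" "\<not> t \<le> s"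
    then have "x s \<le> left_limit x t" using left_limit_upper[OF x, of s t] assms by auto
    then show False using s assms by simp
  qed
qed

text \<open>A point \<open>(t, z)\<close> of the completed graph is reached at the parameter \<open>t + z - x 0\<close>, before which the
  graph only has points with earlier time or smaller height.\<close>

lemma graph_param_image: "graph_param T x ` {0..1} = completed_graph T x"
proof
  have scale: "0 \<le> a * graph_length T x" "a * graph_length T x \<le> graph_length T x"
    if "a \<in> {0..1}" for a
    using that graph_length_pos by (auto simp: mult_left_le_one_le)
  show "graph_param T x ` {0..1} \<subseteq> completed_graph T x"
  proof
    fix p assume "p \<in> graph_param T x ` {0..1}"
    then obtain a where a: "a \<in> {0..1}" "p = graph_param T x a" by blast
    define u where "u = a * graph_length T x"
    have u: "0 \<le> u" "u \<le> graph_length T x" unfolding u_def using scale[OF a(1)] by auto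
    have "left_limit x (graph_time T x u) \<le> u + x 0 - graph_time T x u"
      by (rule left_limit_at_graph_time[OF u])
    moreover have "u + x 0 - graph_time T x u \<le> x (graph_time T x u)"
      using at_graph_time[OF u(2)] by simp
    ultimately show "p \<in> completed_graph T x"
      using graph_time_range[OF u(2)]
      by (auto simp: a(2) graph_param_def completed_graph_def closed_segment_eq_real_ivl simp flip: u_def)
  qed
  show "completed_graph T x \<subseteq> graph_param T x ` {0..1}"
  proof
    fix p assume "p \<in> completed_graph T x"
    then obtain t z where p: "p = (t, z)" "0 \<le> t" "t \<le> T" "z \<in> closed_segment (left_limit x t) (x t)"
      by (auto simp: completed_graph_def)
    then have z: "left_limit x t \<le> z" "z \<le> x t"
      using left_limit_le[OF x p(2,3)] by (auto simp: closed_segment_eq_real_ivl)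
    have "x 0 \<le> left_limit x t"
      using left_limit_upper[OF x, of 0 t] p by (cases "t = 0") (auto simp: left_limit_def)
    then have u: "0 \<le> t + z - x 0" "t + z - x 0 \<le> graph_length T x"
      using p z increasing_le[OF x, of t T] by (auto simp: graph_length_def)
    define a where "a = (t + z - x 0) / graph_length T x"
    have "a \<in> {0..1}" "a * graph_length T x = t + z - x 0"
      using u graph_length_pos by (auto simp: a_def)
    moreover have "graph_param T x a = p"
      using graph_time_eq[OF p(2,3) z] by (simp add: graph_param_def calculation p)
    ultimately show "p \<in> graph_param T x ` {0..1}" by (metis imageI)
  qed
qed

lemma graph_time_continuous: "continuous_on {..graph_length T x} (graph_time T x)"
proof (rule lipschitz_on_continuous_on[of 1])
  show "1-lipschitz_on {..graph_length T x} (graph_time T x)"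
  proof (rule lipschitz_onI)
    fix u v assume uv: "u \<in> {..graph_length T x}" "v \<in> {..graph_length T x}"
    show "dist (graph_time T x u) (graph_time T x v) \<le> 1 * dist u v"
      using graph_time_mono[of u v] graph_time_lipschitz[of u v]
        graph_time_mono[of v u] graph_time_lipschitz[of v u] uv
      by (cases "u \<le> v") (auto simp: dist_real_def)
  qed simp
qed

lemma graph_param_rep: "graph_param T x \<in> parametric_reps T x"
proof -
  let ?L = "graph_length T x"
  have scale: "0 \<le> a * ?L" "a * ?L \<le> ?L" if "a \<in> {0..1}" for a
    using that graph_length_pos by (auto simp: mult_left_le_one_le)
  have time: "continuous_on {0..1} (\<lambda>a. graph_time T x (a * ?L))"
    by (rule continuous_on_compose2[OF graph_time_continuous])
      (use scale in \<open>auto intro!: continuous_intros\<close>)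
  have "continuous_on {0..1} (graph_param T x)"
    unfolding graph_param_def Let_def by (intro continuous_intros time)
  moreover have "graph_le x (graph_param T x a) (graph_param T x b)"
    if ab: "a \<in> {0..1}" "b \<in> {0..1}" "a \<le> b" for a b
  proof -
    let ?u = "a * ?L" and ?v = "b * ?L"
    have uv: "?u \<le> ?v" using ab graph_length_pos by (simp add: mult_right_mono)
    have m: "graph_time T x ?u \<le> graph_time T x ?v" by (rule graph_time_mono[OF uv scale(2)[OF ab(2)]])
    show ?thesis
    proof (cases "graph_time T x ?u = graph_time T x ?v")
      case True
      have "left_limit x (graph_time T x ?u) \<le> ?u + x 0 - graph_time T x ?u"
        by (rule left_limit_at_graph_time[OF scale[OF ab(1)]])
      then show ?thesis using True uv by (simp add: graph_le_def graph_param_def Let_def)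
    next
      case False
      then show ?thesis using m by (simp add: graph_le_def graph_param_def Let_def)
    qed
  qed
  ultimately show ?thesis unfolding parametric_reps_def using graph_param_image by auto
qed

end

lemma levy_close_endpoints:
  assumes "levy_close T e x y" "0 < T" "0 \<le> e"
  shows "\<bar>x 0 - y 0\<bar> \<le> e" "\<bar>x T - y T\<bar> \<le> e"
proof -
  have *: "x (max 0 (min T (t - e))) - e \<le> y (max 0 (min T t))"
    "y (max 0 (min T t)) \<le> x (max 0 (min T (t + e))) + e" for t
    using assms(1) unfolding levy_close_def by blast+
  show "\<bar>x 0 - y 0\<bar> \<le> e" using *(1)[of 0] *(2)[of "-e"] assms by (simp add: max_def min_def split: if_splits)
  show "\<bar>x T - y T\<bar> \<le> e" using *(1)[of "T + e"] *(2)[of "T"] assms by (simp add: max_def min_def split: if_splits)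
qed

text \<open>At the shifted time \<open>t + e\<close> the graph of \<open>x\<close> is at least as long as that of \<open>y\<close> at time \<open>t\<close>, up to an
  error \<open>e\<close> in each of \<open>y t\<close> and \<open>y 0\<close>. The Lipschitz property bridges what remains.\<close>

lemma graph_time_compare:
  assumes T: "0 < T" and x: "x \<in> increasing_cadlag_paths T" and y: "y \<in> increasing_cadlag_paths T"
    and c: "levy_close T e x y" and e: "0 \<le> e"
    and u: "u \<le> graph_length T x" and v: "v \<le> graph_length T y"
  shows "graph_time T x u \<le> graph_time T y v + 3 * e + \<bar>u - v\<bar>"
proof -
  define t where "t = graph_time T y v"
  have t: "0 \<le> t" "t \<le> T" using graph_time_range[OF T y v] by (auto simp: t_def)
  define t' where "t' = min T (t + e)"
  have t': "0 \<le> t'" "t' \<le> T" "t \<le> t'" "t' \<le> t + e" using t e by (auto simp: t'_def)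
  have "y (max 0 (min T t)) \<le> x (max 0 (min T (t + e))) + e"
    using c unfolding levy_close_def by blast
  then have "y t \<le> x t' + e" using t t' by (simp add: t'_def)
  moreover have "v \<le> t + y t - y 0" unfolding t_def by (rule at_graph_time[OF T y v])
  moreover have "x 0 \<le> y 0 + e" using levy_close_endpoints(1)[OF c T e] by simp
  ultimately have w: "v - 2 * e \<le> t' + x t' - x 0" using t' by linarith
  show ?thesis
  proof (cases "u \<le> t' + x t' - x 0")
    case True
    then have "graph_time T x u \<le> t'" using t' by (intro graph_time_le[OF T x]) auto
    then show ?thesis using t' e by (simp add: t_def)
  next
    case False
    let ?w = "t' + x t' - x 0"
    have "graph_time T x u \<le> graph_time T x ?w + (u - ?w)"
      by (rule graph_time_lipschitz[OF T x _ u]) (use False in simp)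
    moreover have "graph_time T x ?w \<le> t'" using t' by (intro graph_time_le[OF T x]) auto
    ultimately show ?thesis using w t' by (simp add: t_def)
  qed
qed

lemma graph_param_compare:
  assumes T: "0 < T" and x: "x \<in> increasing_cadlag_paths T" and y: "y \<in> increasing_cadlag_paths T"
    and c: "levy_close T e x y" and e: "0 \<le> e" and a: "a \<in> {0..1}"
  shows "d_max (graph_param T x a) (graph_param T y a) \<le> 8 * e"
proof -
  note endp = levy_close_endpoints[OF c T e]
  let ?u = "a * graph_length T x" and ?v = "a * graph_length T y"
  have "\<bar>graph_length T x - graph_length T y\<bar> \<le> 2 * e"
    using endp by (simp add: graph_length_def)
  moreover have "\<bar>?u - ?v\<bar> = a * \<bar>graph_length T x - graph_length T y\<bar>"
    using a by (simp add: right_diff_distrib[symmetric] abs_mult)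
  moreover have "a * \<bar>graph_length T x - graph_length T y\<bar> \<le> \<bar>graph_length T x - graph_length T y\<bar>"
    using a by (intro mult_left_le_one_le) auto
  ultimately have uv: "\<bar>?u - ?v\<bar> \<le> 2 * e" by linarith
  have "?u \<le> graph_length T x" "?v \<le> graph_length T y"
    using a graph_length_pos[OF T x] graph_length_pos[OF T y] by (auto simp: mult_left_le_one_le)
  then have "\<bar>graph_time T x ?u - graph_time T y ?v\<bar> \<le> 5 * e"
    using graph_time_compare[OF T x y c e, of ?u ?v]
      graph_time_compare[OF T y x levy_close_sym[OF c] e, of ?v ?u] uv by linarith
  then show ?thesis using uv endp(1)
    by (auto simp: d_max_def graph_param_def Let_def)
qed

text \<open>The canonical parametrisations are one of the pairs over which \<open>M1_dist\<close> takes the infimum.\<close>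

lemma M1_dist_le_of_levy_close:
  assumes T: "0 < T" and x: "x \<in> increasing_cadlag_paths T" and y: "y \<in> increasing_cadlag_paths T"
    and c: "levy_close T e x y" and e: "0 \<le> e"
  shows "M1_dist T x y \<le> 8 * e"
proof -
  have "M1_dist T x y \<le> (SUP a\<in>{0..1}. d_max (graph_param T x a) (graph_param T y a))"
    unfolding M1_dist_def
  proof (rule cINF_lower2[where x = "(graph_param T x, graph_param T y)"])
    show "bdd_below ((\<lambda>(p, q). SUP a\<in>{0..1}. d_max (p a) (q a)) ` (parametric_reps T x \<times> parametric_reps T y))"
    proof (rule bdd_belowI2[of _ 0], clarify)
      fix p q assume pq: "p \<in> parametric_reps T x" "q \<in> parametric_reps T y"
      have "continuous_on {0..1} (\<lambda>a. d_max (p a) (q a))"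
        using pq unfolding parametric_reps_def d_max_def
        by (intro continuous_intros) auto
      then have "compact ((\<lambda>a. d_max (p a) (q a)) ` {0..1})"
        by (intro compact_continuous_image) auto
      then have "bdd_above ((\<lambda>a. d_max (p a) (q a)) ` {0..1})"
        by (simp add: bounded_imp_bdd_above compact_imp_bounded)
      then have "d_max (p 0) (q 0) \<le> (SUP a\<in>{0..1}. d_max (p a) (q a))"
        by (intro cSUP_upper) auto
      moreover have "0 \<le> d_max (p 0) (q 0)" by (simp add: d_max_def)
      ultimately show "0 \<le> (SUP a\<in>{0..1}. d_max (p a) (q a))" by (rule order_trans[rotated])
    qed
  qed (use graph_param_rep[OF T x] graph_param_rep[OF T y] in auto)
  also have "\<dots> \<le> 8 * e"
    by (rule cSUP_least) (use graph_param_compare[OF T x y c e] in auto)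
  finally show ?thesis .
qed

section \<open>The gauge topology and the M1 topology\<close>

definition path_topology where
  "path_topology T = dist_topology (path_space T) (path_dist T)"

lemma topspace_path_topology [simp]: "topspace (path_topology T) = path_space T"
  by (simp add: path_topology_def)

lemma dist_topology_imp_close:
  assumes "openin (dist_topology A d) U" "x \<in> U"
  obtains e where "0 < e" "\<And>y. y \<in> A \<Longrightarrow> d x y < e \<Longrightarrow> y \<in> U"
  using assms unfolding openin_dist_topology by meson

text \<open>Balls of radius at most \<open>1\<close> consist of close paths, so neighbourhoods may be given in terms of
  closeness.\<close>

lemma openin_path_topologyI:
  assumes "0 < T" "U \<subseteq> path_space T"
    and "\<And>p. p \<in> U \<Longrightarrow> \<exists>e>0. \<forall>q\<in>path_space T. path_close T e p q \<longrightarrow> q \<in> U"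
  shows "openin (path_topology T) U"
  unfolding path_topology_def openin_dist_topology
proof (intro conjI ballI assms(2))
  fix p assume p: "p \<in> U"
  obtain e where e: "0 < e" "\<And>q. q \<in> path_space T \<Longrightarrow> path_close T e p q \<Longrightarrow> q \<in> U"
    using assms(3)[OF p] by blast
  have "q \<in> U" if "q \<in> path_space T" "path_dist T p q < min e 1" for q
    by (rule e(2)[OF that(1)], rule path_close_weaken[OF path_dist_less_imp_close[OF that(2)]])
       (use p assms e in auto)
  then show "\<exists>e>0. \<forall>q\<in>path_space T. path_dist T p q < e \<longrightarrow> q \<in> U"
    using e(1) by (intro exI[of _ "min e 1"]) auto
qed

lemma continuous_map_path_topologyI:
  assumes "0 < T" "\<And>p. p \<in> path_space T \<Longrightarrow> g p \<in> topspace E"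
    and "\<And>p U. p \<in> path_space T \<Longrightarrow> openin E U \<Longrightarrow> g p \<in> U \<Longrightarrow>
      \<exists>e>0. \<forall>q\<in>path_space T. path_close T e p q \<longrightarrow> g q \<in> U"
  shows "continuous_map (path_topology T) E g"
  unfolding continuous_map_def
proof (intro conjI allI impI)
  show "g \<in> topspace (path_topology T) \<rightarrow> topspace E" using assms(2) by auto
  fix U assume "openin E U"
  then show "openin (path_topology T) {p \<in> topspace (path_topology T). g p \<in> U}"
    using assms(3) by (intro openin_path_topologyI assms(1)) auto
qed

text \<open>On a compact set a strict inequality between continuous functions has a positive slack, and the
  window \<open>[0, 1/e]\<close> contains the compact set once \<open>e\<close> is small.\<close>

lemma fst_continuous_path_topology:
  assumes T: "0 < T"
  shows "continuous_map (path_topology T) locally_uniform_topology fst"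
  unfolding locally_uniform_topology_def
proof (rule continuous_on_generated_topo)
  fix U assume "U \<in> {{\<psi> \<in> continuous_paths. \<forall>s\<in>K. \<bar>\<psi> s - \<phi> s\<bar> < e} | \<phi> K e.
        \<phi> \<in> continuous_paths \<and> compact K \<and> K \<subseteq> {0..} \<and> e > 0}"
  then obtain \<phi> K e where U: "U = {\<psi> \<in> continuous_paths. \<forall>s\<in>K. \<bar>\<psi> s - \<phi> s\<bar> < e}"
    "\<phi> \<in> continuous_paths" "compact K" "K \<subseteq> {0..}" "0 < e" by blast
  show "openin (path_topology T) (fst -` U \<inter> topspace (path_topology T))"
  proof (rule openin_path_topologyI[OF T])
    fix p assume p: "p \<in> fst -` U \<inter> topspace (path_topology T)"
    then have pc: "fst p \<in> continuous_paths" "\<forall>s\<in>K. \<bar>fst p s - \<phi> s\<bar> < e" using U by auto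
    have "continuous_on K (\<lambda>s. \<bar>fst p s - \<phi> s\<bar>)"
      using pc U by (intro continuous_intros; auto simp: continuous_paths_def elim: continuous_on_subset)
    then obtain d where d: "0 < d" "\<forall>s\<in>K. \<bar>fst p s - \<phi> s\<bar> \<le> e - d"
    proof (cases "K = {}")
      case True
      then show ?thesis using that[of 1] by auto
    next
      case False
      then obtain s0 where "s0 \<in> K" "\<forall>s\<in>K. \<bar>fst p s - \<phi> s\<bar> \<le> \<bar>fst p s0 - \<phi> s0\<bar>"
        using continuous_attains_sup[OF U(3) False \<open>continuous_on K (\<lambda>s. \<bar>fst p s - \<phi> s\<bar>)\<close>] by auto
      then show ?thesis using that[of "e - \<bar>fst p s0 - \<phi> s0\<bar>"] pc(2) by auto
    qed
    obtain R where R: "K \<subseteq> {..R}" "0 < R"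
    proof -
      obtain R where "\<forall>s\<in>K. norm s \<le> R" using compact_imp_bounded[OF U(3)] by (auto simp: bounded_iff)
      then show ?thesis by (intro that[of "max R 1"]) fastforce+
    qed
    define c where "c = min (d / 2) (1 / R)"
    have c: "0 < c" "c < d" "R \<le> 1 / c" using d R by (auto simp: c_def field_simps min_def)
    have "q \<in> fst -` U \<inter> topspace (path_topology T)"
      if q: "q \<in> path_space T" "path_close T c p q" for q
    proof -
      have "fst q \<in> continuous_paths" using q by (auto simp: path_space_def)
      moreover have "\<bar>fst q s - \<phi> s\<bar> < e" if "s \<in> K" for s
      proof -
        have "s \<in> {0..1/c}" using that R U(4) c by (auto simp: subset_iff intro: order_trans)
        then have "\<bar>fst p s - fst q s\<bar> \<le> c" using q by (auto simp: path_close_def)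
        then show ?thesis using d(2) that c by fastforce
      qed
      ultimately show ?thesis using q U by auto
    qed
    then show "\<exists>e>0. \<forall>q\<in>path_space T. path_close T e p q \<longrightarrow> q \<in> fst -` U \<inter> topspace (path_topology T)"
      using c(1) by blast
  qed auto
next
  show "fst ` topspace (path_topology T) \<subseteq> \<Union> {{\<psi> \<in> continuous_paths. \<forall>s\<in>K. \<bar>\<psi> s - \<phi> s\<bar> < e} | \<phi> K e.
        \<phi> \<in> continuous_paths \<and> compact K \<and> K \<subseteq> {0..} \<and> e > 0}"
  proof (intro image_subsetI)
    fix p assume "p \<in> topspace (path_topology T)"
    then have "fst p \<in> {\<psi> \<in> continuous_paths. \<forall>s\<in>{}. \<bar>\<psi> s - fst p s\<bar> < (1::real)}" "fst p \<in> continuous_paths"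
      by (auto simp: path_space_def)
    then show "fst p \<in> \<Union> {{\<psi> \<in> continuous_paths. \<forall>s\<in>K. \<bar>\<psi> s - \<phi> s\<bar> < e} | \<phi> K e.
        \<phi> \<in> continuous_paths \<and> compact K \<and> K \<subseteq> {0..} \<and> e > 0}"
      by (intro UnionI[rotated]) (blast intro: compact_empty zero_less_one)+
  qed
qed

lemma snd_continuous_path_topology:
  assumes T: "0 < T"
  shows "continuous_map (path_topology T) (dist_topology (increasing_cadlag_paths T) (M1_dist T)) snd"
proof (rule continuous_map_path_topologyI[OF T])
  fix p assume "p \<in> path_space T"
  then show "snd p \<in> topspace (dist_topology (increasing_cadlag_paths T) (M1_dist T))"
    by (auto simp: path_space_def)
next
  fix p U assume p: "p \<in> path_space T" and U: "openin (dist_topology (increasing_cadlag_paths T) (M1_dist T)) U" "snd p \<in> U"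
  obtain e where e: "0 < e" "\<And>y. y \<in> increasing_cadlag_paths T \<Longrightarrow> M1_dist T (snd p) y < e \<Longrightarrow> y \<in> U"
    using dist_topology_imp_close[OF U] by metis
  have "snd q \<in> U" if "q \<in> path_space T" "path_close T (e / 16) p q" for q
  proof (rule e(2))
    show "snd q \<in> increasing_cadlag_paths T" using that by (auto simp: path_space_def)
    then have "M1_dist T (snd p) (snd q) \<le> 8 * (e / 16)"
      using that p e(1) T by (intro M1_dist_le_of_levy_close) (auto simp: path_space_def path_close_def)
    then show "M1_dist T (snd p) (snd q) < e" using e(1) by simp
  qed
  then show "\<exists>e>0. \<forall>q\<in>path_space T. path_close T e p q \<longrightarrow> snd q \<in> U"
    using e(1) by (intro exI[of _ "e / 16"]) auto
qed

lemma id_continuous_D_circ: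
  assumes "0 < T" shows "continuous_map (path_topology T) (D_circ_topology T) (\<lambda>p. p)"
  unfolding D_circ_topology_def continuous_map_pairwise o_def
  using fst_continuous_path_topology snd_continuous_path_topology assms by simp

text \<open>The path \<open>fst p\<close> run along the completed graph of \<open>snd p\<close>: where the time change jumps, the
  decoration is the image of the interval that it skips. If it does not jump, the result is the
  embedding of the composed path (\<open>decorate_continuous_path\<close> below).\<close>

definition decorate :: "real \<Rightarrow> (real \<Rightarrow> real) \<times> (real \<Rightarrow> real) \<Rightarrow> (real \<Rightarrow> real) \<times> (real \<Rightarrow> real set)" where
  "decorate T p = (\<lambda>t\<in>{0..T}. fst p (snd p t), \<lambda>t\<in>{0..T}. fst p ` {left_limit (snd p) t..snd p t})"

lemma hausdorff_dist_le:
  assumes "A \<noteq> {}" "B \<noteq> {}" "\<And>a b. 0 \<le> d a b"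
    "\<And>a. a \<in> A \<Longrightarrow> \<exists>b\<in>B. d a b \<le> e" "\<And>b. b \<in> B \<Longrightarrow> \<exists>a\<in>A. d a b \<le> e"
  shows "hausdorff_dist d A B \<le> e"
  unfolding hausdorff_dist_def
proof (rule max.boundedI; rule cSUP_least)
  fix a assume "a \<in> A"
  then obtain b where "b \<in> B" "d a b \<le> e" using assms(4) by blast
  then show "(INF b\<in>B. d a b) \<le> e"
    using assms(3) by (intro cINF_lower2[where x = b] bdd_belowI2[of _ 0]) auto
next
  fix b assume "b \<in> B"
  then obtain a where "a \<in> A" "d a b \<le> e" using assms(5) by blast
  then show "(INF a\<in>A. d a b) \<le> e"
    using assms(3) by (intro cINF_lower2[where x = a] bdd_belowI2[of _ 0]) auto
qed (use assms in auto)

lemma hausdorff_dist_singleton: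
  assumes "A \<noteq> {}" "compact A"
  shows "hausdorff_dist dist A {c :: real} = (SUP a\<in>A. dist a c)"
proof -
  obtain a where a: "a \<in> A" using assms by blast
  have "bdd_above ((\<lambda>a. dist a c) ` A)"
    by (intro bounded_imp_bdd_above compact_imp_bounded compact_continuous_image assms continuous_intros)
  then have "dist a c \<le> (SUP a\<in>A. dist a c)" using a by (intro cSUP_upper) auto
  moreover have "(INF a\<in>A. dist a c) \<le> dist a c"
    using a by (intro cINF_lower bdd_belowI2[of _ 0]) auto
  ultimately show ?thesis by (simp add: hausdorff_dist_def)
qed

lemma hausdorff_tendsto_0:
  assumes "\<And>e. 0 < e \<Longrightarrow> \<forall>\<^sub>F s in F. \<forall>a\<in>I s. \<bar>a - c\<bar> \<le> e"
    and "\<forall>\<^sub>F s in F. I s \<noteq> {} \<and> compact (I s)"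
  shows "((\<lambda>s. hausdorff_dist dist (I s) {c::real}) \<longlongrightarrow> 0) F"
proof (rule tendstoI)
  fix e :: real assume e: "0 < e"
  have "\<forall>\<^sub>F s in F. \<forall>a\<in>I s. \<bar>a - c\<bar> \<le> e / 2" using e by (intro assms(1)) simp
  with assms(2) show "\<forall>\<^sub>F s in F. dist (hausdorff_dist dist (I s) {c}) 0 < e"
  proof eventually_elim
    case (elim s)
    then obtain a where a: "a \<in> I s" by blast
    have "(SUP a\<in>I s. dist a c) \<le> e / 2"
      by (rule cSUP_least) (use elim in \<open>auto simp: dist_real_def\<close>)
    then have "hausdorff_dist dist (I s) {c} \<le> e / 2"
      using elim by (simp add: hausdorff_dist_singleton)
    moreover have "0 \<le> hausdorff_dist dist (I s) {c}"
    proof -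
      have "0 \<le> (INF a\<in>I s. dist a c)" using a by (intro cINF_greatest) auto
      then show ?thesis by (simp add: hausdorff_dist_def)
    qed
    ultimately show ?case using e by (simp add: dist_real_def)
  qed
qed

section \<open>Decorated compositions\<close>

lemma left_limit_nonneg:
  assumes "x \<in> increasing_cadlag_paths T" "0 \<le> t" "t \<le> T"
  shows "0 \<le> left_limit x t"
proof (cases "t = 0")
  case True
  then show ?thesis using increasing_nonneg[OF assms(1), of 0] assms by (simp add: left_limit_def)
next
  case False
  then show ?thesis
    using left_limit_upper[OF assms(1), of 0 t] increasing_nonneg[OF assms(1), of 0] assms by auto
qed

lemma left_limit_eqI:
  assumes "(x \<longlongrightarrow> l) (at_left t)" "t \<noteq> 0" shows "left_limit x t = l"
  using tendsto_Lim[OF _ assms(1)] assms(2) by (simp add: left_limit_def trivial_limit_at_left_real)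

context
  fixes T :: real and \<phi> x :: "real \<Rightarrow> real"
  assumes T: "0 < T" and phi: "\<phi> \<in> continuous_paths" and x: "x \<in> increasing_cadlag_paths T"
begin

lemma path_continuous: "continuous_on {0..} \<phi>"
  using phi by (simp add: continuous_paths_def)

lemma composition_right_limit:
  assumes "0 \<le> t" "t < T"
  shows "((\<lambda>t\<in>{0..T}. \<phi> (x t)) \<longlongrightarrow> \<phi> (x t)) (at_right t)"
proof -
  have in_range: "\<forall>\<^sub>F s in at_right t. s \<in> {0..T}"
    using eventually_at_right_real[OF assms(2)] by eventually_elim (use assms in auto)
  then have pos: "\<forall>\<^sub>F s in at_right t. x s \<in> {0..}"
    by eventually_elim (use increasing_nonneg[OF x] in auto)
  have "((\<lambda>s. \<phi> (x s)) \<longlongrightarrow> \<phi> (x t)) (at_right t)"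
    by (rule continuous_on_tendsto_compose[OF path_continuous increasing_right[OF x] _ pos])
      (use assms increasing_nonneg[OF x, of t] in auto)
  then show ?thesis
    by (rule Lim_transform_eventually) (use in_range in \<open>auto elim: eventually_mono\<close>)
qed

lemma composition_left_limit:
  assumes "0 < t" "t \<le> T"
  shows "((\<lambda>t\<in>{0..T}. \<phi> (x t)) \<longlongrightarrow> \<phi> (left_limit x t)) (at_left t)"
proof -
  have in_range: "\<forall>\<^sub>F s in at_left t. s \<in> {0..T}"
    using eventually_at_left_real[OF assms(1)] by eventually_elim (use assms in auto)
  then have pos: "\<forall>\<^sub>F s in at_left t. x s \<in> {0..}"
    by eventually_elim (use increasing_nonneg[OF x] in auto)
  have "((\<lambda>s. \<phi> (x s)) \<longlongrightarrow> \<phi> (left_limit x t)) (at_left t)"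
    by (rule continuous_on_tendsto_compose[OF path_continuous increasing_left_limit[OF x] _ pos])
      (use assms left_limit_nonneg[OF x, of t] in auto)
  then show ?thesis
    by (rule Lim_transform_eventually) (use in_range in \<open>auto elim: eventually_mono\<close>)
qed

lemma left_limit_composition:
  assumes "0 \<le> t" "t \<le> T"
  shows "left_limit (\<lambda>t\<in>{0..T}. \<phi> (x t)) t = \<phi> (left_limit x t)"
proof (cases "t = 0")
  case True
  then show ?thesis using T by (simp add: left_limit_def)
next
  case False
  then show ?thesis using assms by (intro left_limit_eqI composition_left_limit) auto
qed

lemma decoration_compact:
  assumes "0 \<le> t" "t \<le> T"
  shows "compact (\<phi> ` {left_limit x t..x t})"
  using left_limit_nonneg[OF x assms]
  by (intro compact_continuous_image continuous_on_subset[OF path_continuous]) auto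

lemma decoration_right:
  assumes t: "0 \<le> t" "t < T"
  shows "((\<lambda>s. hausdorff_dist dist ((\<lambda>t\<in>{0..T}. \<phi> ` {left_limit x t..x t}) s) {\<phi> (x t)}) \<longlongrightarrow> 0) (at_right t)"
proof (rule hausdorff_tendsto_0)
  have in_range: "\<forall>\<^sub>F s in at_right t. s \<in> {t<..<T}"
    using eventually_at_right_real[OF t(2)] .
  then show "\<forall>\<^sub>F s in at_right t. (\<lambda>t\<in>{0..T}. \<phi> ` {left_limit x t..x t}) s \<noteq> {} \<and>
      compact ((\<lambda>t\<in>{0..T}. \<phi> ` {left_limit x t..x t}) s)"
    by eventually_elim (use t decoration_compact left_limit_le[OF x] in auto)
  fix e :: real assume e: "0 < e"
  have xt: "0 \<le> x t" using increasing_nonneg[OF x, of t] t by simp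
  then obtain d where d: "0 < d" "\<And>z. 0 \<le> z \<Longrightarrow> \<bar>z - x t\<bar> < d \<Longrightarrow> \<bar>\<phi> z - \<phi> (x t)\<bar> \<le> e"
    using path_continuous[unfolded continuous_on_iff, rule_format, of "x t" e] e
    by (auto simp: dist_real_def intro: less_imp_le)
  have "\<forall>\<^sub>F s in at_right t. dist (x s) (x t) < d"
    using tendstoD[OF increasing_right[OF x t] d(1)] .
  with in_range show "\<forall>\<^sub>F s in at_right t. \<forall>a\<in>(\<lambda>t\<in>{0..T}. \<phi> ` {left_limit x t..x t}) s. \<bar>a - \<phi> (x t)\<bar> \<le> e"
  proof eventually_elim
    case (elim s)
    have "x t \<le> left_limit x s" using left_limit_upper[OF x, of t s] elim t by auto
    then show ?case using elim t d(2) xt by (auto simp: dist_real_def)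
  qed
qed

lemma decoration_left:
  assumes t: "0 < t" "t \<le> T"
  shows "((\<lambda>s. hausdorff_dist dist ((\<lambda>t\<in>{0..T}. \<phi> ` {left_limit x t..x t}) s) {\<phi> (left_limit x t)}) \<longlongrightarrow> 0) (at_left t)"
proof (rule hausdorff_tendsto_0)
  have in_range: "\<forall>\<^sub>F s in at_left t. s \<in> {0<..<t}"
    using eventually_at_left_real[OF t(1)] .
  then show "\<forall>\<^sub>F s in at_left t. (\<lambda>t\<in>{0..T}. \<phi> ` {left_limit x t..x t}) s \<noteq> {} \<and>
      compact ((\<lambda>t\<in>{0..T}. \<phi> ` {left_limit x t..x t}) s)"
    by eventually_elim (use t decoration_compact left_limit_le[OF x] in auto)
  fix e :: real assume e: "0 < e"
  let ?l = "left_limit x t"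
  have l: "0 \<le> ?l" using left_limit_nonneg[OF x, of t] t by simp
  then obtain d where d: "0 < d" "\<And>z. 0 \<le> z \<Longrightarrow> \<bar>z - ?l\<bar> < d \<Longrightarrow> \<bar>\<phi> z - \<phi> ?l\<bar> \<le> e"
    using path_continuous[unfolded continuous_on_iff, rule_format, of ?l e] e
    by (auto simp: dist_real_def intro: less_imp_le)
  have "\<forall>\<^sub>F s in at_left t. dist (x s) ?l < d"
    using tendstoD[OF increasing_left_limit[OF x t] d(1)] .
  with in_range have "\<forall>\<^sub>F s in at_left t. s \<in> {0<..<t} \<and> dist (x s) ?l < d" by eventually_elim simp
  then obtain b where b: "b < t" "\<And>s. b < s \<Longrightarrow> s < t \<Longrightarrow> s \<in> {0<..<t} \<and> dist (x s) ?l < d"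
    using eventually_at_left[of b t] t(1) by (auto simp: eventually_at_left[OF t(1)])
  \<comment> \<open>For times after \<open>r\<close> the whole interval of the decoration lies between \<open>x r\<close> and the left limit.\<close>
  define r where "r = (b + t) / 2"
  have r: "r < t" "0 < r" "dist (x r) ?l < d" using b(2)[of r] b(1) by (auto simp: r_def)
  have "\<forall>\<^sub>F s in at_left t. s \<in> {r<..<t}" using eventually_at_left_real[OF r(1)] .
  then show "\<forall>\<^sub>F s in at_left t. \<forall>a\<in>(\<lambda>t\<in>{0..T}. \<phi> ` {left_limit x t..x t}) s. \<bar>a - \<phi> ?l\<bar> \<le> e"
  proof eventually_elim
    case (elim s)
    have lo: "x r \<le> left_limit x s" using left_limit_upper[OF x, of r s] elim t r by auto
    have hi: "x s \<le> ?l" using left_limit_upper[OF x, of s t] elim t r by auto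
    have nn: "0 \<le> left_limit x s" using left_limit_nonneg[OF x, of s] elim t r by auto
    have "\<bar>\<phi> z - \<phi> ?l\<bar> \<le> e" if "left_limit x s \<le> z" "z \<le> x s" for z
      by (rule d(2)) (use that lo hi nn r(3) in \<open>auto simp: dist_real_def\<close>)
    then show ?case using elim t r by auto
  qed
qed

lemma decorate_in_decorated_paths: "decorate T (\<phi>, x) \<in> decorated_paths T"
proof -
  have "(\<lambda>t\<in>{0..T}. \<phi> (x t)) \<in> cadlag_paths T"
    using composition_right_limit composition_left_limit unfolding cadlag_paths_def by fastforce
  moreover have "\<phi> (left_limit x t) \<in> \<phi> ` {left_limit x t..x t}" "\<phi> (x t) \<in> \<phi> ` {left_limit x t..x t}"
    if "0 \<le> t" "t \<le> T" for t
    using left_limit_le[OF x that] by auto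
  ultimately show ?thesis
    using decoration_compact decoration_right decoration_left left_limit_composition
    unfolding decorated_paths_def decorate_def by simp
qed

text \<open>In this form the graphs of two decorated paths can be compared point by point along the canonical
  parametrisations.\<close>

lemma decoration_graph_decorate:
  "decoration_graph T (snd (decorate T (\<phi>, x))) = (\<lambda>(t, z). (t, \<phi> z)) ` completed_graph T x"
proof -
  have "completed_graph T x = Sigma {0..T} (\<lambda>t. {left_limit x t..x t})"
    using left_limit_le[OF x] by (auto simp: completed_graph_def closed_segment_eq_real_ivl)
  then show ?thesis
    unfolding decoration_graph_def decorate_def by (force simp: image_iff)
qed

end

lemma completed_graph_bounds:
  assumes "0 < T" "x \<in> increasing_cadlag_paths T" "(t, z) \<in> completed_graph T x"
  shows "0 \<le> z" "z \<le> x T"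
proof -
  have t: "0 \<le> t" "t \<le> T" using assms by (auto simp: completed_graph_def)
  have "left_limit x t \<le> z" "z \<le> x t"
    using assms(3) left_limit_le[OF assms(2) t] by (auto simp: completed_graph_def closed_segment_eq_real_ivl)
  then show "0 \<le> z" "z \<le> x T"
    using left_limit_nonneg[OF assms(2) t] increasing_le[OF assms(2) t(1) t(2)] by auto
qed

text \<open>The canonical parametrisations pair the points of the two completed graphs. Mapping such a pair by
  \<open>\<phi>\<close> costs the modulus of continuity of \<open>\<phi>\<close> on a bounded interval, and replacing \<open>\<phi>\<close> by \<open>\<psi>\<close> costs \<open>c\<close>.\<close>

lemma decorate_continuous:
  assumes T: "0 < T"
  shows "continuous_map (path_topology T) (decorated_topology T) (decorate T)"
proof (rule continuous_map_path_topologyI[OF T])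
  fix p assume "p \<in> path_space T"
  then show "decorate T p \<in> topspace (decorated_topology T)"
    using decorate_in_decorated_paths[OF T, of "fst p" "snd p"]
    by (auto simp: decorated_topology_def path_space_def)
next
  fix p U assume p: "p \<in> path_space T" and U: "openin (decorated_topology T) U" "decorate T p \<in> U"
  obtain \<phi> x where px: "p = (\<phi>, x)" "\<phi> \<in> continuous_paths" "x \<in> increasing_cadlag_paths T"
    using p by (auto simp: path_space_def)
  obtain e where e: "0 < e" "\<And>y. y \<in> decorated_paths T \<Longrightarrow>
     hausdorff_dist d_max (decoration_graph T (snd (decorate T p))) (decoration_graph T (snd y)) < e \<Longrightarrow> y \<in> U"
    using dist_topology_imp_close[OF U[unfolded decorated_topology_def]] by (auto simp: split_beta)
  define R where "R = x T + 1"
  have R: "0 < R" using increasing_nonneg[OF px(3), of T] T by (simp add: R_def)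
  have "uniformly_continuous_on {0..R} \<phi>"
    using px(2) by (intro compact_uniformly_continuous) (auto simp: continuous_paths_def elim: continuous_on_subset)
  then obtain d where d: "0 < d" "\<And>z w. z \<in> {0..R} \<Longrightarrow> w \<in> {0..R} \<Longrightarrow> dist w z < d \<Longrightarrow> dist (\<phi> w) (\<phi> z) < e / 4"
    using e(1) unfolding uniformly_continuous_on_def by (metis zero_less_divide_iff zero_less_numeral)
  define c where "c = min (min (e / 16) (d / 16)) (min 1 (1 / R))"
  have c: "0 < c" "8 * c < d" "8 * c \<le> e / 2" "c \<le> 1" "R \<le> 1 / c" "c \<le> e / 4"
  proof -
    have le: "c \<le> e / 16" "c \<le> d / 16" "c \<le> 1" "c \<le> 1 / R" by (simp_all add: c_def)
    show "0 < c" using e(1) d(1) R by (simp add: c_def)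
    then show "R \<le> 1 / c" using le(4) R by (simp add: field_simps)
    show "8 * c < d" "8 * c \<le> e / 2" "c \<le> 1" "c \<le> e / 4" using le e(1) d(1) by auto
  qed
  have "decorate T q \<in> U" if q: "q \<in> path_space T" "path_close T c p q" for q
  proof -
    obtain \<psi> y where qy: "q = (\<psi>, y)" "\<psi> \<in> continuous_paths" "y \<in> increasing_cadlag_paths T"
      using q by (auto simp: path_space_def)
    have lc: "levy_close T c x y" using q(2) by (simp add: path_close_def px qy)
    let ?A = "(\<lambda>(t, z). (t, \<phi> z)) ` completed_graph T x"
    let ?B = "(\<lambda>(t, z). (t, \<psi> z)) ` completed_graph T y"
    have yT: "y T \<le> R" using levy_close_endpoints(2)[OF lc T] c by (simp add: R_def)
    have close: "d_max (t, \<phi> z) (s, \<psi> w) \<le> e / 2"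
      if "(t, z) \<in> completed_graph T x" "(s, w) \<in> completed_graph T y" "d_max (t, z) (s, w) \<le> 8 * c" for t z s w
    proof -
      have z: "z \<in> {0..R}" using completed_graph_bounds[OF T px(3) that(1)] by (simp add: R_def)
      have w: "w \<in> {0..R}" using completed_graph_bounds[OF T qy(3) that(2)] yT by simp
      have "\<bar>\<phi> z - \<phi> w\<bar> < e / 4"
        using d(2)[OF w z] that(3) c by (auto simp: d_max_def dist_real_def)
      moreover have "\<bar>\<phi> w - \<psi> w\<bar> \<le> c"
        using q(2) w c(5) by (auto simp: path_close_def px qy)
      ultimately have "\<bar>\<phi> z - \<psi> w\<bar> \<le> e / 2" using c by linarith
      moreover have "\<bar>t - s\<bar> \<le> e / 2" using that(3) c by (simp add: d_max_def)
      ultimately show ?thesis by (simp add: d_max_def)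
    qed
    have pair: "graph_param T x a \<in> completed_graph T x" "graph_param T y a \<in> completed_graph T y"
      "d_max (graph_param T x a) (graph_param T y a) \<le> 8 * c" if "a \<in> {0..1}" for a
      using graph_param_image[OF T px(3)] graph_param_image[OF T qy(3)] that
        graph_param_compare[OF T px(3) qy(3) lc _ that] c by auto
    have "hausdorff_dist d_max ?A ?B \<le> e / 2"
    proof (rule hausdorff_dist_le)
      show "?A \<noteq> {}" "?B \<noteq> {}" using pair(1)[of 0] pair(2)[of 0] by auto
      fix v assume "v \<in> ?A"
      then obtain a where a: "a \<in> {0..1}" "v = (\<lambda>(t, z). (t, \<phi> z)) (graph_param T x a)"
        unfolding graph_param_image[OF T px(3), symmetric] by blast
      then show "\<exists>b\<in>?B. d_max v b \<le> e / 2"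
        using pair[OF a(1)] close by (intro bexI[OF _ imageI[OF pair(2)[OF a(1)]]]) (auto simp: split_beta)
    next
      fix v assume "v \<in> ?B"
      then obtain a where a: "a \<in> {0..1}" "v = (\<lambda>(t, z). (t, \<psi> z)) (graph_param T y a)"
        unfolding graph_param_image[OF T qy(3), symmetric] by blast
      then show "\<exists>b\<in>?A. d_max b v \<le> e / 2"
        using pair[OF a(1)] close by (intro bexI[OF _ imageI[OF pair(1)[OF a(1)]]]) (auto simp: split_beta)
    qed (auto simp: d_max_def)
    then show ?thesis
      using e decorate_in_decorated_paths[OF T qy(2,3)] decoration_graph_decorate[OF T px(2,3)]
        decoration_graph_decorate[OF T qy(2,3)] by (intro e(2)) (auto simp: px qy)
  qed
  then show "\<exists>e>0. \<forall>q\<in>path_space T. path_close T e p q \<longrightarrow> decorate T q \<in> U"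
    using c(1) by blast
qed

lemma decorate_continuous_path:
  assumes T: "0 < T" and phi: "\<phi> \<in> continuous_paths" and x: "x \<in> increasing_cadlag_paths T"
    and cont: "continuous_on {0..T} x"
  shows "decorate T (\<phi>, x) = embed_path T (\<lambda>t\<in>{0..T}. \<phi> (x t))"
proof -
  have "left_limit x t = x t" if "0 \<le> t" "t \<le> T" for t
  proof (cases "t = 0")
    case False
    then have t: "0 < t" using that by simp
    have "(x \<longlongrightarrow> x t) (at t within {0..T})" using cont that by (simp add: continuous_on)
    then have "(x \<longlongrightarrow> x t) (at t within {0..t})" by (rule tendsto_within_subset) (use that in auto)
    moreover have "at t within {0..t} = at_left t" using at_within_Icc_at_left[OF t] .
    ultimately show ?thesis using t by (intro left_limit_eqI) auto
  qed (simp add: left_limit_def)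
  then show ?thesis
    using left_limit_composition[OF T phi x]
    by (auto simp: decorate_def embed_path_def restrict_def fun_eq_iff)
qed

section \<open>Measurability of path-valued maps\<close>

text \<open>Cells are small in the gauge, are given by countably many rational data, and membership depends
  only on evaluations. They take the place of balls around the points of a dense set: an open set is
  the union of the cells that it contains (\<open>open_Union_cells\<close>).\<close>

definition path_cell where
  "path_cell T m k a b = {p \<in> path_space T.
     (\<forall>i<m * k. \<forall>s\<in>{real i / real k..real (Suc i) / real k}. \<bar>fst p s - a ! i\<bar> \<le> 1 / real m) \<and>
     (\<forall>i\<le>m. \<bar>snd p (real i * T / real m) - b ! i\<bar> \<le> 1 / real m)}"

lemma grid_cover:
  fixes s :: real
  assumes "0 \<le> s" "s \<le> real m" "0 < k" "0 < m"
  obtains i where "i < m * k" "s \<in> {real i / real k..real (Suc i) / real k}"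
proof (cases "s = real m")
  case True
  have "real (m * k - 1) = real m * real k - 1" using assms by (simp add: of_nat_diff Suc_leI)
  then have "s \<in> {real (m * k - 1) / real k..real (Suc (m * k - 1)) / real k}"
    using True assms by (auto simp: field_simps)
  then show ?thesis using that[of "m * k - 1"] assms by simp
next
  case False
  define i where "i = nat \<lfloor>s * real k\<rfloor>"
  have i: "real i \<le> s * real k" "s * real k < real i + 1"
    using assms by (auto simp: i_def)
  have "s * real k < real m * real k" using False assms by simp
  then have "real i < real (m * k)" using i by simp
  then have "i < m * k" by linarith
  then show ?thesis using that[of i] i assms by (simp add: field_simps)
qed

text \<open>A monotone path is controlled by its values on a grid: moving on to the next grid point is a time
  shift by at most \<open>T / m\<close>.\<close>

lemma levy_close_grid:
  assumes T: "0 < T" and x: "x \<in> increasing_cadlag_paths T" and y: "y \<in> increasing_cadlag_paths T"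
    and m: "0 < m" and e: "T / real m \<le> e" "\<And>i. i \<le> m \<Longrightarrow> \<bar>x (real i * T / real m) - y (real i * T / real m)\<bar> \<le> e"
  shows "levy_close T e x y"
proof -
  have e0: "0 \<le> e" using e(2)[of 0] by simp
  have *: "y (max 0 (min T t)) \<le> x (max 0 (min T (t + e))) + e"
    if x: "x \<in> increasing_cadlag_paths T" and y: "y \<in> increasing_cadlag_paths T"
      and g: "\<And>i. i \<le> m \<Longrightarrow> \<bar>x (real i * T / real m) - y (real i * T / real m)\<bar> \<le> e" for x y t
  proof -
    define s where "s = max 0 (min T t)"
    have s: "0 \<le> s" "s \<le> T" using T by (auto simp: s_def)
    have le: "y s \<le> x r + e" if "i \<le> m" "s \<le> real i * T / real m" "real i * T / real m \<le> r" "r \<le> T" for i r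
    proof -
      have "y s \<le> y (real i * T / real m)"
        by (rule increasing_le[OF y]) (use s that in auto)
      moreover have "x (real i * T / real m) \<le> x r"
        by (rule increasing_le[OF x]) (use s that in auto)
      ultimately show ?thesis using g[OF that(1)] by linarith
    qed
    show ?thesis
    proof (cases "t \<le> 0")
      case True
      then have "s = 0" using T by (simp add: s_def)
      then show ?thesis using le[of 0 "max 0 (min T (t + e))"] T by (simp add: s_def)
    next
      case False
      define i where "i = nat \<lceil>s * real m / T\<rceil>"
      have i: "s * real m / T \<le> real i" "real i < s * real m / T + 1"
        using s T by (auto simp: i_def) linarith+
      have "s * real m / T \<le> real m" using s T m by (simp add: field_simps)
      then have "i \<le> m" unfolding i_def by linarith
      have 1: "s \<le> real i * T / real m" using i(1) T m by (simp add: field_simps)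
      have "real i * T / real m \<le> (s * real m / T + 1) * T / real m"
        using i(2) T m by (intro divide_right_mono mult_right_mono) auto
      also have "\<dots> = s + T / real m" using T m by (simp add: field_simps)
      finally have 2: "real i * T / real m \<le> s + e" using e(1) by simp
      have 3: "real i * T / real m \<le> T" using \<open>i \<le> m\<close> T m by (simp add: field_simps)
      have "s \<le> t" using False by (simp add: s_def)
      then have "real i * T / real m \<le> max 0 (min T (t + e))" using 2 3 by auto
      then show ?thesis using le[OF \<open>i \<le> m\<close> 1] T by (simp add: s_def)
    qed
  qed
  have "x (max 0 (min T (t - e))) - e \<le> y (max 0 (min T t))" for t
    using *[OF y x, of "t - e"] e(2) by (simp add: abs_minus_commute)
  then show ?thesis unfolding levy_close_def using *[OF x y e(2)] by auto
qed

lemma path_cell_close: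
  assumes T: "0 < T" and m: "0 < m" and k: "0 < k" and p: "p \<in> path_cell T m k a b" and q: "q \<in> path_cell T m k a b"
  shows "path_close T ((2 + T) / real m) p q"
  unfolding path_close_def
proof (intro conjI ballI)
  have pq: "p \<in> path_space T" "q \<in> path_space T" using p q by (auto simp: path_cell_def)
  fix s assume s: "s \<in> {0..1 / ((2 + T) / real m)}"
  have "real m / (2 + T) \<le> real m / 1" using T by (intro divide_left_mono) auto
  then have "0 \<le> s" "s \<le> real m" using s by auto
  then obtain i where i: "i < m * k" "s \<in> {real i / real k..real (Suc i) / real k}"
    by (rule grid_cover[OF _ _ k m])
  then have "\<bar>fst p s - a ! i\<bar> \<le> 1 / real m" "\<bar>fst q s - a ! i\<bar> \<le> 1 / real m"
    using p q unfolding path_cell_def by blast+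
  then have "\<bar>fst p s - fst q s\<bar> \<le> 2 / real m" by (simp add: abs_le_iff field_simps)
  also have "\<dots> \<le> (2 + T) / real m" using T by (simp add: divide_right_mono)
  finally show "\<bar>fst p s - fst q s\<bar> \<le> (2 + T) / real m" .
next
  have pq: "p \<in> path_space T" "q \<in> path_space T" using p q by (auto simp: path_cell_def)
  show "levy_close T ((2 + T) / real m) (snd p) (snd q)"
  proof (rule levy_close_grid[OF T _ _ m])
    fix i assume "i \<le> m"
    then have "\<bar>snd p (real i * T / real m) - b ! i\<bar> \<le> 1 / real m" "\<bar>snd q (real i * T / real m) - b ! i\<bar> \<le> 1 / real m"
      using p q unfolding path_cell_def by blast+
    then have "\<bar>snd p (real i * T / real m) - snd q (real i * T / real m)\<bar> \<le> 2 / real m"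
      by (simp add: abs_le_iff field_simps)
    also have "\<dots> \<le> (2 + T) / real m" using T by (simp add: divide_right_mono)
    finally show "\<bar>snd p (real i * T / real m) - snd q (real i * T / real m)\<bar> \<le> (2 + T) / real m" .
  qed (use pq T in \<open>auto simp: path_space_def divide_right_mono\<close>)
qed

lemma rational_close: 
  fixes x e :: real assumes "0 < e" obtains q :: rat where "\<bar>x - of_rat q\<bar> \<le> e"
proof -
  obtain q where "x - e < of_rat q" "of_rat q < x + e" using of_rat_dense[of "x - e" "x + e"] assms by auto
  then show ?thesis by (intro that[of q]) auto
qed

text \<open>The spatial grid \<open>1/k\<close> is chosen after \<open>m\<close>, from the modulus of continuity on \<open>[0, m]\<close>.\<close>

lemma path_cell_exists:
  assumes T: "0 < T" and m: "0 < m" and p: "p \<in> path_space T"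
  obtains k and a b :: "rat list" where "0 < k" "p \<in> path_cell T m k (map of_rat a) (map of_rat b)"
proof -
  have pm: "0 < 1 / (2 * real m)" using m by simp
  have cont: "continuous_on {0..real m} (fst p)"
    by (rule continuous_on_subset[of "{0..}"]) (use p in \<open>auto simp: path_space_def continuous_paths_def\<close>)
  then have "uniformly_continuous_on {0..real m} (fst p)"
    by (intro compact_uniformly_continuous) auto
  then obtain d where d: "0 < d" "\<And>s r. s \<in> {0..real m} \<Longrightarrow> r \<in> {0..real m} \<Longrightarrow> dist r s < d \<Longrightarrow>
      dist (fst p r) (fst p s) < 1 / (2 * real m)"
    using pm unfolding uniformly_continuous_on_def by metis
  obtain k where k: "inverse (real (Suc k)) < d" using reals_Archimedean[OF d(1)] by blast
  let ?k = "Suc k"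
  have "\<exists>q::rat. \<bar>fst p (real i / real ?k) - of_rat q\<bar> \<le> 1 / (2 * real m)" for i
    using rational_close[OF pm] by metis
  then obtain A where A: "\<And>i. \<bar>fst p (real i / real ?k) - of_rat (A i)\<bar> \<le> 1 / (2 * real m)" by metis
  have "0 < 1 / real m" using m by simp
  then have "\<exists>q::rat. \<bar>snd p (real i * T / real m) - of_rat q\<bar> \<le> 1 / real m" for i
    using rational_close by metis
  then obtain B where B: "\<And>i. \<bar>snd p (real i * T / real m) - of_rat (B i)\<bar> \<le> 1 / real m" by metis
  have "p \<in> path_cell T m ?k (map of_rat (map A [0..<m * ?k])) (map of_rat (map B [0..<Suc m]))"
    unfolding path_cell_def
  proof (intro CollectI conjI allI impI ballI p)
    fix i s assume i: "i < m * ?k" and s: "s \<in> {real i / real ?k..real (Suc i) / real ?k}"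
    have "Suc i \<le> m * ?k" using i by simp
    then have "real (Suc i) \<le> real m * real ?k" by (metis of_nat_le_iff of_nat_mult)
    then have "real (Suc i) / real ?k \<le> real m" by (simp add: divide_le_eq)
    then have sm: "s \<in> {0..real m}" "real i / real ?k \<in> {0..real m}"
      using s by (auto intro: order_trans[rotated] divide_nonneg_nonneg)
    have "dist s (real i / real ?k) \<le> inverse (real ?k)"
      using s by (simp add: dist_real_def inverse_eq_divide add_divide_distrib)
    then have "dist (fst p s) (fst p (real i / real ?k)) < 1 / (2 * real m)"
      using d(2)[OF sm(2,1)] k by simp
    then have "\<bar>fst p s - of_rat (A i)\<bar> \<le> 1 / (2 * real m) + 1 / (2 * real m)"
      using A[of i] unfolding dist_real_def by linarith
    then have "\<bar>fst p s - of_rat (A i)\<bar> \<le> 1 / real m" by (simp add: field_simps)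
    moreover have "map of_rat (map A [0..<m * ?k]) ! i = (of_rat (A i) :: real)" using i by simp
    ultimately show "\<bar>fst p s - map of_rat (map A [0..<m * ?k]) ! i\<bar> \<le> 1 / real m"
      by (simp only:)
  next
    fix i assume "i \<le> m"
    then have "map of_rat (map B [0..<Suc m]) ! i = (of_rat (B i) :: real)" by (simp del: upt_Suc)
    then show "\<bar>snd p (real i * T / real m) - map of_rat (map B [0..<Suc m]) ! i\<bar> \<le> 1 / real m" using B[of i] by (simp only:)
  qed
  then show ?thesis using that[of ?k] by blast
qed

lemma open_Union_cells:
  assumes T: "0 < T" and U: "openin (path_topology T) U"
  shows "U = \<Union>{C. C \<subseteq> U \<and> (\<exists>m k (a :: rat list) (b :: rat list). 0 < m \<and> 0 < k \<and> C = path_cell T m k (map of_rat a) (map of_rat b))}"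
    (is "U = \<Union>?C")
proof
  show "U \<subseteq> \<Union>?C"
  proof
    fix p assume pU: "p \<in> U"
    have p: "p \<in> path_space T" using pU openin_subset[OF U] by auto
    obtain e where e: "0 < e" "\<And>q. q \<in> path_space T \<Longrightarrow> path_dist T p q < e \<Longrightarrow> q \<in> U"
      using dist_topology_imp_close[OF U[unfolded path_topology_def] pU] by metis
    obtain m where m: "0 < m" "(2 + T) / real m < e"
      using reals_Archimedean2[of "(2 + T) / e"] e(1) T
      by (metis divide_less_eq divide_pos_pos gr0I less_trans of_nat_0 mult.commute not_less_iff_gr_or_eq add_pos_pos zero_less_numeral of_nat_0_less_iff)
    obtain k and a b :: "rat list" where C: "0 < k" "p \<in> path_cell T m k (map of_rat a) (map of_rat b)"
      using path_cell_exists[OF T m(1) p] by blast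
    have "path_cell T m k (map of_rat a) (map of_rat b) \<subseteq> U"
    proof
      fix q assume q: "q \<in> path_cell T m k (map of_rat a) (map of_rat b)"
      have "path_dist T p q \<le> (2 + T) / real m"
        using T m by (intro path_dist_le path_cell_close[OF T m(1) C q]) auto
      then show "q \<in> U" using e(2) q m by (auto simp: path_cell_def)
    qed
    then show "p \<in> \<Union>?C" using C m by blast
  qed
qed blast

lemma measurable_borel_ofI:
  assumes "\<And>\<omega>. \<omega> \<in> space M \<Longrightarrow> Z \<omega> \<in> topspace E"
    and "\<And>U. openin E U \<Longrightarrow> {\<omega> \<in> space M. Z \<omega> \<in> U} \<in> sets M"
  shows "Z \<in> measurable M (borel_of E)"
  unfolding borel_of_def
proof (rule measurable_measure_of)
  show "{U. openin E U} \<subseteq> Pow (topspace E)" using openin_subset by blast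
  fix U assume "U \<in> {U. openin E U}"
  then show "Z -` U \<inter> space M \<in> sets M" using assms(2)[of U] by (simp add: vimage_def Int_def conj_commute)
qed (use assms(1) in auto)

text \<open>Open sets are countable unions of cells, and by continuity the suprema in the definition of a cell
  may be taken over countable dense sets of times. So measurability of the evaluations suffices.\<close>

lemma path_measurable:
  assumes T: "0 < T" and Z: "\<And>\<omega>. \<omega> \<in> space M \<Longrightarrow> Z \<omega> \<in> path_space T"
    and m1: "\<And>s. 0 \<le> s \<Longrightarrow> (\<lambda>\<omega>. fst (Z \<omega>) s) \<in> borel_measurable M"
    and m2: "\<And>t. t \<in> {0..T} \<Longrightarrow> (\<lambda>\<omega>. snd (Z \<omega>) t) \<in> borel_measurable M"
  shows "Z \<in> measurable M (borel_of (path_topology T))"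
proof (rule measurable_borel_ofI)
  show "Z \<omega> \<in> topspace (path_topology T)" if "\<omega> \<in> space M" for \<omega> using Z[OF that] by simp
  have cell: "{\<omega> \<in> space M. Z \<omega> \<in> path_cell T m k a b} \<in> sets M" if mk: "0 < m" "0 < k" for m k a b
  proof -
    have "\<exists>D. countable D \<and> D \<subseteq> {real i / real k..real (Suc i) / real k} \<and>
        {real i / real k..real (Suc i) / real k} \<subseteq> closure D" for i
      using separable[of "{real i / real k..real (Suc i) / real k}"] by metis
    then obtain D where D: "\<And>i. countable (D i)" "\<And>i. D i \<subseteq> {real i / real k..real (Suc i) / real k}"
      "\<And>i. {real i / real k..real (Suc i) / real k} \<subseteq> closure (D i)" by metis
    have Dpos: "0 \<le> s" if "s \<in> D i" for s i
    proof -
      have "real i / real k \<le> s" using D(2)[of i] that by auto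
      then show ?thesis by (rule order_trans[rotated]) simp
    qed
    have dense: "(\<forall>s\<in>{real i / real k..real (Suc i) / real k}. \<bar>\<phi> s - c\<bar> \<le> r) \<longleftrightarrow> (\<forall>s\<in>D i. \<bar>\<phi> s - c\<bar> \<le> r)"
      if "\<phi> \<in> continuous_paths" for \<phi> i c and r :: real
    proof
      assume *: "\<forall>s\<in>D i. \<bar>\<phi> s - c\<bar> \<le> r"
      have cl: "closure (D i) \<subseteq> {real i / real k..real (Suc i) / real k}"
        by (rule closure_minimal[OF D(2)]) simp
      then have "continuous_on (closure (D i)) (\<lambda>s. \<bar>\<phi> s - c\<bar>)"
      proof (intro continuous_intros)
        have "0 \<le> real i / real k" by simp
        then have "closure (D i) \<subseteq> {0..}" using cl by (meson atLeastAtMost_iff atLeast_iff subsetD subsetI order_trans)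
        then show "continuous_on (closure (D i)) \<phi>"
          using that continuous_on_subset by (auto simp: continuous_paths_def)
      qed
      then show "\<forall>s\<in>{real i / real k..real (Suc i) / real k}. \<bar>\<phi> s - c\<bar> \<le> r"
        using continuous_le_on_closure * D(3) by blast
    qed (use D(2) in auto)
    have grid: "real i * T / real m \<in> {0..T}" if "i \<le> m" for i
      using that T mk by (auto simp: field_simps)
    have "{\<omega> \<in> space M. Z \<omega> \<in> path_cell T m k a b} =
      {\<omega> \<in> space M. (\<forall>i\<in>{..<m * k}. \<forall>s\<in>D i. \<bar>fst (Z \<omega>) s - a ! i\<bar> \<le> 1 / real m) \<and>
         (\<forall>i\<in>{..m}. \<bar>snd (Z \<omega>) (real i * T / real m) - b ! i\<bar> \<le> 1 / real m)}"
    proof (rule Collect_cong, rule conj_cong[OF HOL.refl])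
      fix \<omega> assume "\<omega> \<in> space M"
      then have "Z \<omega> \<in> path_space T" "fst (Z \<omega>) \<in> continuous_paths" using Z by (auto simp: path_space_def mem_Times_iff)
      then show "Z \<omega> \<in> path_cell T m k a b \<longleftrightarrow>
         (\<forall>i\<in>{..<m * k}. \<forall>s\<in>D i. \<bar>fst (Z \<omega>) s - a ! i\<bar> \<le> 1 / real m) \<and>
         (\<forall>i\<in>{..m}. \<bar>snd (Z \<omega>) (real i * T / real m) - b ! i\<bar> \<le> 1 / real m)"
        unfolding path_cell_def mem_Collect_eq dense[OF \<open>fst (Z \<omega>) \<in> continuous_paths\<close>]
        by (simp only: Ball_def lessThan_iff atMost_iff) simp
    qed
    also have "\<dots> \<in> sets M"
    proof (rule sets.sets_Collect_conj)
      have "{\<omega> \<in> space M. \<bar>fst (Z \<omega>) s - a ! i\<bar> \<le> 1 / real m} \<in> sets M" if "s \<in> D i" for i s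
      proof -
        have [measurable]: "(\<lambda>\<omega>. fst (Z \<omega>) s) \<in> borel_measurable M" using m1 Dpos that by blast
        show ?thesis by measurable
      qed
      then have "{\<omega> \<in> space M. \<forall>s\<in>D i. \<bar>fst (Z \<omega>) s - a ! i\<bar> \<le> 1 / real m} \<in> sets M" for i
        using D(1) by (rule sets.sets_Collect_countable_All') auto
      then show "{\<omega> \<in> space M. \<forall>i\<in>{..<m * k}. \<forall>s\<in>D i. \<bar>fst (Z \<omega>) s - a ! i\<bar> \<le> 1 / real m} \<in> sets M"
        by (rule sets.sets_Collect_countable_All') (auto simp: countable_finite)
      have "{\<omega> \<in> space M. \<bar>snd (Z \<omega>) (real i * T / real m) - b ! i\<bar> \<le> 1 / real m} \<in> sets M" if "i \<in> {..m}" for i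
      proof -
        have [measurable]: "(\<lambda>\<omega>. snd (Z \<omega>) (real i * T / real m)) \<in> borel_measurable M" using m2 grid that by simp
        show ?thesis by measurable
      qed
      then show "{\<omega> \<in> space M. \<forall>i\<in>{..m}. \<bar>snd (Z \<omega>) (real i * T / real m) - b ! i\<bar> \<le> 1 / real m} \<in> sets M"
        by (rule sets.sets_Collect_countable_All') (auto simp: countable_finite)
    qed
    finally show ?thesis .
  qed
  fix U assume U: "openin (path_topology T) U"
  let ?C = "{C. C \<subseteq> U \<and> (\<exists>m k (a :: rat list) (b :: rat list). 0 < m \<and> 0 < k \<and> C = path_cell T m k (map of_rat a) (map of_rat b))}"
  have "?C \<subseteq> (\<lambda>(m, k, a, b). path_cell T m k (map of_rat a) (map of_rat b)) ` (UNIV :: (nat \<times> nat \<times> rat list \<times> rat list) set)"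
    by force
  then have "countable ?C" by (rule countable_subset) simp
  moreover have "{\<omega> \<in> space M. Z \<omega> \<in> U} = (\<Union>C\<in>?C. {\<omega> \<in> space M. Z \<omega> \<in> C})"
    by (subst open_Union_cells[OF T U]) blast
  ultimately show "{\<omega> \<in> space M. Z \<omega> \<in> U} \<in> sets M"
    using cell by (auto intro!: sets.countable_UN')
qed

section \<open>Convergence in law\<close>

lemma space_borel_of [simp]: "space (borel_of E) = topspace E"
  by (simp add: borel_of_def space_measure_of_conv)

lemma sets_borel_of: "openin E U \<Longrightarrow> U \<in> sets (borel_of E)"
proof -
  assume "openin E U"
  moreover have "{U. openin E U} \<subseteq> Pow (topspace E)" using openin_subset by blast
  ultimately show ?thesis by (simp add: borel_of_def)
qed

lemma continuous_map_borel_of: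
  assumes "continuous_map E E' g" shows "g \<in> measurable (borel_of E) (borel_of E')"
proof (rule measurable_borel_ofI)
  show "g \<omega> \<in> topspace E'" if "\<omega> \<in> space (borel_of E)" for \<omega>
    using assms that by (auto simp: continuous_map_def)
  fix U assume "openin E' U"
  then have "openin E {x \<in> topspace E. g x \<in> U}" using assms by (auto simp: continuous_map_def)
  then show "{\<omega> \<in> space (borel_of E). g \<omega> \<in> U} \<in> sets (borel_of E)"
    using sets_borel_of by simp
qed

lemma borel_of_euclideanreal: "borel_of euclideanreal = (borel :: real measure)"
  by (simp add: borel_of_def borel_def)

lemma continuous_map_borel_measurable:
  "continuous_map E euclideanreal h \<Longrightarrow> h \<in> borel_measurable (borel_of E)"
  using continuous_map_borel_of[of E euclideanreal h] by (simp add: borel_of_euclideanreal)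

lemma converges_in_law_continuous_map:
  assumes "converges_in_law E M Z N Z'" and g: "continuous_map E E' g"
  shows "converges_in_law E' M (\<lambda>n \<omega>. g (Z n \<omega>)) N (\<lambda>\<omega>. g (Z' \<omega>))"
proof -
  note gm = continuous_map_borel_of[OF g]
  obtain Y Y' where Y: "\<And>n. Y n \<in> measurable (M n) (borel_of E)" "\<And>n. AE \<omega> in M n. Y n \<omega> = Z n \<omega>"
    and Y': "Y' \<in> measurable N (borel_of E)" "AE \<omega> in N. Y' \<omega> = Z' \<omega>"
    and w: "weakly_converges E (\<lambda>n. distr (M n) (borel_of E) (Y n)) (distr N (borel_of E) Y')"
    using assms(1) unfolding converges_in_law_def by blast
  have "weakly_converges E' (\<lambda>n. distr (M n) (borel_of E') (\<lambda>\<omega>. g (Y n \<omega>)))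
      (distr N (borel_of E') (\<lambda>\<omega>. g (Y' \<omega>)))"
    unfolding weakly_converges_def
  proof (intro allI impI)
    fix h assume h: "continuous_map E' euclideanreal h \<and> bounded (h ` topspace E')"
    have "continuous_map E euclideanreal (h \<circ> g)" using g h continuous_map_compose by blast
    moreover have "bounded ((h \<circ> g) ` topspace E)"
      by (rule bounded_subset[OF conjunct2[OF h]]) (use g in \<open>auto simp: continuous_map_def\<close>)
    ultimately have "(\<lambda>n. \<integral>x. (h \<circ> g) x \<partial>distr (M n) (borel_of E) (Y n)) \<longlonglongrightarrow> (\<integral>x. (h \<circ> g) x \<partial>distr N (borel_of E) Y')"
      using w unfolding weakly_converges_def by blast
    then have "(\<lambda>n. \<integral>x. (h \<circ> g) (Y n x) \<partial>M n) \<longlonglongrightarrow> (\<integral>x. (h \<circ> g) (Y' x) \<partial>N)"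
      using \<open>continuous_map E euclideanreal (h \<circ> g)\<close> Y(1) Y'(1)
      by (simp only: integral_distr[OF _ continuous_map_borel_measurable])
    moreover have "h \<in> borel_measurable (borel_of E')" using h continuous_map_borel_measurable by blast
    ultimately show "(\<lambda>n. \<integral>x. h x \<partial>distr (M n) (borel_of E') (\<lambda>\<omega>. g (Y n \<omega>)))
       \<longlonglongrightarrow> (\<integral>x. h x \<partial>distr N (borel_of E') (\<lambda>\<omega>. g (Y' \<omega>)))"
      using Y(1) Y'(1) measurable_compose[OF Y(1) gm] measurable_compose[OF Y'(1) gm]
      by (simp add: integral_distr)
  qed
  moreover have "\<And>n. (\<lambda>\<omega>. g (Y n \<omega>)) \<in> measurable (M n) (borel_of E')" "(\<lambda>\<omega>. g (Y' \<omega>)) \<in> measurable N (borel_of E')"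
    using measurable_compose[OF Y(1) gm] measurable_compose[OF Y'(1) gm] by auto
  moreover have "AE \<omega> in M n. g (Y n \<omega>) = g (Z n \<omega>)" for n using Y(2)[of n] by eventually_elim simp
  moreover have "AE \<omega> in N. g (Y' \<omega>) = g (Z' \<omega>)" using Y'(2) by eventually_elim simp
  ultimately show ?thesis unfolding converges_in_law_def
    by (intro exI[of _ "\<lambda>n \<omega>. g (Y n \<omega>)"] exI[of _ "\<lambda>\<omega>. g (Y' \<omega>)"]) simp
qed

locale pseudometric =
  fixes A :: "'b set" and d :: "'b \<Rightarrow> 'b \<Rightarrow> real"
  assumes nonneg: "0 \<le> d x y" and sym: "d x y = d y x"
    and triangle: "d x z \<le> d x y + d y z" and refl: "x \<in> A \<Longrightarrow> d x x = 0"
begin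

abbreviation "E \<equiv> dist_topology A d"

text \<open>The inf-convolution with \<open>k d\<close>, which is the largest minorant of \<open>h\<close> that is \<open>k\<close>-Lipschitz.\<close>

definition lower_envelope :: "('b \<Rightarrow> real) \<Rightarrow> nat \<Rightarrow> 'b \<Rightarrow> real" where
  "lower_envelope h k x = (INF y\<in>A. h y + real k * d x y)"

lemma lipschitz_continuous_map:
  assumes "0 \<le> L" "\<And>x y. x \<in> A \<Longrightarrow> y \<in> A \<Longrightarrow> \<bar>h x - h y\<bar> \<le> L * d x y"
  shows "continuous_map E euclideanreal h"
  unfolding continuous_map_def
proof (intro conjI allI impI)
  fix U :: "real set" assume "openin euclideanreal U"
  then have U: "open U" by simp
  show "openin E {x \<in> topspace E. h x \<in> U}"
    unfolding openin_dist_topology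
  proof (intro conjI ballI)
    fix x assume x: "x \<in> {x \<in> topspace E. h x \<in> U}"
    then obtain e where e: "0 < e" "\<And>z. dist z (h x) < e \<Longrightarrow> z \<in> U" using U unfolding open_dist by blast
    have "h y \<in> U" if "y \<in> A" "d x y < e / (L + 1)" for y
    proof (rule e(2))
      have "\<bar>h x - h y\<bar> \<le> L * d x y" using assms(2) x that by simp
      also have "\<dots> \<le> (L + 1) * d x y" using nonneg[of x y] by (simp add: algebra_simps)
      also have "\<dots> < e" using that assms(1) by (simp add: field_simps)
      finally show "dist (h y) (h x) < e" by (simp add: dist_real_def abs_minus_commute)
    qed
    then show "\<exists>e>0. \<forall>y\<in>A. d x y < e \<longrightarrow> y \<in> {x \<in> topspace E. h x \<in> U}"
      using e(1) assms(1) by (intro exI[of _ "e / (L + 1)"]) auto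
  qed auto
qed auto

context
  fixes h :: "'b \<Rightarrow> real" and C :: real
  assumes bound: "\<And>x. x \<in> A \<Longrightarrow> \<bar>h x\<bar> \<le> C"
begin

lemma envelope_bdd: "bdd_below ((\<lambda>y. h y + real k * d x y) ` A)"
proof (rule bdd_belowI2[of _ "- C"])
  fix y assume "y \<in> A"
  moreover have "0 \<le> real k * d x y" using nonneg by simp
  ultimately show "- C \<le> h y + real k * d x y" using bound[of y] by linarith
qed

lemma envelope_le: "x \<in> A \<Longrightarrow> lower_envelope h k x \<le> h x"
  using cINF_lower[OF envelope_bdd, of x k x] refl unfolding lower_envelope_def by simp

lemma envelope_ge: "x \<in> A \<Longrightarrow> - C \<le> lower_envelope h k x"
  unfolding lower_envelope_def
proof (rule cINF_greatest)
  fix y assume "y \<in> A"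
  moreover have "0 \<le> real k * d x y" using nonneg by simp
  ultimately show "- C \<le> h y + real k * d x y" using bound[of y] by linarith
qed auto

lemma envelope_lipschitz:
  assumes "x \<in> A" "y \<in> A"
  shows "lower_envelope h k x \<le> lower_envelope h k y + real k * d x y"
proof -
  have "lower_envelope h k x - real k * d x y \<le> h z + real k * d y z" if "z \<in> A" for z
  proof -
    have "lower_envelope h k x \<le> h z + real k * d x z"
      unfolding lower_envelope_def by (rule cINF_lower[OF envelope_bdd that])
    also have "\<dots> \<le> h z + real k * (d x y + d y z)"
      using triangle by (simp add: mult_left_mono)
    finally show ?thesis by (simp add: algebra_simps)
  qed
  then have "lower_envelope h k x - real k * d x y \<le> lower_envelope h k y"
    unfolding lower_envelope_def[of h k y] using assms by (intro cINF_greatest) auto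
  then show ?thesis by simp
qed

lemma envelope_continuous: "continuous_map E euclideanreal (lower_envelope h k)"
proof (rule lipschitz_continuous_map[of "real k"])
  fix x y assume "x \<in> A" "y \<in> A"
  then show "\<bar>lower_envelope h k x - lower_envelope h k y\<bar> \<le> real k * d x y"
    using envelope_lipschitz[of x y k] envelope_lipschitz[of y x k] sym[of x y] by (simp add: abs_le_iff)
qed simp

lemma envelope_tendsto:
  assumes h: "continuous_map E euclideanreal h" and x: "x \<in> A"
  shows "(\<lambda>k. lower_envelope h k x) \<longlonglongrightarrow> h x"
proof (rule LIMSEQ_I)
  fix r :: real assume r: "0 < r"
  have "openin E {y \<in> topspace E. h y \<in> {h x - r / 2<..}}"
    using h unfolding continuous_map_def by (metis open_greaterThan open_openin)
  moreover have "x \<in> {y \<in> topspace E. h y \<in> {h x - r / 2<..}}" using x r by simp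
  ultimately obtain e where e: "0 < e" "\<And>y. y \<in> A \<Longrightarrow> d x y < e \<Longrightarrow> y \<in> {y \<in> topspace E. h y \<in> {h x - r / 2<..}}"
    by (rule dist_topology_imp_close) blast
  obtain k0 where k0: "2 * C / e \<le> real k0" using real_arch_simple by blast
  have "h x - r / 2 \<le> lower_envelope h k x" if "k0 \<le> k" for k
    unfolding lower_envelope_def
  proof (rule cINF_greatest)
    fix y assume y: "y \<in> A"
    have p: "0 \<le> real k * d x y" using nonneg by simp
    show "h x - r / 2 \<le> h y + real k * d x y"
    proof (cases "d x y < e")
      case True
      then show ?thesis using e(2)[OF y] p by auto
    next
      case False
      have "2 * C \<le> real k0 * e" using k0 e(1) by (simp add: field_simps)
      also have "\<dots> \<le> real k * d x y" using False that e(1) by (intro mult_mono) auto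
      finally show ?thesis using bound[OF x] bound[OF y] r by linarith
    qed
  qed (use x in auto)
  then have "norm (lower_envelope h k x - h x) < r" if "k0 \<le> k" for k
    unfolding real_norm_def using envelope_le[OF x, of k] that r by force
  then show "\<exists>k0. \<forall>k\<ge>k0. norm (lower_envelope h k x - h x) < r" by blast
qed

end

text \<open>For a Lipschitz test function closeness in probability is enough, and the means of the Lipschitz
  minorants of \<open>h\<close> increase to that of \<open>h\<close> under the fixed law \<open>\<mu>\<close>.\<close>

lemma liminf_of_close:
  fixes M :: "nat \<Rightarrow> 'a measure"
  assumes P: "\<And>n. prob_space (M n)" "prob_space \<mu>"
    and Y: "\<And>n. Y n \<in> measurable (M n) (borel_of E)" and Y0: "\<And>n. Y0 n \<in> measurable (M n) (borel_of E)"
    and law: "\<And>n. distr (M n) (borel_of E) (Y0 n) = \<mu>"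
    and close: "\<And>e. 0 < e \<Longrightarrow> \<forall>\<^sub>F n in sequentially. \<exists>Bad\<in>sets (M n). measure (M n) Bad \<le> e \<and>
       (\<forall>\<omega>\<in>space (M n) - Bad. d (Y n \<omega>) (Y0 n \<omega>) \<le> e)"
    and h: "continuous_map E euclideanreal h" and bound: "\<And>x. x \<in> A \<Longrightarrow> \<bar>h x\<bar> \<le> C" and r: "0 < r"
  shows "\<forall>\<^sub>F n in sequentially. (\<integral>x. h x \<partial>\<mu>) - r \<le> (\<integral>x. h x \<partial>distr (M n) (borel_of E) (Y n))"
proof -
  interpret mu: prob_space \<mu> by fact
  have mu_sets: "sets \<mu> = sets (borel_of E)" using law[of 0] by (metis sets_distr)
  have mu_space: "space \<mu> = A" using sets_eq_imp_space_eq[OF mu_sets] by simp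
  have hm: "h \<in> borel_measurable (borel_of E)" by (rule continuous_map_borel_measurable[OF h])
  let ?k = "lower_envelope h"
  have km: "?k k \<in> borel_measurable (borel_of E)" for k
    by (rule continuous_map_borel_measurable[OF envelope_continuous[of h C, OF bound]])
  have kb: "\<bar>?k k x\<bar> \<le> C" if "x \<in> A" for k x
    using envelope_le[of h C x k, OF bound that] envelope_ge[of h C x k, OF bound that] bound[OF that] by linarith
  have "(\<lambda>k. \<integral>x. ?k k x \<partial>\<mu>) \<longlonglongrightarrow> (\<integral>x. h x \<partial>\<mu>)"
  proof (rule integral_dominated_convergence[where w = "\<lambda>_. C"])
    show "h \<in> borel_measurable \<mu>" "\<And>k. ?k k \<in> borel_measurable \<mu>"
      using hm km mu_sets by (simp_all cong: measurable_cong_sets)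
    show "AE x in \<mu>. (\<lambda>k. ?k k x) \<longlonglongrightarrow> h x"
      by (rule AE_I2) (use envelope_tendsto[of h C, OF bound h] mu_space in auto)
    show "AE x in \<mu>. norm (?k k x) \<le> C" for k by (rule AE_I2) (use kb mu_space in auto)
  qed simp
  then have "\<forall>\<^sub>F k in sequentially. (\<integral>x. h x \<partial>\<mu>) - r / 2 < (\<integral>x. ?k k x \<partial>\<mu>)"
    by (rule order_tendstoD) (use r in simp)
  then obtain k where k: "(\<integral>x. h x \<partial>\<mu>) - r / 2 < (\<integral>x. ?k k x \<partial>\<mu>)"
    by (auto simp: eventually_sequentially)
  have C0: "0 \<le> C" using mu.not_empty bound mu_space by force
  \<comment> \<open>Off the exceptional set the minorant changes by at most \<open>k * e\<close>, on it by at most \<open>2 * C\<close>.\<close>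
  define e where "e = r / (2 * (real k + 2 * C + 1))"
  have e: "0 < e" "(real k + 2 * C) * e \<le> r / 2"
  proof -
    have pos: "0 < real k + 2 * C + 1" using C0 by (simp add: add_nonneg_pos)
    then show "0 < e" using r by (simp add: e_def)
    have "(real k + 2 * C) * e \<le> (real k + 2 * C + 1) * e" using \<open>0 < e\<close> by (simp add: algebra_simps)
    also have "\<dots> = r / 2" using pos unfolding e_def by (simp add: field_simps)
    finally show "(real k + 2 * C) * e \<le> r / 2" .
  qed
  from close[OF e(1)] show ?thesis
  proof eventually_elim
    case (elim n)
    interpret Mn: prob_space "M n" by (rule P)
    obtain Bad where Bad: "Bad \<in> sets (M n)" "measure (M n) Bad \<le> e"
      "\<And>\<omega>. \<omega> \<in> space (M n) - Bad \<Longrightarrow> d (Y n \<omega>) (Y0 n \<omega>) \<le> e" using elim by blast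
    have YA: "Y n \<omega> \<in> A" "Y0 n \<omega> \<in> A" if "\<omega> \<in> space (M n)" for \<omega>
      using measurable_space[OF Y that] measurable_space[OF Y0 that] by auto
    have pt: "?k k (Y0 n \<omega>) \<le> h (Y n \<omega>) + (real k * e + 2 * C * indicator Bad \<omega>)" if "\<omega> \<in> space (M n)" for \<omega>
    proof (cases "\<omega> \<in> Bad")
      case True
      have "0 \<le> real k * e" using e by simp
      moreover have "\<bar>?k k (Y0 n \<omega>)\<bar> \<le> C" "\<bar>h (Y n \<omega>)\<bar> \<le> C" using kb bound YA[OF that] by auto
      ultimately show ?thesis using True by (simp add: abs_le_iff)
    next
      case False
      have "?k k (Y0 n \<omega>) \<le> ?k k (Y n \<omega>) + real k * d (Y0 n \<omega>) (Y n \<omega>)"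
        by (rule envelope_lipschitz[of h C, OF bound]) (use YA[OF that] in auto)
      also have "real k * d (Y0 n \<omega>) (Y n \<omega>) \<le> real k * e"
        using Bad(3)[of \<omega>] False that sym by (intro mult_left_mono) auto
      also have "?k k (Y n \<omega>) \<le> h (Y n \<omega>)" by (rule envelope_le[of h C, OF bound YA(1)[OF that]])
      finally show ?thesis using False by simp
    qed
    have [measurable]: "(\<lambda>\<omega>. ?k k (Y0 n \<omega>)) \<in> borel_measurable (M n)" "(\<lambda>\<omega>. h (Y n \<omega>)) \<in> borel_measurable (M n)"
      using measurable_compose[OF Y0 km] measurable_compose[OF Y hm] by auto
    have i1: "integrable (M n) (\<lambda>\<omega>. ?k k (Y0 n \<omega>))"
      by (rule Mn.integrable_const_bound[where B = C]) (use kb YA in auto)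
    have i2: "integrable (M n) (\<lambda>\<omega>. h (Y n \<omega>))"
      by (rule Mn.integrable_const_bound[where B = C]) (use bound YA in auto)
    have ind: "integrable (M n) (indicator Bad :: _ \<Rightarrow> real)"
      by (rule integrable_real_indicator[OF Bad(1)]) (simp add: Mn.emeasure_eq_measure)
    have i3: "integrable (M n) (\<lambda>\<omega>. real k * e + 2 * C * indicator Bad \<omega> :: real)"
      using ind by (intro Bochner_Integration.integrable_add integrable_mult_right) auto
    have "(\<integral>x. ?k k x \<partial>\<mu>) = (\<integral>\<omega>. ?k k (Y0 n \<omega>) \<partial>M n)"
      unfolding law[of n, symmetric] by (rule integral_distr[OF Y0 km])
    also have "\<dots> \<le> (\<integral>\<omega>. h (Y n \<omega>) + (real k * e + 2 * C * indicator Bad \<omega>) \<partial>M n)"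
      by (rule integral_mono[OF i1 Bochner_Integration.integrable_add[OF i2 i3]]) (rule pt)
    also have "\<dots> = (\<integral>\<omega>. h (Y n \<omega>) \<partial>M n) + (real k * e + 2 * C * measure (M n) Bad)"
      using i2 i3 ind Bad(1) by (simp add: Mn.prob_space)
    also have "\<dots> \<le> (\<integral>\<omega>. h (Y n \<omega>) \<partial>M n) + (real k + 2 * C) * e"
      using Bad(2) C0 by (simp add: distrib_right mult_left_mono)
    finally have "(\<integral>x. ?k k x \<partial>\<mu>) \<le> (\<integral>x. h x \<partial>distr (M n) (borel_of E) (Y n)) + r / 2"
      using e(2) by (simp add: integral_distr[OF Y hm])
    then show ?case using k by linarith
  qed
qed

text \<open>The one-sided bound for \<open>h\<close> and for \<open>- h\<close>. That the comparison variables \<open>Y0 n\<close> all have the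
  law \<open>\<mu>\<close> plays the part of tightness.\<close>

lemma weakly_converges_of_close:
  fixes M :: "nat \<Rightarrow> 'a measure"
  assumes P: "\<And>n. prob_space (M n)" "prob_space \<mu>"
    and Y: "\<And>n. Y n \<in> measurable (M n) (borel_of E)" and Y0: "\<And>n. Y0 n \<in> measurable (M n) (borel_of E)"
    and law: "\<And>n. distr (M n) (borel_of E) (Y0 n) = \<mu>"
    and close: "\<And>e. 0 < e \<Longrightarrow> \<forall>\<^sub>F n in sequentially. \<exists>Bad\<in>sets (M n). measure (M n) Bad \<le> e \<and>
       (\<forall>\<omega>\<in>space (M n) - Bad. d (Y n \<omega>) (Y0 n \<omega>) \<le> e)"
  shows "weakly_converges E (\<lambda>n. distr (M n) (borel_of E) (Y n)) \<mu>"
  unfolding weakly_converges_def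
proof (intro allI impI)
  fix h assume h: "continuous_map E euclideanreal h \<and> bounded (h ` topspace E)"
  then obtain C where C: "\<And>x. x \<in> A \<Longrightarrow> \<bar>h x\<bar> \<le> C" by (auto simp: bounded_iff)
  have minus: "continuous_map E euclideanreal (\<lambda>x. - h x)" using h by (intro continuous_intros) simp
  note liminf = liminf_of_close[OF P Y Y0 law close]
  show "(\<lambda>n. \<integral>x. h x \<partial>distr (M n) (borel_of E) (Y n)) \<longlonglongrightarrow> (\<integral>x. h x \<partial>\<mu>)"
  proof (rule tendstoI)
    fix r :: real assume r: "0 < r"
    have "\<forall>\<^sub>F n in sequentially. (\<integral>x. h x \<partial>\<mu>) - r / 2 \<le> (\<integral>x. h x \<partial>distr (M n) (borel_of E) (Y n))"
      using liminf[of h C "r / 2"] h C r by simp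
    moreover have "\<forall>\<^sub>F n in sequentially. (\<integral>x. - h x \<partial>\<mu>) - r / 2 \<le> (\<integral>x. - h x \<partial>distr (M n) (borel_of E) (Y n))"
      using liminf[of "\<lambda>x. - h x" C "r / 2"] minus C r by simp
    ultimately show "\<forall>\<^sub>F n in sequentially. dist (\<integral>x. h x \<partial>distr (M n) (borel_of E) (Y n)) (\<integral>x. h x \<partial>\<mu>) < r"
      by eventually_elim (use r in \<open>simp add: dist_real_def abs_less_iff; linarith\<close>)
  qed
qed

end

lemma pseudometric_path_dist:
  assumes "0 < T" shows "pseudometric (path_space T) (path_dist T)"
  by unfold_locales (use path_dist_nonneg path_dist_sym path_dist_triangle path_dist_refl[OF _ assms] in auto)

section \<open>The law of a Brownian path\<close>

locale brownian =
  fixes M :: "'a measure" and F :: "real \<Rightarrow> 'a measure" and W :: "real \<Rightarrow> 'a \<Rightarrow> real"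
  assumes brownian: "brownian_motion_wrt M F W"
begin

sublocale prob_space M
  using brownian by (simp add: brownian_motion_wrt_def filtered_prob_space_def)

lemma subalg: "subalgebra M (F t)"
  using brownian by (simp add: brownian_motion_wrt_def filtered_prob_space_def)

lemma space_F: "space (F t) = space M"
  using subalg by (simp add: subalgebra_def)

lemma F_mono: "s \<le> t \<Longrightarrow> subalgebra (F t) (F s)"
  using brownian filtration.sets_F_mono
  by (fastforce simp: brownian_motion_wrt_def filtered_prob_space_def subalgebra_def space_F)

lemma adapted: "0 \<le> t \<Longrightarrow> W t \<in> borel_measurable (F t)"
  using brownian by (simp add: brownian_motion_wrt_def)

lemma adapted_later: "0 \<le> s \<Longrightarrow> s \<le> t \<Longrightarrow> W s \<in> borel_measurable (F t)"
  using measurable_from_subalg[OF F_mono adapted] .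

lemma W_measurable [measurable]: "0 \<le> t \<Longrightarrow> W t \<in> borel_measurable M"
  using measurable_from_subalg[OF subalg adapted] .

lemma W_cont: "\<omega> \<in> space M \<Longrightarrow> continuous_on {0..} (\<lambda>t. W t \<omega>)"
  using brownian by (simp add: brownian_motion_wrt_def)

lemma W_0: "AE \<omega> in M. W 0 \<omega> = 0"
  using brownian by (simp add: brownian_motion_wrt_def)

lemma increment_distributed:
  "0 \<le> s \<Longrightarrow> s < t \<Longrightarrow> distributed M lborel (\<lambda>\<omega>. W t \<omega> - W s \<omega>) (\<lambda>x. ennreal (normal_density 0 (sqrt (t - s)) x))"
  using brownian by (simp add: brownian_motion_wrt_def)

text \<open>The constant \<open>indep_var\<close> relates variables with values in one type; \<open>\<phi>\<close> maps the increment into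
  the value space of \<open>X\<close>.\<close>

lemma increment_indep:
  assumes "0 \<le> s" "s < t" "X \<in> measurable (F s) S" "\<phi> \<in> measurable borel S"
  shows "indep_var S X S (\<lambda>\<omega>. \<phi> (W t \<omega> - W s \<omega>))"
  unfolding indep_var_eq
proof (intro conjI)
  have D: "(\<lambda>\<omega>. W t \<omega> - W s \<omega>) \<in> borel_measurable M"
    using assms by (intro borel_measurable_diff W_measurable) auto
  show "random_variable S X" using measurable_from_subalg[OF subalg assms(3)] .
  show "random_variable S (\<lambda>\<omega>. \<phi> (W t \<omega> - W s \<omega>))" using measurable_compose[OF D assms(4)] .
  let ?V = "vimage_algebra (space M) (\<lambda>\<omega>. W t \<omega> - W s \<omega>) borel"
  have ind: "indep_set (sets (F s)) (sets ?V)"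
    using brownian assms by (simp add: brownian_motion_wrt_def)
  have X: "sigma_sets (space M) {X -` A \<inter> space M | A. A \<in> sets S} \<subseteq> sets (F s)"
    using sets.sigma_sets_subset[of "{X -` A \<inter> space M | A. A \<in> sets S}" "F s"]
      measurable_sets[OF assms(3)] by (auto simp: space_F)
  have "(\<lambda>\<omega>. \<phi> (W t \<omega> - W s \<omega>)) \<in> measurable ?V S"
    by (rule measurable_compose[OF measurable_vimage_algebra1 assms(4)]) simp
  then have Y: "sigma_sets (space M) {(\<lambda>\<omega>. \<phi> (W t \<omega> - W s \<omega>)) -` A \<inter> space M | A. A \<in> sets S} \<subseteq> sets ?V"
    using sets.sigma_sets_subset[of "{(\<lambda>\<omega>. \<phi> (W t \<omega> - W s \<omega>)) -` A \<inter> space M | A. A \<in> sets S}" ?V]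
      measurable_sets[of "\<lambda>\<omega>. \<phi> (W t \<omega> - W s \<omega>)" ?V S] by auto
  show "indep_set (sigma_sets (space M) {X -` A \<inter> space M | A. A \<in> sets S})
     (sigma_sets (space M) {(\<lambda>\<omega>. \<phi> (W t \<omega> - W s \<omega>)) -` A \<inter> space M | A. A \<in> sets S})"
    unfolding indep_set_def
    by (rule indep_sets_mono_sets[OF ind[unfolded indep_set_def]])
      (use X Y in \<open>simp split: bool.splits\<close>)
qed

end

text \<open>A step of length zero is a point mass, so that repeated times and the time \<open>0\<close> are no special
  cases below.\<close>

definition brownian_step :: "real \<Rightarrow> real \<Rightarrow> real measure" where
  "brownian_step s t = (if s < t
     then density lborel (\<lambda>x. ennreal (normal_density 0 (sqrt (t - s)) x)) else return borel 0)"

lemma sets_brownian_step [measurable_cong, simp]: "sets (brownian_step s t) = sets borel"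
  by (simp add: brownian_step_def)

lemma prob_space_brownian_step: "prob_space (brownian_step s t)"
  by (simp add: brownian_step_def prob_space_normal_density prob_space_return)

text \<open>The probability that a Brownian motion which is at \<open>x\<close> at time \<open>s\<close> visits the given sets at the
  given later times, computed by integrating out one step after the other.\<close>

primrec cylinder_value :: "real \<Rightarrow> real \<Rightarrow> (real \<times> real set) list \<Rightarrow> ennreal" where
  "cylinder_value s x [] = 1"
| "cylinder_value s x (p # l) =
     (\<integral>\<^sup>+ y. indicator (snd p) (x + y) * cylinder_value (fst p) (x + y) l \<partial>brownian_step s (fst p))"

lemma cylinder_value_measurable [measurable]:
  assumes "\<And>p. p \<in> set l \<Longrightarrow> snd p \<in> sets borel"
  shows "(\<lambda>x. cylinder_value s x l) \<in> borel_measurable borel"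
  using assms
proof (induction l arbitrary: s)
  case (Cons p l)
  interpret step: prob_space "brownian_step s (fst p)" by (rule prob_space_brownian_step)
  have [measurable]: "snd p \<in> sets borel" "(\<lambda>x. cylinder_value (fst p) x l) \<in> borel_measurable borel"
    using Cons by auto
  have "(\<lambda>(x, y). indicator (snd p) (x + y) * cylinder_value (fst p) (x + y) l)
      \<in> borel_measurable (borel \<Otimes>\<^sub>M brownian_step s (fst p))"
    by measurable
  from step.borel_measurable_nn_integral[OF this] show ?case by simp
qed simp

context brownian
begin

lemma distr_increment:
  assumes "0 \<le> s" "s < t" shows "distr M borel (\<lambda>\<omega>. W t \<omega> - W s \<omega>) = brownian_step s t"
proof -
  have "distr M lborel (\<lambda>\<omega>. W t \<omega> - W s \<omega>) = brownian_step s t"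
    using increment_distributed[OF assms] assms by (simp add: distributed_def brownian_step_def)
  then show ?thesis by (metis distr_cong sets_lborel)
qed

text \<open>The increment is independent of the past, and Fubini integrates it out.\<close>

lemma markov_step:
  assumes st: "0 \<le> s" "s \<le> t" and Z: "Z \<in> borel_measurable (F s)" and g [measurable]: "g \<in> borel_measurable borel"
  shows "(\<integral>\<^sup>+\<omega>. Z \<omega> * g (W t \<omega>) \<partial>M) = (\<integral>\<^sup>+\<omega>. Z \<omega> * (\<integral>\<^sup>+y. g (W s \<omega> + y) \<partial>brownian_step s t) \<partial>M)"
proof (cases "s = t")
  case True
  then show ?thesis by (simp add: brownian_step_def nn_integral_return)
next
  case False
  then have lt: "s < t" using st by simp
  let ?D = "\<lambda>\<omega>. W t \<omega> - W s \<omega>" and ?X = "\<lambda>\<omega>. (Z \<omega>, W s \<omega>)"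
  let ?S = "borel \<Otimes>\<^sub>M borel :: (ennreal \<times> real) measure"
  have X: "?X \<in> measurable (F s) ?S" using Z adapted[OF st(1)] by measurable
  have [measurable]: "Z \<in> borel_measurable M" using measurable_from_subalg[OF subalg Z] .
  have XM [measurable]: "?X \<in> measurable M ?S" using measurable_from_subalg[OF subalg X] .
  have [measurable]: "W t \<in> borel_measurable M" "W s \<in> borel_measurable M" using st by auto
  let ?Y = "\<lambda>\<omega>. (0 :: ennreal, ?D \<omega>)"
  have YM [measurable]: "?Y \<in> measurable M ?S" by measurable
  interpret step: prob_space "distr M ?S ?Y" by (rule prob_space_distr[OF YM])
  have law: "distr M ?S ?X \<Otimes>\<^sub>M distr M ?S ?Y = distr M (?S \<Otimes>\<^sub>M ?S) (\<lambda>\<omega>. (?X \<omega>, ?Y \<omega>))"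
    using increment_indep[OF st(1) lt X, of "\<lambda>y. (0, y)"] unfolding indep_var_distribution_eq by simp
  let ?f = "\<lambda>p. fst (fst p) * g (snd (fst p) + snd (snd p))"
  have f: "?f \<in> borel_measurable (?S \<Otimes>\<^sub>M ?S)" by measurable
  have inner: "(\<integral>\<^sup>+y. z * g (w + snd y) \<partial>distr M ?S ?Y) = z * (\<integral>\<^sup>+y. g (w + y) \<partial>brownian_step s t)" for z w
  proof -
    have "(\<integral>\<^sup>+y. z * g (w + snd y) \<partial>distr M ?S ?Y) = (\<integral>\<^sup>+\<omega>. z * g (w + ?D \<omega>) \<partial>M)"
      by (subst nn_integral_distr[OF YM]) auto
    also have "\<dots> = z * (\<integral>\<^sup>+\<omega>. g (w + ?D \<omega>) \<partial>M)" by (rule nn_integral_cmult) measurable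
    also have "(\<integral>\<^sup>+\<omega>. g (w + ?D \<omega>) \<partial>M) = (\<integral>\<^sup>+y. g (w + y) \<partial>distr M borel ?D)"
      by (subst nn_integral_distr) auto
    finally show ?thesis by (simp add: distr_increment[OF st(1) lt])
  qed
  have "(\<integral>\<^sup>+\<omega>. Z \<omega> * g (W t \<omega>) \<partial>M) = (\<integral>\<^sup>+p. ?f p \<partial>distr M (?S \<Otimes>\<^sub>M ?S) (\<lambda>\<omega>. (?X \<omega>, ?Y \<omega>)))"
    by (subst nn_integral_distr) (auto intro: f)
  also have "\<dots> = (\<integral>\<^sup>+x. \<integral>\<^sup>+y. ?f (x, y) \<partial>distr M ?S ?Y \<partial>distr M ?S ?X)"
    unfolding law[symmetric] by (subst step.nn_integral_fst[symmetric]) (auto intro: f cong: measurable_cong_sets)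
  also have "\<dots> = (\<integral>\<^sup>+x. fst x * (\<integral>\<^sup>+y. g (snd x + y) \<partial>brownian_step s t) \<partial>distr M ?S ?X)"
    by (simp add: inner)
  also have "\<dots> = (\<integral>\<^sup>+\<omega>. Z \<omega> * (\<integral>\<^sup>+y. g (W s \<omega> + y) \<partial>brownian_step s t) \<partial>M)"
  proof -
    interpret b: prob_space "brownian_step s t" by (rule prob_space_brownian_step)
    have "(\<lambda>(x, y). g (x + y)) \<in> borel_measurable (borel \<Otimes>\<^sub>M brownian_step s t)" by measurable
    from b.borel_measurable_nn_integral[OF this]
    have [measurable]: "(\<lambda>x. \<integral>\<^sup>+y. g (x + y) \<partial>brownian_step s t) \<in> borel_measurable borel" by simp
    show ?thesis by (subst nn_integral_distr[OF XM]) auto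
  qed
  finally show ?thesis .
qed

text \<open>In the induction along the list of times the weight \<open>Z\<close> absorbs the constraints at the times already
  passed, which are known at the current time.\<close>

lemma cylinder_integral:
  assumes "0 \<le> s" "sorted (s # map fst l)" "\<And>p. p \<in> set l \<Longrightarrow> snd p \<in> sets borel" "Z \<in> borel_measurable (F s)"
  shows "(\<integral>\<^sup>+\<omega>. Z \<omega> * (\<Prod>p\<leftarrow>l. indicator (snd p) (W (fst p) \<omega>)) \<partial>M) = (\<integral>\<^sup>+\<omega>. Z \<omega> * cylinder_value s (W s \<omega>) l \<partial>M)"
  using assms
proof (induction l arbitrary: s Z)
  case (Cons p l)
  let ?t = "fst p"
  have st: "0 \<le> s" "s \<le> ?t" using Cons.prems by auto
  have [measurable]: "snd p \<in> sets borel" using Cons.prems by simp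
  have [measurable]: "(\<lambda>x. cylinder_value ?t x l) \<in> borel_measurable borel" using Cons.prems by (intro cylinder_value_measurable) auto
  have Zt [measurable]: "Z \<in> borel_measurable (F ?t)" using measurable_from_subalg[OF F_mono[OF st(2)] Cons.prems(4)] .
  have [measurable]: "W ?t \<in> borel_measurable (F ?t)" using st by (intro adapted) simp
  have "(\<integral>\<^sup>+\<omega>. Z \<omega> * (\<Prod>p\<leftarrow>p # l. indicator (snd p) (W (fst p) \<omega>)) \<partial>M) =
     (\<integral>\<^sup>+\<omega>. (Z \<omega> * indicator (snd p) (W ?t \<omega>)) * (\<Prod>p\<leftarrow>l. indicator (snd p) (W (fst p) \<omega>)) \<partial>M)"
    by (simp add: mult.assoc)
  also have "\<dots> = (\<integral>\<^sup>+\<omega>. (Z \<omega> * indicator (snd p) (W ?t \<omega>)) * cylinder_value ?t (W ?t \<omega>) l \<partial>M)"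
    using Cons.prems st by (intro Cons.IH) auto
  also have "\<dots> = (\<integral>\<^sup>+\<omega>. Z \<omega> * (indicator (snd p) (W ?t \<omega>) * cylinder_value ?t (W ?t \<omega>) l) \<partial>M)"
    by (simp add: mult.assoc)
  also have "\<dots> = (\<integral>\<^sup>+\<omega>. Z \<omega> * cylinder_value s (W s \<omega>) (p # l) \<partial>M)"
    by (subst markov_step[OF st Cons.prems(4), of "\<lambda>x. indicator (snd p) x * cylinder_value ?t x l"]) auto
  finally show ?case .
qed simp

definition sample_path :: "'a \<Rightarrow> real \<Rightarrow> real" where
  "sample_path \<omega> = (\<lambda>t\<in>{0..}. W t \<omega>)"

lemma finite_dim_law:
  assumes "finite J" "J \<subseteq> {0..}" "\<And>t. t \<in> J \<Longrightarrow> A t \<in> sets borel"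
  shows "emeasure M {\<omega> \<in> space M. \<forall>t\<in>J. W t \<omega> \<in> A t} = cylinder_value 0 0 (map (\<lambda>t. (t, A t)) (sorted_list_of_set J))"
proof -
  define l where "l = map (\<lambda>t. (t, A t)) (sorted_list_of_set J)"
  have l: "map fst l = sorted_list_of_set J" "\<And>p. p \<in> set l \<Longrightarrow> snd p \<in> sets borel"
    using assms by (auto simp: l_def comp_def)
  have prod: "(\<Prod>p\<leftarrow>l. indicator (snd p) (W (fst p) \<omega>)) = (\<Prod>t\<in>J. indicator (A t) (W t \<omega>) :: ennreal)" for \<omega>
    using assms(1) prod.distinct_set_conv_list[of "sorted_list_of_set J" "\<lambda>t. indicator (A t) (W t \<omega>) :: ennreal"]
    by (simp add: l_def comp_def)
  have ind: "(\<Prod>t\<in>J. indicator (A t) (W t \<omega>) :: ennreal) = indicator {\<omega> \<in> space M. \<forall>t\<in>J. W t \<omega> \<in> A t} \<omega>"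
    if "\<omega> \<in> space M" for \<omega>
    using assms(1) that by (auto simp: indicator_def)
  have "{\<omega> \<in> space M. \<forall>t\<in>J. W t \<omega> \<in> A t} \<in> sets M"
  proof (rule sets.sets_Collect_countable_All')
    show "{\<omega> \<in> space M. W t \<omega> \<in> A t} \<in> sets M" if "t \<in> J" for t
    proof -
      have [measurable]: "W t \<in> borel_measurable M" "A t \<in> sets borel" using that assms by auto
      show ?thesis by measurable
    qed
  qed (use assms in \<open>simp add: countable_finite\<close>)
  then have "emeasure M {\<omega> \<in> space M. \<forall>t\<in>J. W t \<omega> \<in> A t} = (\<integral>\<^sup>+\<omega>. (\<Prod>t\<in>J. indicator (A t) (W t \<omega>)) \<partial>M)"
    by (simp add: ind cong: nn_integral_cong_simp)
  also have "\<dots> = (\<integral>\<^sup>+\<omega>. 1 * (\<Prod>p\<leftarrow>l. indicator (snd p) (W (fst p) \<omega>)) \<partial>M)"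
    by (simp add: prod)
  also have "\<dots> = (\<integral>\<^sup>+\<omega>. 1 * cylinder_value 0 (W 0 \<omega>) l \<partial>M)"
    using assms l by (intro cylinder_integral) auto
  also have "\<dots> = (\<integral>\<^sup>+\<omega>. cylinder_value 0 0 l \<partial>M)"
    by (intro nn_integral_cong_AE) (use W_0 in eventually_elim, simp)
  finally show ?thesis by (simp add: emeasure_space_1 l_def)
qed

end

text \<open>The trace of the product \<open>\<sigma>\<close>-algebra on the continuous paths. Functionals that depend on
  uncountably many evaluations, such as suprema and passage times, are measurable here because
  continuity reduces them to countably many.\<close>

definition path_sigma :: "(real \<Rightarrow> real) measure" where
  "path_sigma = restrict_space (PiM {0..} (\<lambda>_. borel)) continuous_paths"

lemma space_path_sigma [simp]: "space path_sigma = continuous_paths"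
  by (auto simp: path_sigma_def space_restrict_space space_PiM continuous_paths_def PiE_def)

lemma path_sigma_eval [measurable]:
  assumes "0 \<le> t" shows "(\<lambda>w. w t) \<in> borel_measurable path_sigma"
  unfolding path_sigma_def
  by (intro measurable_restrict_space1 measurable_component_singleton) (use assms in simp)

context brownian
begin

lemma sample_path_PiM: "sample_path \<in> measurable M (PiM {0..} (\<lambda>_. borel))"
  unfolding sample_path_def by (rule measurable_restrict) auto

lemma sample_path_continuous: "\<omega> \<in> space M \<Longrightarrow> sample_path \<omega> \<in> continuous_paths"
  using W_cont[of \<omega>] continuous_on_cong[of "{0..}" "{0..}" "sample_path \<omega>" "\<lambda>t. W t \<omega>"]
  by (simp add: continuous_paths_def sample_path_def)

lemma sample_path_measurable [measurable]: "sample_path \<in> measurable M path_sigma"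
  unfolding path_sigma_def
  by (rule measurable_restrict_space2) (use sample_path_continuous sample_path_PiM in auto)

end

text \<open>The finite-dimensional laws are the same integrals \<open>cylinder_value 0 0\<close> for both processes; they
  determine the law on the product space and hence on the trace.\<close>

lemma brownian_law_unique:
  assumes "brownian M F W" "brownian N G B"
  shows "distr M path_sigma (brownian.sample_path W) = distr N path_sigma (brownian.sample_path B)"
proof -
  interpret W: brownian M F W by fact
  interpret B: brownian N G B by fact
  let ?P = "PiM {0..} (\<lambda>_. borel) :: (real \<Rightarrow> real) measure"
  have eq: "distr M ?P W.sample_path = distr N ?P B.sample_path"
  proof (rule measure_eqI_PiM_infinite)
    fix A :: "real \<Rightarrow> real set" and J :: "real set" assume J: "finite J" "J \<subseteq> {0..}" "\<And>i. i \<in> J \<Longrightarrow> A i \<in> sets (borel :: real measure)"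
    have emb: "prod_emb {0..} (\<lambda>_. borel) J (Pi\<^sub>E J A) \<in> sets ?P" using J by (intro sets_PiM_I) auto
    have "W.sample_path -` prod_emb {0..} (\<lambda>_. borel) J (Pi\<^sub>E J A) \<inter> space M = {\<omega> \<in> space M. \<forall>t\<in>J. W t \<omega> \<in> A t}"
      using J(2) by (auto simp: prod_emb_def W.sample_path_def PiE_def Pi_def subset_iff extensional_def)
    moreover have "B.sample_path -` prod_emb {0..} (\<lambda>_. borel) J (Pi\<^sub>E J A) \<inter> space N = {\<omega> \<in> space N. \<forall>t\<in>J. B t \<omega> \<in> A t}"
      using J(2) by (auto simp: prod_emb_def B.sample_path_def PiE_def Pi_def subset_iff extensional_def)
    ultimately show "distr M ?P W.sample_path (prod_emb {0..} (\<lambda>_. borel) J (Pi\<^sub>E J A)) =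
        distr N ?P B.sample_path (prod_emb {0..} (\<lambda>_. borel) J (Pi\<^sub>E J A))"
      using W.finite_dim_law[OF J] B.finite_dim_law[OF J] emb W.sample_path_PiM B.sample_path_PiM
      by (simp add: emeasure_distr)
  next
    show "finite_measure (distr M ?P W.sample_path)"
      using W.prob_space_distr[OF W.sample_path_PiM] by (simp add: prob_space_def)
  qed auto
  show ?thesis
  proof (rule measure_eqI)
    fix S assume "S \<in> sets (distr M path_sigma W.sample_path)"
    then obtain D where D: "D \<in> sets ?P" "S = continuous_paths \<inter> D"
      by (auto simp: path_sigma_def sets_restrict_space)
    then have S: "S \<in> sets path_sigma" by (auto simp: path_sigma_def sets_restrict_space)
    have "W.sample_path -` S \<inter> space M = W.sample_path -` D \<inter> space M"
      "B.sample_path -` S \<inter> space N = B.sample_path -` D \<inter> space N"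
      using D(2) W.sample_path_continuous B.sample_path_continuous by auto
    moreover have "distr M ?P W.sample_path D = distr N ?P B.sample_path D" by (simp add: eq)
    ultimately show "distr M path_sigma W.sample_path S = distr N path_sigma B.sample_path S"
      using S D(1) W.sample_path_PiM B.sample_path_PiM by (simp add: emeasure_distr)
  qed simp
qed

section \<open>Optional stopping\<close>

text \<open>Fatou bounds the second moment of the limit. Truncation at \<open>R\<close> changes the means by at most \<open>B / R\<close>,
  uniformly in \<open>m\<close>, and the truncated means converge by dominated convergence.\<close>

lemma (in prob_space) L2_bounded_limit:
  fixes S :: "nat \<Rightarrow> 'a \<Rightarrow> real"
  assumes S [measurable]: "\<And>m. S m \<in> borel_measurable M" and lim: "\<And>\<omega>. \<omega> \<in> space M \<Longrightarrow> (\<lambda>m. S m \<omega>) \<longlonglongrightarrow> Z \<omega>"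
    and sq: "\<And>m. integrable M (\<lambda>\<omega>. (S m \<omega>)\<^sup>2)" "\<And>m. expectation (\<lambda>\<omega>. (S m \<omega>)\<^sup>2) \<le> B"
    and mean: "\<And>m. expectation (S m) = 0"
  shows "integrable M Z" "integrable M (\<lambda>\<omega>. (Z \<omega>)\<^sup>2)" "expectation (\<lambda>\<omega>. (Z \<omega>)\<^sup>2) \<le> B" "expectation Z = 0"
proof -
  have Z [measurable]: "Z \<in> borel_measurable M" by (rule borel_measurable_LIMSEQ_real[OF lim S])
  have B0: "0 \<le> B" using sq(2)[of 0] by (rule order_trans[rotated]) simp
  have "(\<integral>\<^sup>+\<omega>. ennreal ((Z \<omega>)\<^sup>2) \<partial>M) = (\<integral>\<^sup>+\<omega>. liminf (\<lambda>m. ennreal ((S m \<omega>)\<^sup>2)) \<partial>M)"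
  proof (rule nn_integral_cong)
    fix \<omega> assume "\<omega> \<in> space M"
    then have "(\<lambda>m. ennreal ((S m \<omega>)\<^sup>2)) \<longlonglongrightarrow> ennreal ((Z \<omega>)\<^sup>2)"
      by (intro tendsto_ennrealI tendsto_power lim)
    then show "ennreal ((Z \<omega>)\<^sup>2) = liminf (\<lambda>m. ennreal ((S m \<omega>)\<^sup>2))"
      by (intro lim_imp_Liminf[symmetric]) auto
  qed
  also have "\<dots> \<le> liminf (\<lambda>m. \<integral>\<^sup>+\<omega>. ennreal ((S m \<omega>)\<^sup>2) \<partial>M)"
    by (rule nn_integral_liminf) measurable
  also have "\<dots> \<le> liminf (\<lambda>m. ennreal B)"
    by (intro Liminf_mono always_eventually allI) (simp add: nn_integral_eq_integral sq ennreal_leI)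
  finally have fin: "(\<integral>\<^sup>+\<omega>. ennreal ((Z \<omega>)\<^sup>2) \<partial>M) \<le> ennreal B" by (simp add: Liminf_const)
  show Z2: "integrable M (\<lambda>\<omega>. (Z \<omega>)\<^sup>2)"
    by (rule integrableI_nonneg) (use fin in \<open>auto intro: le_less_trans\<close>)
  show ZB: "expectation (\<lambda>\<omega>. (Z \<omega>)\<^sup>2) \<le> B"
    using fin B0 by (simp add: nn_integral_eq_integral Z2)
  show Z1: "integrable M Z" by (rule square_integrable_imp_integrable[OF Z Z2])
  have S1: "integrable M (S m)" for m by (rule square_integrable_imp_integrable[OF S sq(1)])
  let ?t = "\<lambda>R x :: real. max (- R) (min R x)"
  have tail: "\<bar>expectation (\<lambda>\<omega>. ?t R (V \<omega>)) - expectation V\<bar> \<le> B / R"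
    if R: "0 < R" and V: "integrable M V" "integrable M (\<lambda>\<omega>. (V \<omega>)\<^sup>2)" "expectation (\<lambda>\<omega>. (V \<omega>)\<^sup>2) \<le> B" for R V
  proof -
    have [measurable]: "V \<in> borel_measurable M" using V(1) by simp
    have t: "integrable M (\<lambda>\<omega>. ?t R (V \<omega>))"
      by (rule integrable_const_bound[where B = R]) (use R in auto)
    have pt: "\<bar>?t R x - x\<bar> \<le> x\<^sup>2 / R" for x
    proof (cases "\<bar>x\<bar> \<le> R")
      case True
      then show ?thesis using R by (auto simp: max_def min_def)
    next
      case False
      then have "\<bar>?t R x - x\<bar> \<le> \<bar>x\<bar> * 1" using R by (auto simp: max_def min_def)
      also have "\<bar>x\<bar> * 1 \<le> \<bar>x\<bar> * (\<bar>x\<bar> / R)" using False R by (intro mult_left_mono) auto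
      finally have "\<bar>?t R x - x\<bar> \<le> \<bar>x\<bar> * (\<bar>x\<bar> / R)" by simp
      also have "\<dots> = x\<^sup>2 / R" by (simp add: power2_eq_square)
      finally show ?thesis .
    qed
    have "\<bar>expectation (\<lambda>\<omega>. ?t R (V \<omega>)) - expectation V\<bar> = \<bar>expectation (\<lambda>\<omega>. ?t R (V \<omega>) - V \<omega>)\<bar>"
      using t V by simp
    also have "\<dots> \<le> expectation (\<lambda>\<omega>. \<bar>?t R (V \<omega>) - V \<omega>\<bar>)" by (rule integral_abs_bound)
    also have "\<dots> \<le> expectation (\<lambda>\<omega>. (V \<omega>)\<^sup>2 / R)"
      using t V pt by (intro integral_mono) auto
    also have "\<dots> \<le> B / R" using V R by (simp add: divide_right_mono)
    finally show ?thesis .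
  qed
  have bound: "\<bar>expectation Z\<bar> \<le> 2 * B / R" if R: "0 < R" for R
  proof -
    have "(\<lambda>m. expectation (\<lambda>\<omega>. ?t R (S m \<omega>))) \<longlonglongrightarrow> expectation (\<lambda>\<omega>. ?t R (Z \<omega>))"
    proof (rule integral_dominated_convergence[where w = "\<lambda>_. R"])
      show "AE \<omega> in M. (\<lambda>m. ?t R (S m \<omega>)) \<longlonglongrightarrow> ?t R (Z \<omega>)"
        by (intro AE_I2 tendsto_max tendsto_min tendsto_const lim)
    qed (use R in \<open>auto simp: abs_le_iff\<close>)
    moreover have "\<bar>expectation (\<lambda>\<omega>. ?t R (S m \<omega>))\<bar> \<le> B / R" for m
      using tail[OF R S1 sq(1) sq(2), of m] mean[of m] by simp
    ultimately have "\<bar>expectation (\<lambda>\<omega>. ?t R (Z \<omega>))\<bar> \<le> B / R"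
      by (intro tendsto_upperbound[OF tendsto_rabs]) auto
    then show ?thesis using tail[OF R Z1 Z2 ZB] by simp
  qed
  show "expectation Z = 0"
  proof (rule ccontr)
    assume ne: "expectation Z \<noteq> 0"
    define R where "R = (2 * B + 1) / \<bar>expectation Z\<bar>"
    have R: "0 < R" using ne B0 by (simp add: R_def)
    have "\<bar>expectation Z\<bar> * R \<le> 2 * B" using bound[OF R] R by (simp add: field_simps)
    then show False using ne by (simp add: R_def)
  qed
qed

context brownian
begin

lemma increment_moments:
  assumes "0 \<le> s" "s < t"
  shows "integrable M (\<lambda>\<omega>. W t \<omega> - W s \<omega>)" "expectation (\<lambda>\<omega>. W t \<omega> - W s \<omega>) = 0"
    "integrable M (\<lambda>\<omega>. (W t \<omega> - W s \<omega>)\<^sup>2)" "expectation (\<lambda>\<omega>. (W t \<omega> - W s \<omega>)\<^sup>2) = t - s"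
proof -
  note D = increment_distributed[OF assms]
  have pos: "0 < sqrt (t - s)" using assms by simp
  show "integrable M (\<lambda>\<omega>. W t \<omega> - W s \<omega>)"
    using distributed_integrable_var[OF D] integrable_normal_moment_nz_1[OF pos] by simp
  show mean: "expectation (\<lambda>\<omega>. W t \<omega> - W s \<omega>) = 0"
    by (rule normal_distributed_expectation[OF pos D])
  have "integrable lborel (\<lambda>x. normal_density 0 (sqrt (t - s)) x * (x - 0)\<^sup>2)"
    by (rule integrable_normal_moment[OF pos])
  then show "integrable M (\<lambda>\<omega>. (W t \<omega> - W s \<omega>)\<^sup>2)"
    using distributed_integrable[OF D, of "\<lambda>x. x\<^sup>2"] by simp
  show "expectation (\<lambda>\<omega>. (W t \<omega> - W s \<omega>)\<^sup>2) = t - s"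
    using normal_distributed_variance[OF pos D] assms by (simp add: mean)
qed

lemma indep_product:
  assumes "0 \<le> s" "s < t" "Y \<in> borel_measurable (F s)" "integrable M Y"
    "\<phi> \<in> borel_measurable borel" "integrable M (\<lambda>\<omega>. \<phi> (W t \<omega> - W s \<omega>))"
  shows "integrable M (\<lambda>\<omega>. Y \<omega> * \<phi> (W t \<omega> - W s \<omega>))"
    "expectation (\<lambda>\<omega>. Y \<omega> * \<phi> (W t \<omega> - W s \<omega>)) = expectation Y * expectation (\<lambda>\<omega>. \<phi> (W t \<omega> - W s \<omega>) :: real)"
  using indep_var_integrable[OF increment_indep[OF assms(1,2,3,5)] assms(4,6)]
    indep_var_lebesgue_integral[OF increment_indep[OF assms(1,2,3,5)] assms(4,6)] by auto

text \<open>The event \<open>P r\<close> says that the stopping time exceeds \<open>r\<close>, so this is Brownian motion stopped at the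
  first grid point that is not before it.\<close>

definition grid_sum :: "(real \<Rightarrow> 'a set) \<Rightarrow> (nat \<Rightarrow> real) \<Rightarrow> nat \<Rightarrow> 'a \<Rightarrow> real" where
  "grid_sum P g m \<omega> = (\<Sum>i<m. indicator (P (g i)) \<omega> * (W (g (Suc i)) \<omega> - W (g i) \<omega>))"

text \<open>Each increment is independent of the sum that precedes it, so the cross terms vanish. The second
  moment is kept proportional to the probability of still running at the start.\<close>

lemma grid_sum_moments:
  assumes g: "0 \<le> g 0" "\<And>i. g i < g (Suc i)" and P: "\<And>i. P (g i) \<in> sets (F (g i))" "\<And>i. P (g i) \<subseteq> P (g 0)"
  shows "grid_sum P g m \<in> borel_measurable (F (g m))" "integrable M (grid_sum P g m)" "expectation (grid_sum P g m) = 0"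
    "integrable M (\<lambda>\<omega>. (grid_sum P g m \<omega>)\<^sup>2)"
    "expectation (\<lambda>\<omega>. (grid_sum P g m \<omega>)\<^sup>2) \<le> (g m - g 0) * prob (P (g 0))"
proof -
  have "grid_sum P g m \<in> borel_measurable (F (g m)) \<and> integrable M (grid_sum P g m) \<and> expectation (grid_sum P g m) = 0 \<and>
    integrable M (\<lambda>\<omega>. (grid_sum P g m \<omega>)\<^sup>2) \<and>
    expectation (\<lambda>\<omega>. (grid_sum P g m \<omega>)\<^sup>2) \<le> (g m - g 0) * prob (P (g 0))"
  proof (induction m)
    case 0
    have "grid_sum P g 0 = (\<lambda>\<omega>. 0)" by (simp add: grid_sum_def fun_eq_iff)
    then show ?case by simp
  next
    case (Suc m)
    have gm: "0 \<le> g m" using lift_Suc_mono_le[of g 0 m] g less_imp_le by (meson order_trans le0)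
    have lt: "g m < g (Suc m)" by (rule g)
    let ?S = "grid_sum P g m" and ?I = "indicator (P (g m)) :: 'a \<Rightarrow> real"
    let ?D = "\<lambda>\<omega>. W (g (Suc m)) \<omega> - W (g m) \<omega>"
    note [measurable] = P(1)
    note D = increment_moments[OF gm lt]
    have step: "grid_sum P g (Suc m) = (\<lambda>\<omega>. ?S \<omega> + ?I \<omega> * ?D \<omega>)" by (simp add: grid_sum_def fun_eq_iff)
    have S [measurable]: "?S \<in> borel_measurable (F (g m))" using Suc by simp
    have I [measurable]: "?I \<in> borel_measurable (F (g m))" by measurable
    have Pm: "P (g m) \<in> events" using P(1)[of m] subalg[of "g m"] by (auto simp: subalgebra_def)
    have iI: "integrable M ?I" by (rule integrable_real_indicator[OF Pm]) (simp add: emeasure_eq_measure)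
    have SI [measurable]: "(\<lambda>\<omega>. ?S \<omega> * ?I \<omega>) \<in> borel_measurable (F (g m))" by measurable
    have iSI: "integrable M (\<lambda>\<omega>. ?S \<omega> * ?I \<omega>)"
      by (rule integrable_real_mult_indicator[OF Pm]) (use Suc in simp)
    have 1: "integrable M (\<lambda>\<omega>. ?I \<omega> * ?D \<omega>)" "expectation (\<lambda>\<omega>. ?I \<omega> * ?D \<omega>) = 0"
      using indep_product[OF gm lt I iI, of "\<lambda>x. x"] D by auto
    have 2: "integrable M (\<lambda>\<omega>. ?I \<omega> * (?D \<omega>)\<^sup>2)"
      "expectation (\<lambda>\<omega>. ?I \<omega> * (?D \<omega>)\<^sup>2) = prob (P (g m)) * (g (Suc m) - g m)"
      using indep_product[OF gm lt I iI, of "\<lambda>x. x\<^sup>2"] D sets.sets_into_space[OF Pm] by (auto simp: Int_absorb2)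
    have 3: "integrable M (\<lambda>\<omega>. ?S \<omega> * ?I \<omega> * ?D \<omega>)" "expectation (\<lambda>\<omega>. ?S \<omega> * ?I \<omega> * ?D \<omega>) = 0"
      using indep_product[OF gm lt SI iSI, of "\<lambda>x. x"] D by auto
    have sq: "(\<lambda>\<omega>. (?S \<omega> + ?I \<omega> * ?D \<omega>)\<^sup>2) = (\<lambda>\<omega>. (?S \<omega>)\<^sup>2 + (2 * (?S \<omega> * ?I \<omega> * ?D \<omega>) + ?I \<omega> * (?D \<omega>)\<^sup>2))"
      by (rule ext) (auto simp: indicator_def power2_eq_square algebra_simps)
    have "prob (P (g m)) \<le> prob (P (g 0))"
      using P(1)[of 0] P(2) subalg[of "g 0"] by (intro finite_measure_mono) (auto simp: subalgebra_def)
    then have "(g (Suc m) - g m) * prob (P (g m)) \<le> (g (Suc m) - g m) * prob (P (g 0))"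
      using lt by (intro mult_left_mono) auto
    moreover have "expectation (\<lambda>\<omega>. (?S \<omega>)\<^sup>2 + (2 * (?S \<omega> * ?I \<omega> * ?D \<omega>) + ?I \<omega> * (?D \<omega>)\<^sup>2)) =
      expectation (\<lambda>\<omega>. (?S \<omega>)\<^sup>2) + prob (P (g m)) * (g (Suc m) - g m)"
      using Suc 2 3 by simp
    ultimately have "expectation (\<lambda>\<omega>. (?S \<omega> + ?I \<omega> * ?D \<omega>)\<^sup>2) \<le> (g (Suc m) - g 0) * prob (P (g 0))"
      unfolding sq using Suc by (simp add: algebra_simps)
    moreover have "integrable M (\<lambda>\<omega>. (?S \<omega> + ?I \<omega> * ?D \<omega>)\<^sup>2)"
      unfolding sq using Suc 2 3 by (intro Bochner_Integration.integrable_add integrable_mult_right) auto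
    moreover have "(\<lambda>\<omega>. ?S \<omega> + ?I \<omega> * ?D \<omega>) \<in> borel_measurable (F (g (Suc m)))"
    proof -
      note F' = F_mono[of "g m" "g (Suc m)"]
      have [measurable]: "?S \<in> borel_measurable (F (g (Suc m)))" "?I \<in> borel_measurable (F (g (Suc m)))"
        "W (g m) \<in> borel_measurable (F (g (Suc m)))" "W (g (Suc m)) \<in> borel_measurable (F (g (Suc m)))"
        using measurable_from_subalg[OF F' S] measurable_from_subalg[OF F' I] adapted_later gm lt by auto
      show ?thesis by measurable
    qed
    ultimately show ?case unfolding step using Suc 1 by auto
  qed
  then show "grid_sum P g m \<in> borel_measurable (F (g m))" "integrable M (grid_sum P g m)" "expectation (grid_sum P g m) = 0"
    "integrable M (\<lambda>\<omega>. (grid_sum P g m \<omega>)\<^sup>2)"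
    "expectation (\<lambda>\<omega>. (grid_sum P g m \<omega>)\<^sup>2) \<le> (g m - g 0) * prob (P (g 0))" by auto
qed

lemma grid_sum_telescope:
  fixes \<sigma> :: "'a \<Rightarrow> real"
  assumes g: "\<And>i. g i < g (Suc i)" and P: "\<And>r. \<omega> \<in> P r \<longleftrightarrow> r < \<sigma> \<omega>"
  shows "\<exists>k\<le>m. grid_sum P g m \<omega> = W (g k) \<omega> - W (g 0) \<omega> \<and>
    (k = 0 \<or> g (k - 1) < \<sigma> \<omega>) \<and> (k < m \<longrightarrow> \<sigma> \<omega> \<le> g k)"
proof (induction m)
  case 0
  then show ?case by (simp add: grid_sum_def)
next
  case (Suc m)
  then obtain k where k: "k \<le> m" "grid_sum P g m \<omega> = W (g k) \<omega> - W (g 0) \<omega>"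
    "k = 0 \<or> g (k - 1) < \<sigma> \<omega>" "k < m \<longrightarrow> \<sigma> \<omega> \<le> g k" by blast
  have step: "grid_sum P g (Suc m) \<omega> = grid_sum P g m \<omega> + indicator (P (g m)) \<omega> * (W (g (Suc m)) \<omega> - W (g m) \<omega>)"
    by (simp add: grid_sum_def)
  show ?case
  proof (cases "g m < \<sigma> \<omega>")
    case True
    have "k = m"
    proof (rule ccontr)
      assume "k \<noteq> m"
      then have "\<sigma> \<omega> \<le> g k" "g k \<le> g m" using k lift_Suc_mono_le[of g k m] g by (auto simp: less_imp_le)
      then show False using True by simp
    qed
    moreover have "indicator (P (g m)) \<omega> = (1 :: real)" using P True by simp
    ultimately show ?thesis using True k step by (intro exI[of _ "Suc m"]) simp
  next
    case False
    then have "indicator (P (g m)) \<omega> = (0 :: real)" using P by simp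
    moreover have "\<sigma> \<omega> \<le> g k" using k(1,4) False by (cases "k = m") auto
    ultimately show ?thesis using k step by (intro exI[of _ k]) simp
  qed
qed

text \<open>The stopping time is approximated from above by the points of a grid, and the grid sums converge by
  continuity of the paths. The bound on the second moment retains the factor
  \<open>prob {\<omega> \<in> space M. s < \<sigma> \<omega>}\<close>, which later makes dyadic increments summable.\<close>

lemma optional_stopping:
  fixes \<sigma> :: "'a \<Rightarrow> real"
  assumes st: "0 \<le> s" "s \<le> t" and stop: "\<And>r. 0 \<le> r \<Longrightarrow> {\<omega> \<in> space M. r < \<sigma> \<omega>} \<in> sets (F r)"
  defines "Z \<equiv> \<lambda>\<omega>. W (max s (min t (\<sigma> \<omega>))) \<omega> - W s \<omega>"
  shows "integrable M Z" "integrable M (\<lambda>\<omega>. (Z \<omega>)\<^sup>2)"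
    "expectation (\<lambda>\<omega>. (Z \<omega>)\<^sup>2) \<le> (t - s) * prob {\<omega> \<in> space M. s < \<sigma> \<omega>}" "expectation Z = 0"
proof -
  have "integrable M Z \<and> integrable M (\<lambda>\<omega>. (Z \<omega>)\<^sup>2) \<and>
    expectation (\<lambda>\<omega>. (Z \<omega>)\<^sup>2) \<le> (t - s) * prob {\<omega> \<in> space M. s < \<sigma> \<omega>} \<and> expectation Z = 0"
  proof (cases "s = t")
    case True
    then have "Z = (\<lambda>_. 0)" by (auto simp: Z_def fun_eq_iff max_def min_def)
    then show ?thesis using True by simp
  next
    case False
    then have lt: "s < t" using st by simp
    define g where "g m i = s + (t - s) * real i / real (Suc m)" for m i
    define P where "P r = {\<omega> \<in> space M. r < \<sigma> \<omega>}" for r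
    have g0: "g m 0 = s" and gm: "g m (Suc m) = t" for m by (simp_all add: g_def)
    have ginc: "g m i < g m (Suc i)" for m i using lt by (simp add: g_def divide_strict_right_mono)
    have gle: "s \<le> g m i" for m i using lt by (simp add: g_def)
    have mesh: "g m (Suc i) = g m i + (t - s) / real (Suc m)" for m i
      by (simp only: g_def of_nat_Suc distrib_left add_divide_distrib mult_1_right)
    have P1: "P (g m i) \<in> sets (F (g m i))" for m i unfolding P_def using stop gle st by (meson order_trans)
    have P2: "P (g m i) \<subseteq> P (g m 0)" for m i using gle[of m i] by (auto simp: P_def g0)
    define S where "S m = grid_sum P (g m) (Suc m)" for m
    have S: "S m \<in> borel_measurable M" "integrable M (\<lambda>\<omega>. (S m \<omega>)\<^sup>2)" "expectation (S m) = 0"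
      "expectation (\<lambda>\<omega>. (S m \<omega>)\<^sup>2) \<le> (t - s) * prob {\<omega> \<in> space M. s < \<sigma> \<omega>}" for m
      using grid_sum_moments[of "g m" P "Suc m"] ginc P1 P2 st measurable_from_subalg[OF subalg]
      unfolding S_def g0 gm by (auto simp: P_def)
    have lim: "(\<lambda>m. S m \<omega>) \<longlonglongrightarrow> Z \<omega>" if \<omega>: "\<omega> \<in> space M" for \<omega>
    proof -
      let ?c = "max s (min t (\<sigma> \<omega>))"
      have "\<exists>r. s \<le> r \<and> \<bar>r - ?c\<bar> \<le> (t - s) / real (Suc m) \<and> S m \<omega> = W r \<omega> - W s \<omega>" for m
      proof -
        obtain k where k: "k \<le> Suc m" "S m \<omega> = W (g m k) \<omega> - W s \<omega>"
          "k = 0 \<or> g m (k - 1) < \<sigma> \<omega>" "k < Suc m \<longrightarrow> \<sigma> \<omega> \<le> g m k"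
          using grid_sum_telescope[of "g m" \<omega> P \<sigma> "Suc m"] ginc \<omega> by (auto simp: S_def g0 P_def)
        have kt: "g m k \<le> t" using lift_Suc_mono_le[of "g m" k "Suc m"] ginc k(1) by (simp add: gm less_imp_le)
        have pos: "0 \<le> (t - s) / real (Suc m)" using lt by simp
        have "\<bar>g m k - ?c\<bar> \<le> (t - s) / real (Suc m)"
        proof (cases k)
          case 0
          then show ?thesis using k(4) lt pos by (auto simp: g0)
        next
          case (Suc j)
          then have 1: "g m j < \<sigma> \<omega>" "g m k = g m j + (t - s) / real (Suc m)" using k(3) mesh[of m j] by auto
          have 2: "s \<le> g m j" by (rule gle)
          have 3: "k < Suc m \<and> \<sigma> \<omega> \<le> g m k \<or> g m k = t" using k(1,4) gm by (auto simp: le_less)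
          have "\<bar>u - max s (min t v)\<bar> \<le> d"
            if "a < v" "u = a + d" "s \<le> a" "v \<le> u \<or> u = t" "u \<le> t" "0 \<le> d" for u v a d
            using that by (cases "v \<le> t") (auto simp: max_def min_def abs_if)
          then show ?thesis using 1 2 3 kt pos by blast
        qed
        then show ?thesis using k(2) gle by blast
      qed
      then obtain r where r: "\<And>m. s \<le> r m" "\<And>m. \<bar>r m - ?c\<bar> \<le> (t - s) / real (Suc m)" "\<And>m. S m \<omega> = W (r m) \<omega> - W s \<omega>"
        by metis
      have "(\<lambda>m. (t - s) * inverse (real (Suc m))) \<longlonglongrightarrow> (t - s) * 0"
        by (intro tendsto_mult tendsto_const LIMSEQ_inverse_real_of_nat)
      then have null: "(\<lambda>m. (t - s) / real (Suc m)) \<longlonglongrightarrow> 0"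
        by (simp only: divide_inverse mult_zero_right)
      have "(\<lambda>m. r m - ?c) \<longlonglongrightarrow> 0"
        by (rule Lim_null_comparison[OF _ null], rule always_eventually) (unfold real_norm_def, blast intro: r(2))
      then have "r \<longlonglongrightarrow> ?c" by (rule LIM_zero_cancel)
      then have "(\<lambda>m. W (r m) \<omega>) \<longlonglongrightarrow> W ?c \<omega>"
        by (rule continuous_on_tendsto_compose[OF W_cont[OF \<omega>]])
          (use st r(1) in \<open>auto intro: order_trans always_eventually\<close>)
      then show ?thesis unfolding r(3) Z_def by (intro tendsto_diff tendsto_const)
    qed
    show ?thesis
      using L2_bounded_limit[OF S(1) lim S(2) S(4) S(3)] by simp
  qed
  then show "integrable M Z" "integrable M (\<lambda>\<omega>. (Z \<omega>)\<^sup>2)"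
    "expectation (\<lambda>\<omega>. (Z \<omega>)\<^sup>2) \<le> (t - s) * prob {\<omega> \<in> space M. s < \<sigma> \<omega>}" "expectation Z = 0" by auto
qed

end

section \<open>The mean of a first passage time\<close>

text \<open>A Brownian motion run by a deterministic clock \<open>f\<close> of at most quadratic growth, with a drift.\<close>

locale drifted_clock = brownian +
  fixes f :: "real \<Rightarrow> real" and lam nu C :: real
  assumes f_cont: "continuous_on {0..} f" and f_mono: "mono_on {0..} f" and f_0: "f 0 = 0"
    and f_growth: "\<And>x. 0 \<le> x \<Longrightarrow> f x \<le> C * (1 + x\<^sup>2)" and lam: "0 \<le> lam" and nu: "0 \<le> nu"
begin

definition level :: "'a \<Rightarrow> real \<Rightarrow> real" where
  "level \<omega> u = (1 + lam) * u - nu * W (f u) \<omega>"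

lemma f_le: "0 \<le> x \<Longrightarrow> x \<le> y \<Longrightarrow> f x \<le> f y"
  using mono_onD[OF f_mono] by auto

lemma f_nonneg: "0 \<le> x \<Longrightarrow> 0 \<le> f x"
  using f_le[of 0 x] f_0 by simp

lemma C_nonneg: "0 \<le> C"
  using f_growth[of 0] f_0 by simp

lemma level_cont: "\<omega> \<in> space M \<Longrightarrow> continuous_on {0..} (level \<omega>)"
  unfolding level_def
  by (intro continuous_intros continuous_on_compose2[OF W_cont f_cont]) (auto intro: f_nonneg)

lemma level_adapted: "0 \<le> u \<Longrightarrow> f u \<le> r \<Longrightarrow> (\<lambda>\<omega>. level \<omega> u) \<in> borel_measurable (F r)"
  unfolding level_def using adapted_later[OF f_nonneg] by (intro borel_measurable_diff borel_measurable_times) auto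

lemma level_measurable: "0 \<le> u \<Longrightarrow> (\<lambda>\<omega>. level \<omega> u) \<in> borel_measurable M"
  by (rule measurable_from_subalg[OF subalg level_adapted[of u "f u"]]) auto

lemma level_0: "AE \<omega> in M. level \<omega> 0 = 0"
  using W_0 by eventually_elim (simp add: level_def f_0)

text \<open>On a compact set, to be below \<open>c\<close> is to be at most \<open>c - 1/(k+1)\<close> on a countable dense subset, for
  some \<open>k\<close>.\<close>

lemma below_on_compact:
  assumes D: "compact D" "D \<subseteq> {0..}" and G: "space G = space M" "\<And>u. u \<in> D \<Longrightarrow> (\<lambda>\<omega>. level \<omega> u) \<in> borel_measurable G"
  shows "{\<omega> \<in> space M. \<forall>u\<in>D. level \<omega> u < c} \<in> sets G"
proof -
  obtain Q where Q: "countable Q" "Q \<subseteq> D" "D \<subseteq> closure Q" using separable[of D] by metis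
  have "(\<forall>u\<in>D. level \<omega> u < c) \<longleftrightarrow> (\<exists>k::nat. \<forall>u\<in>Q. level \<omega> u \<le> c - inverse (real (Suc k)))" if \<omega>: "\<omega> \<in> space M" for \<omega>
  proof
    assume less: "\<forall>u\<in>D. level \<omega> u < c"
    show "\<exists>k::nat. \<forall>u\<in>Q. level \<omega> u \<le> c - inverse (real (Suc k))"
    proof (cases "D = {}")
      case True
      then show ?thesis using Q by auto
    next
      case False
      have "continuous_on D (level \<omega>)" using level_cont[OF \<omega>] D(2) by (rule continuous_on_subset)
      then obtain v where v: "v \<in> D" "\<forall>u\<in>D. level \<omega> u \<le> level \<omega> v"
        using continuous_attains_sup[OF D(1) False] by blast
      then have "0 < c - level \<omega> v" using less by simp
      then obtain k where "inverse (real (Suc k)) < c - level \<omega> v" using reals_Archimedean by blast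
      then show ?thesis using v Q(2) by (intro exI[of _ k]) force
    qed
  next
    assume "\<exists>k::nat. \<forall>u\<in>Q. level \<omega> u \<le> c - inverse (real (Suc k))"
    then obtain k :: nat where k: "\<forall>u\<in>Q. level \<omega> u \<le> c - inverse (real (Suc k))" by blast
    have "closure Q \<subseteq> D" using Q(2) D(1) by (simp add: closure_minimal compact_imp_closed)
    then have "continuous_on (closure Q) (level \<omega>)"
      using level_cont[OF \<omega>] D(2) by (auto elim!: continuous_on_subset)
    then have "level \<omega> u \<le> c - inverse (real (Suc k))" if "u \<in> D" for u
      using continuous_le_on_closure k that Q(3) by blast
    then show "\<forall>u\<in>D. level \<omega> u < c"
      by (smt (verit, best) inverse_positive_iff_positive of_nat_0_less_iff zero_less_Suc)
  qed
  then have "{\<omega> \<in> space M. \<forall>u\<in>D. level \<omega> u < c} = {\<omega> \<in> space G. \<exists>k::nat. \<forall>u\<in>Q. level \<omega> u \<le> c - inverse (real (Suc k))}"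
    using G(1) by auto
  also have "\<dots> \<in> sets G"
  proof (intro sets.sets_Collect_countable_Ex sets.sets_Collect_countable_All' Q(1))
    fix k :: nat and u assume "u \<in> Q"
    then have [measurable]: "(\<lambda>\<omega>. level \<omega> u) \<in> borel_measurable G" using G Q(2) by blast
    show "{\<omega> \<in> space G. level \<omega> u \<le> c - inverse (real (Suc k))} \<in> sets G" by measurable
  qed
  finally show ?thesis .
qed

text \<open>The hitting time of the level \<open>c\<close>, cut off at \<open>A\<close>.\<close>

definition hit :: "real \<Rightarrow> real \<Rightarrow> 'a \<Rightarrow> real" where
  "hit c A \<omega> = Inf ({u. 0 \<le> u \<and> u \<le> A \<and> c \<le> level \<omega> u} \<union> {A})"

lemma hit_le:
  assumes "0 \<le> A" "0 \<le> u" "u \<le> A" "c \<le> level \<omega> u" shows "hit c A \<omega> \<le> u"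
  unfolding hit_def by (rule cInf_lower) (use assms in \<open>auto intro!: bdd_belowI[of _ 0]\<close>)

lemma hit_le_bound: "0 \<le> A \<Longrightarrow> hit c A \<omega> \<le> A"
  unfolding hit_def by (rule cInf_lower) (auto intro!: bdd_belowI[of _ 0])

lemma hit_ge:
  assumes "v \<le> A" "\<And>u. 0 \<le> u \<Longrightarrow> u \<le> A \<Longrightarrow> c \<le> level \<omega> u \<Longrightarrow> v \<le> u"
  shows "v \<le> hit c A \<omega>"
  unfolding hit_def by (rule cInf_greatest) (use assms in auto)

lemma hit_nonneg: "0 \<le> A \<Longrightarrow> 0 \<le> hit c A \<omega>"
  by (rule hit_ge) auto

lemma below_before_hit: "0 \<le> A \<Longrightarrow> 0 \<le> u \<Longrightarrow> u < hit c A \<omega> \<Longrightarrow> level \<omega> u < c"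
  using hit_le[of A u c \<omega>] hit_le_bound[of A c \<omega>] by force

lemma level_at_hit:
  assumes "\<omega> \<in> space M" "0 \<le> A" "hit c A \<omega> < A"
  shows "c \<le> level \<omega> (hit c A \<omega>)"
proof -
  let ?S = "{u. 0 \<le> u \<and> u \<le> A \<and> c \<le> level \<omega> u}"
  have "?S = {0..A} \<inter> level \<omega> -` {c..}" by auto
  moreover have "closed ({0..A} \<inter> level \<omega> -` {c..})"
    by (rule continuous_closed_preimage[OF continuous_on_subset[OF level_cont[OF assms(1)]]]) auto
  ultimately have cl: "closed (?S \<union> {A})" by (simp add: closed_Un)
  have "Inf (?S \<union> {A}) \<in> ?S \<union> {A}"
    by (rule closed_contains_Inf[OF _ _ cl]) (use assms in \<open>auto intro!: bdd_belowI[of _ 0]\<close>)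
  then show ?thesis using assms(3) unfolding hit_def by auto
qed

lemma level_at_hit_le:
  assumes "\<omega> \<in> space M" "0 \<le> A" "level \<omega> 0 \<le> c"
  shows "level \<omega> (hit c A \<omega>) \<le> c"
proof (cases "hit c A \<omega> = 0")
  case False
  let ?h = "hit c A \<omega>"
  have h: "0 < ?h" using False hit_nonneg[OF assms(2), of c \<omega>] by simp
  have "continuous_on {0..?h} (level \<omega>)"
    by (rule continuous_on_subset[OF level_cont[OF assms(1)]]) auto
  then have "(level \<omega> \<longlongrightarrow> level \<omega> ?h) (at ?h within {0..?h})" using h by (simp add: continuous_on)
  then have "(level \<omega> \<longlongrightarrow> level \<omega> ?h) (at_left ?h)" using at_within_Icc_at_left[OF h] by simp
  moreover have "\<forall>\<^sub>F u in at_left ?h. level \<omega> u \<le> c"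
    using eventually_at_left_real[OF h] by eventually_elim (use below_before_hit[OF assms(2)] in \<open>auto intro: less_imp_le\<close>)
  ultimately show ?thesis by (rule tendsto_upperbound) (simp add: trivial_limit_at_left_real)
qed (use assms in simp)

lemma hit_min:
  assumes "0 \<le> A" "A \<le> A'"
  shows "hit c A \<omega> = min A (hit c A' \<omega>)"
proof (rule antisym)
  show "hit c A \<omega> \<le> min A (hit c A' \<omega>)"
  proof (rule min.boundedI)
    show "hit c A \<omega> \<le> A" using assms by (intro hit_le_bound)
    show "hit c A \<omega> \<le> hit c A' \<omega>"
    proof (rule hit_ge)
      show "hit c A \<omega> \<le> A'" using hit_le_bound[of A c \<omega>] assms by simp
      fix u assume "0 \<le> u" "u \<le> A'" "c \<le> level \<omega> u"
      then show "hit c A \<omega> \<le> u" using hit_le[of A u c \<omega>] hit_le_bound[of A c \<omega>] assms by (cases "u \<le> A") auto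
    qed
  qed
  show "min A (hit c A' \<omega>) \<le> hit c A \<omega>"
    by (rule hit_ge) (use hit_le[of A' _ c \<omega>] assms in \<open>auto simp: min_le_iff_disj\<close>)
qed

text \<open>The clock at the hitting time exceeds \<open>r\<close> if and only if the level is not reached during
  \<open>{u. f u \<le> r}\<close>, and there the path only involves the Brownian motion up to time \<open>r\<close>. Intervals on
  which the clock rests belong to this set as a whole.\<close>

lemma hit_stopping:
  assumes "0 \<le> A" "0 \<le> r"
  shows "{\<omega> \<in> space M. r < f (hit c A \<omega>)} \<in> sets (F r)"
proof -
  have eq: "r < f (hit c A \<omega>) \<longleftrightarrow> (\<forall>u\<ge>0. f u \<le> r \<longrightarrow> u < A \<and> level \<omega> u < c)" if \<omega>: "\<omega> \<in> space M" for \<omega>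
  proof
    assume less: "r < f (hit c A \<omega>)"
    show "\<forall>u\<ge>0. f u \<le> r \<longrightarrow> u < A \<and> level \<omega> u < c"
    proof (intro allI impI)
      fix u assume u: "0 \<le> u" "f u \<le> r"
      then have "u < hit c A \<omega>" using less f_le[of "hit c A \<omega>" u] hit_nonneg[OF assms(1), of c \<omega>] by force
      then show "u < A \<and> level \<omega> u < c"
        using hit_le_bound[OF assms(1), of c \<omega>] below_before_hit[OF assms(1) u(1)] by auto
    qed
  next
    assume all: "\<forall>u\<ge>0. f u \<le> r \<longrightarrow> u < A \<and> level \<omega> u < c"
    show "r < f (hit c A \<omega>)"
    proof (rule ccontr)
      assume "\<not> r < f (hit c A \<omega>)"
      then have "hit c A \<omega> < A" "level \<omega> (hit c A \<omega>) < c"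
        using all hit_nonneg[OF assms(1), of c \<omega>] by auto
      then show False using level_at_hit[OF \<omega> assms(1)] by force
    qed
  qed
  let ?D = "{u. 0 \<le> u \<and> f u \<le> r}"
  show ?thesis
  proof (cases "\<exists>u\<in>?D. A \<le> u")
    case True
    then have "{\<omega> \<in> space M. r < f (hit c A \<omega>)} = {}" using eq by force
    then show ?thesis by (metis sets.empty_sets)
  next
    case False
    then have D: "?D \<subseteq> {0..A}" by force
    have "?D = {0..A} \<inter> f -` {..r}" using D by auto
    moreover have "closed ({0..A} \<inter> f -` {..r})"
      by (rule continuous_closed_preimage[OF continuous_on_subset[OF f_cont]]) auto
    ultimately have "compact ?D" using D by (metis compact_Icc compact_Int_closed inf.absorb_iff2)
    moreover have "{\<omega> \<in> space M. r < f (hit c A \<omega>)} = {\<omega> \<in> space M. \<forall>u\<in>?D. level \<omega> u < c}"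
      using eq False by force
    ultimately show ?thesis
      using below_on_compact[of ?D "F r" c] level_adapted by (auto simp: space_F)
  qed
qed

lemma hit_measurable:
  assumes "0 \<le> A" shows "hit c A \<in> borel_measurable M"
  unfolding borel_measurable_iff_greater
proof
  fix a
  consider "a < 0" | "0 \<le> a" "a < A" | "A \<le> a" by linarith
  then show "{\<omega> \<in> space M. a < hit c A \<omega>} \<in> sets M"
  proof cases
    case 1
    then have "a < hit c A \<omega>" for \<omega> using hit_nonneg[OF assms, of c \<omega>] by linarith
    then show ?thesis by simp
  next
    case 2
    have "a < hit c A \<omega> \<longleftrightarrow> (\<forall>u\<in>{0..a}. level \<omega> u < c)" if \<omega>: "\<omega> \<in> space M" for \<omega>
    proof
      assume "a < hit c A \<omega>"
      then show "\<forall>u\<in>{0..a}. level \<omega> u < c" using below_before_hit[OF assms] by auto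
    next
      assume all: "\<forall>u\<in>{0..a}. level \<omega> u < c"
      show "a < hit c A \<omega>"
      proof (rule ccontr)
        assume "\<not> a < hit c A \<omega>"
        then show False using all level_at_hit[OF \<omega> assms, of c] hit_nonneg[OF assms, of c \<omega>] 2 by force
      qed
    qed
    then have "{\<omega> \<in> space M. a < hit c A \<omega>} = {\<omega> \<in> space M. \<forall>u\<in>{0..a}. level \<omega> u < c}" by blast
    also have "\<dots> \<in> sets M" by (rule below_on_compact) (auto intro: level_measurable)
    finally show ?thesis .
  next
    case 3
    then have "\<not> a < hit c A \<omega>" for \<omega> using hit_le_bound[OF assms, of c \<omega>] by linarith
    then show ?thesis by simp
  qed
qed

lemma hit_integrable: "0 \<le> A \<Longrightarrow> integrable M (hit c A)"
  by (rule integrable_const_bound[where B = A])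
    (use hit_measurable hit_nonneg hit_le_bound in \<open>auto simp: abs_le_iff intro!: AE_I2 intro: order_trans[of _ 0]\<close>)

lemma stopped_mean:
  assumes "0 \<le> A"
  shows "integrable M (\<lambda>\<omega>. W (f (hit c A \<omega>)) \<omega>)" "expectation (\<lambda>\<omega>. W (f (hit c A \<omega>)) \<omega>) = 0"
proof -
  have clip: "max 0 (min (f A) (f (hit c A \<omega>))) = f (hit c A \<omega>)" for \<omega>
    using f_le[OF hit_nonneg[OF assms] hit_le_bound[OF assms], of c \<omega>] f_nonneg[OF hit_nonneg[OF assms], of c \<omega>] by simp
  have stop: "\<And>r. 0 \<le> r \<Longrightarrow> {\<omega> \<in> space M. r < f (hit c A \<omega>)} \<in> sets (F r)" by (rule hit_stopping[OF assms])
  note os = optional_stopping[OF order_refl f_nonneg[OF assms] stop, unfolded clip]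
  have W0: "integrable M (W 0)" "expectation (W 0) = 0"
    using integrable_cong_AE[of "W 0" M "\<lambda>_. 0"] integral_cong_AE[of "W 0" M "\<lambda>_. 0"] W_0 by auto
  have "integrable M (\<lambda>\<omega>. (W (f (hit c A \<omega>)) \<omega> - W 0 \<omega>) + W 0 \<omega>)"
    by (rule Bochner_Integration.integrable_add[OF os(1) W0(1)])
  then show i: "integrable M (\<lambda>\<omega>. W (f (hit c A \<omega>)) \<omega>)" by simp
  show "expectation (\<lambda>\<omega>. W (f (hit c A \<omega>)) \<omega>) = 0"
    using os(4) i W0 by simp
qed

text \<open>The stopped Brownian motion has mean zero, and the level does not exceed \<open>c\<close> when stopped.\<close>

lemma hit_mean_le:
  assumes "0 \<le> A" "0 \<le> c"
  shows "(1 + lam) * expectation (hit c A) \<le> c"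
proof -
  have "(1 + lam) * expectation (hit c A) = expectation (\<lambda>\<omega>. (1 + lam) * hit c A \<omega> - nu * W (f (hit c A \<omega>)) \<omega>)"
    using hit_integrable[OF assms(1)] stopped_mean[OF assms(1)] by simp
  also have "\<dots> \<le> expectation (\<lambda>\<omega>. c)"
  proof (rule integral_mono_AE)
    have "AE \<omega> in M. \<omega> \<in> space M" by simp
    with level_0 show "AE \<omega> in M. (1 + lam) * hit c A \<omega> - nu * W (f (hit c A \<omega>)) \<omega> \<le> c"
    proof eventually_elim
      case (elim \<omega>)
      have "level \<omega> (hit c A \<omega>) \<le> c" by (rule level_at_hit_le) (use elim assms in auto)
      then show ?case by (simp add: level_def)
    qed
  qed (use hit_integrable[OF assms(1)] stopped_mean[OF assms(1)] in auto)
  finally show ?thesis by (simp add: prob_space)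
qed

lemma hit_finite:
  assumes "0 \<le> c"
  shows "AE \<omega> in M. \<exists>k. hit c (2 ^ k) \<omega> < 2 ^ k"
proof -
  have "(\<lambda>k. c * (1 / 2) ^ k) \<longlonglongrightarrow> c * 0" by (intro tendsto_mult tendsto_const LIMSEQ_realpow_zero) auto
  then have lim: "(\<lambda>k. c * (1 / 2) ^ k) \<longlonglongrightarrow> 0" by simp
  let ?N = "{\<omega> \<in> space M. \<forall>k. 2 ^ k \<le> hit c (2 ^ k) \<omega>}"
  have [measurable]: "hit c (2 ^ k) \<in> borel_measurable M" for k by (rule hit_measurable) simp
  have N: "?N \<in> sets M" by measurable
  have "prob ?N \<le> c * (1 / 2) ^ k" for k
  proof -
    have "expectation (hit c (2 ^ k)) * 1 \<le> expectation (hit c (2 ^ k)) * (1 + lam)"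
      using lam hit_nonneg[of "2 ^ k" c] by (intro mult_left_mono integral_nonneg) auto
    then have "expectation (hit c (2 ^ k)) \<le> c" using hit_mean_le[of "2 ^ k" c] assms by (simp add: mult.commute)
    have "prob ?N \<le> prob {\<omega> \<in> space M. 2 ^ k \<le> hit c (2 ^ k) \<omega>}" by (intro finite_measure_mono) auto
    also have "\<dots> \<le> expectation (hit c (2 ^ k)) / 2 ^ k"
      by (rule integral_Markov_inequality_measure[where A = "{}"]) (use hit_integrable hit_nonneg in auto)
    also have "\<dots> \<le> c / 2 ^ k" using \<open>expectation (hit c (2 ^ k)) \<le> c\<close> by (simp add: divide_right_mono)
    finally show ?thesis by (simp add: power_divide)
  qed
  then have "prob ?N \<le> 0" by (intro tendsto_lowerbound[OF lim]) auto
  then have "emeasure M ?N = 0" by (simp add: emeasure_eq_measure measure_le_0_iff)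
  then show ?thesis by (intro AE_I[of _ _ ?N] N) (auto simp flip: not_less)
qed

lemma hit_stable:
  assumes "hit c (2 ^ k) \<omega> < 2 ^ k" "k \<le> j"
  shows "hit c (2 ^ j) \<omega> = hit c (2 ^ k) \<omega>"
proof -
  have "(2::real) ^ k \<le> 2 ^ j" using assms(2) by simp
  then show ?thesis using hit_min[of "2 ^ k" "2 ^ j" c \<omega>] assms(1) by (auto simp: min_def split: if_splits)
qed

end

lemma dyadic_sum_le:
  fixes x :: real assumes "0 \<le> x" shows "(\<Sum>k<n. 2 ^ k * (if 2 ^ k < x then 1 else 0)) \<le> 2 * x"
proof (induction n)
  case (Suc n)
  show ?case
  proof (cases "2 ^ n < x")
    case True
    have "(\<Sum>k<Suc n. 2 ^ k * (if 2 ^ k < x then 1 else 0)) \<le> (\<Sum>k<Suc n. (2::real) ^ k)"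
      by (intro sum_mono) auto
    also have "\<dots> = 2 ^ Suc n - 1" by (simp add: sum_power2 geometric_sum)
    also have "\<dots> \<le> 2 * x" using True by simp
    finally show ?thesis .
  next
    case False
    then show ?thesis using Suc by simp
  qed
qed (use assms in simp)

context drifted_clock
begin

text \<open>The increment vanishes unless the level is hit after \<open>2^k\<close>. Its second moment is at most the
  increment of the clock, of order \<open>4^k\<close> by quadratic growth, times the probability of that event. With
  \<open>\<bar>x\<bar> \<le> x\<^sup>2 / y + y\<close> at \<open>y = 2^k\<close> its mean absolute value is of order \<open>2^k\<close> times this probability.\<close>

lemma dyadic_increment:
  fixes c :: real and k :: nat
  defines "D \<equiv> \<lambda>\<omega>. W (f (hit c (2 ^ Suc k) \<omega>)) \<omega> - W (f (hit c (2 ^ k) \<omega>)) \<omega>"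
  shows "integrable M D"
    "expectation (\<lambda>\<omega>. \<bar>D \<omega>\<bar>) \<le> (5 * C + 1) * expectation (\<lambda>\<omega>. 2 ^ k * (if 2 ^ k < hit c (2 ^ Suc k) \<omega> then 1 else 0))"
proof -
  let ?\<tau> = "hit c (2 ^ Suc k)" and ?s = "f (2 ^ k)" and ?t = "f (2 ^ Suc k)"
  have le: "(2::real) ^ k \<le> 2 ^ Suc k" by simp
  have st: "0 \<le> ?s" "?s \<le> ?t" using f_nonneg f_le le by auto
  have min: "hit c (2 ^ k) \<omega> = min (2 ^ k) (?\<tau> \<omega>)" for \<omega> using hit_min[OF _ le] by simp
  have \<tau>: "0 \<le> ?\<tau> \<omega>" "?\<tau> \<omega> \<le> 2 ^ Suc k" for \<omega> using hit_nonneg hit_le_bound by auto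
  have stop: "\<And>r. 0 \<le> r \<Longrightarrow> {\<omega> \<in> space M. r < f (?\<tau> \<omega>)} \<in> sets (F r)" by (rule hit_stopping) auto
  note os = optional_stopping[OF st stop]
  have clip: "W (max ?s (min ?t (f (?\<tau> \<omega>)))) \<omega> - W ?s \<omega> = D \<omega>" for \<omega>
  proof -
    have "f (?\<tau> \<omega>) \<le> ?t" using \<tau> by (intro f_le)
    then show ?thesis
      using f_le[of "?\<tau> \<omega>" "2 ^ k"] f_le[of "2 ^ k" "?\<tau> \<omega>"] \<tau>[of \<omega>]
      by (cases "2 ^ k \<le> ?\<tau> \<omega>") (auto simp: D_def min max_def)
  qed
  note os = os[unfolded clip]
  show iD: "integrable M D" by (rule os(1))
  have [measurable]: "?\<tau> \<in> borel_measurable M" by (rule hit_measurable) simp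
  then have [measurable]: "hit c (2 * 2 ^ k) \<in> borel_measurable M" by simp
  let ?I = "\<lambda>\<omega>. 2 ^ k * (if 2 ^ k < ?\<tau> \<omega> then 1 else 0) :: real"
  let ?E = "{\<omega> \<in> space M. 2 ^ k < ?\<tau> \<omega>}"
  have iI: "integrable M ?I" by (rule integrable_const_bound[where B = "2 ^ k"]) auto
  have EI: "expectation ?I = 2 ^ k * prob ?E"
  proof -
    have "expectation ?I = expectation (\<lambda>\<omega>. 2 ^ k * indicator ?E \<omega>)"
      by (rule Bochner_Integration.integral_cong) (auto simp: indicator_def)
    then show ?thesis by (simp add: Int_absorb2 Collect_conj_eq)
  qed
  have "prob {\<omega> \<in> space M. ?s < f (?\<tau> \<omega>)} \<le> prob ?E"
  proof (rule finite_measure_mono)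
    show "{\<omega> \<in> space M. ?s < f (?\<tau> \<omega>)} \<subseteq> ?E"
      using f_le[OF \<tau>(1), of _ "2 ^ k"] by (auto simp: not_less[symmetric])
  qed measurable
  moreover have "?t - ?s \<le> 5 * C * 4 ^ k"
  proof -
    have "?t \<le> C * (1 + (2 ^ Suc k)\<^sup>2)" by (rule f_growth) simp
    also have "\<dots> = C * (1 + 4 * 4 ^ k)" by (simp add: power_mult_distrib power2_eq_square flip: power_mult_distrib)
    also have "\<dots> \<le> C * (5 * 4 ^ k)" using C_nonneg by (intro mult_left_mono) auto
    finally show ?thesis using st by simp
  qed
  ultimately have "(?t - ?s) * prob {\<omega> \<in> space M. ?s < f (?\<tau> \<omega>)} \<le> 5 * C * 4 ^ k * prob ?E"
    using C_nonneg by (intro mult_mono) auto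
  with os(3) have sq: "expectation (\<lambda>\<omega>. (D \<omega>)\<^sup>2) \<le> 5 * C * 4 ^ k * prob ?E" by simp
  have pt: "\<bar>D \<omega>\<bar> \<le> (D \<omega>)\<^sup>2 / 2 ^ k + ?I \<omega>" for \<omega>
  proof (cases "2 ^ k < ?\<tau> \<omega>")
    case True
    have p: "(0::real) < 2 ^ k" by simp
    have "\<bar>x\<bar> \<le> x\<^sup>2 / y + y" if "0 < y" for x y :: real
    proof (cases "\<bar>x\<bar> \<le> y")
      case False
      then have "y * \<bar>x\<bar> \<le> \<bar>x\<bar> * \<bar>x\<bar>" by (intro mult_right_mono) auto
      then have "\<bar>x\<bar> \<le> x\<^sup>2 / y" using that by (simp add: field_simps power2_eq_square)
      then show ?thesis using that by linarith
    qed (use that in \<open>auto intro: add_increasing\<close>)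
    from this[OF p] True show ?thesis by simp
  next
    case False
    then have "D \<omega> = 0" by (simp add: D_def min)
    then show ?thesis by simp
  qed
  have "expectation (\<lambda>\<omega>. \<bar>D \<omega>\<bar>) \<le> expectation (\<lambda>\<omega>. (D \<omega>)\<^sup>2 / 2 ^ k + ?I \<omega>)"
    using iD os(2) iI pt by (intro integral_mono) auto
  also have "\<dots> = expectation (\<lambda>\<omega>. (D \<omega>)\<^sup>2) / 2 ^ k + expectation ?I"
    using os(2) iI by simp
  also have "\<dots> \<le> 5 * C * 4 ^ k * prob ?E / 2 ^ k + 2 ^ k * prob ?E"
    using sq unfolding EI by (simp add: divide_right_mono)
  also have "\<dots> = (5 * C + 1) * (2 ^ k * prob ?E)"
  proof -
    have "(4::real) ^ k = 2 ^ k * 2 ^ k" by (simp flip: power_mult_distrib)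
    then show ?thesis by (simp add: field_simps)
  qed
  finally show "expectation (\<lambda>\<omega>. \<bar>D \<omega>\<bar>) \<le> (5 * C + 1) * expectation ?I" unfolding EI .
qed

text \<open>The sum of \<open>2^k\<close> times the probability of a hit after \<open>2^k\<close> is at most twice the mean hitting time,
  which is bounded by \<open>hit_mean_le\<close>. Hence the stopped Brownian motion is dominated along dyadic
  times, as in the Burkholder-Davis-Gundy inequality with exponent one.\<close>

lemma dominated_by_dyadic:
  assumes "0 \<le> c"
  obtains w where "integrable M w" "AE \<omega> in M. \<forall>k. \<bar>W (f (hit c (2 ^ k) \<omega>)) \<omega>\<bar> \<le> w \<omega>"
proof -
  define D where "D k \<omega> = W (f (hit c (2 ^ Suc k) \<omega>)) \<omega> - W (f (hit c (2 ^ k) \<omega>)) \<omega>" for k \<omega>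
  let ?I = "\<lambda>k \<omega>. 2 ^ k * (if 2 ^ k < hit c (2 ^ Suc k) \<omega> then 1 else 0) :: real"
  have iD: "integrable M (D k)" for k unfolding D_def by (rule dyadic_increment(1))
  have aD: "integrable M (\<lambda>\<omega>. \<bar>D k \<omega>\<bar>)" for k using iD by simp
  have [measurable]: "hit c (2 ^ k) \<in> borel_measurable M" for k by (rule hit_measurable) simp
  have [measurable]: "hit c (2 * 2 ^ k) \<in> borel_measurable M" for k by (rule hit_measurable) simp
  have iI: "integrable M (?I k)" for k by (rule integrable_const_bound[where B = "2 ^ k"]) auto
  have sums: "(\<Sum>k<n. expectation (\<lambda>\<omega>. \<bar>D k \<omega>\<bar>)) \<le> (5 * C + 1) * (2 * c)" for n
  proof -
    have "(\<Sum>k<n. expectation (\<lambda>\<omega>. \<bar>D k \<omega>\<bar>)) \<le> (\<Sum>k<n. (5 * C + 1) * expectation (?I k))"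
      unfolding D_def by (intro sum_mono dyadic_increment(2))
    also have "\<dots> = (5 * C + 1) * expectation (\<lambda>\<omega>. \<Sum>k<n. ?I k \<omega>)"
      using iI by (simp add: sum_distrib_left)
    also have "\<dots> \<le> (5 * C + 1) * expectation (\<lambda>\<omega>. 2 * hit c (2 ^ n) \<omega>)"
    proof (intro mult_left_mono integral_mono)
      show "integrable M (\<lambda>\<omega>. \<Sum>k<n. ?I k \<omega>)" using iI by (intro Bochner_Integration.integrable_sum) auto
      show "integrable M (\<lambda>\<omega>. 2 * hit c (2 ^ n) \<omega>)" using hit_integrable by simp
      fix \<omega> assume "\<omega> \<in> space M"
      have "(\<Sum>k<n. ?I k \<omega>) \<le> (\<Sum>k<n. 2 ^ k * (if 2 ^ k < hit c (2 ^ n) \<omega> then 1 else 0))"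
      proof (rule sum_mono)
        fix k assume "k \<in> {..<n}"
        then have "(2::real) ^ Suc k \<le> 2 ^ n" by (intro power_increasing) auto
        then show "?I k \<omega> \<le> 2 ^ k * (if 2 ^ k < hit c (2 ^ n) \<omega> then 1 else 0)"
          using hit_min[of "2 ^ Suc k" "2 ^ n" c \<omega>] by auto
      qed
      also have "\<dots> \<le> 2 * hit c (2 ^ n) \<omega>" by (intro dyadic_sum_le hit_nonneg) simp
      finally show "(\<Sum>k<n. ?I k \<omega>) \<le> 2 * hit c (2 ^ n) \<omega>" .
    qed (use C_nonneg in auto)
    also have "\<dots> \<le> (5 * C + 1) * (2 * c)"
    proof -
      have "expectation (hit c (2 ^ n)) * 1 \<le> expectation (hit c (2 ^ n)) * (1 + lam)"
        using lam hit_nonneg[of "2 ^ n" c] by (intro mult_left_mono integral_nonneg) auto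
      then have "expectation (hit c (2 ^ n)) \<le> c" using hit_mean_le[of "2 ^ n" c] assms by (simp add: mult.commute)
      then show ?thesis using C_nonneg by (simp add: mult_left_mono)
    qed
    finally show ?thesis .
  qed
  have summ: "summable (\<lambda>k. expectation (\<lambda>\<omega>. norm \<bar>D k \<omega>\<bar>))"
    using sums by (intro summableI_nonneg_bounded[where x = "(5 * C + 1) * (2 * c)"]) auto
  have "(\<integral>\<^sup>+\<omega>. (\<Sum>k. ennreal \<bar>D k \<omega>\<bar>) \<partial>M) = (\<Sum>k. \<integral>\<^sup>+\<omega>. ennreal \<bar>D k \<omega>\<bar> \<partial>M)"
    using iD by (intro nn_integral_suminf) auto
  also have "\<dots> = (\<Sum>k. ennreal (expectation (\<lambda>\<omega>. \<bar>D k \<omega>\<bar>)))"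
    using aD by (simp add: nn_integral_eq_integral)
  also have "\<dots> < \<infinity>"
    using summ by (simp add: suminf_ennreal2 less_top[symmetric] ennreal_suminf_neq_top)
  finally have "AE \<omega> in M. (\<Sum>k. ennreal \<bar>D k \<omega>\<bar>) \<noteq> \<infinity>"
    using iD by (intro nn_integral_PInf_AE) auto
  then have pw: "AE \<omega> in M. summable (\<lambda>k. norm \<bar>D k \<omega>\<bar>)"
    by eventually_elim (simp add: summable_suminf_not_top)
  define w where "w \<omega> = \<bar>W (f (hit c 1 \<omega>)) \<omega>\<bar> + (\<Sum>k. \<bar>D k \<omega>\<bar>)" for \<omega>
  have "integrable M w"
    unfolding w_def using integrable_suminf[OF aD pw summ] stopped_mean(1)[of 1 c]
    by (intro Bochner_Integration.integrable_add) auto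
  moreover have "AE \<omega> in M. \<forall>k. \<bar>W (f (hit c (2 ^ k) \<omega>)) \<omega>\<bar> \<le> w \<omega>"
    using pw
  proof eventually_elim
    case (elim \<omega>)
    have "\<bar>W (f (hit c (2 ^ k) \<omega>)) \<omega>\<bar> \<le> \<bar>W (f (hit c 1 \<omega>)) \<omega>\<bar> + (\<Sum>j<k. \<bar>D j \<omega>\<bar>)" for k
    proof (induction k)
      case (Suc k)
      have "W (f (hit c (2 ^ Suc k) \<omega>)) \<omega> = W (f (hit c (2 ^ k) \<omega>)) \<omega> + D k \<omega>" by (simp add: D_def)
      with Suc show ?case by (simp del: power_Suc)
    qed simp
    moreover have "(\<Sum>j<k. \<bar>D j \<omega>\<bar>) \<le> (\<Sum>j. \<bar>D j \<omega>\<bar>)" for k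
      using elim by (intro sum_le_suminf) auto
    ultimately show ?case unfolding w_def by (meson add_left_mono order_trans)
  qed
  ultimately show ?thesis by (rule that)
qed

text \<open>By domination the mean zero of the stopped Brownian motion survives the limit, in which the level
  is equal to \<open>c\<close>.\<close>

lemma hit_mean_tendsto:
  assumes "0 \<le> c"
  shows "(\<lambda>k. (1 + lam) * expectation (hit c (2 ^ k))) \<longlonglongrightarrow> c"
proof -
  obtain w where w: "integrable M w" "AE \<omega> in M. \<forall>k. \<bar>W (f (hit c (2 ^ k) \<omega>)) \<omega>\<bar> \<le> w \<omega>"
    using dominated_by_dyadic[OF assms] .
  have sp: "AE \<omega> in M. \<omega> \<in> space M" by simp
  have m: "(\<lambda>\<omega>. level \<omega> (hit c (2 ^ k) \<omega>)) \<in> borel_measurable M" for k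
    unfolding level_def using hit_integrable[of "2 ^ k" c] stopped_mean(1)[of "2 ^ k" c] by measurable
  have "(\<lambda>k. expectation (\<lambda>\<omega>. level \<omega> (hit c (2 ^ k) \<omega>))) \<longlonglongrightarrow> expectation (\<lambda>\<omega>. c)"
  proof (rule integral_dominated_convergence[where w = "\<lambda>\<omega>. c + nu * w \<omega> + nu * w \<omega>"])
    show "AE \<omega> in M. (\<lambda>k. level \<omega> (hit c (2 ^ k) \<omega>)) \<longlonglongrightarrow> c"
      using level_0 hit_finite[OF assms] sp
    proof eventually_elim
      case (elim \<omega>)
      then obtain k where k: "hit c (2 ^ k) \<omega> < 2 ^ k" by blast
      have "level \<omega> (hit c (2 ^ k) \<omega>) = c"
        using level_at_hit[OF elim(3) _ k] level_at_hit_le[OF elim(3), of "2 ^ k" c] elim assms by simp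
      then have "level \<omega> (hit c (2 ^ j) \<omega>) = c" if "k \<le> j" for j using hit_stable[OF k that] by simp
      then show ?case by (intro tendsto_eventually) (auto simp: eventually_sequentially)
    qed
    show "AE \<omega> in M. norm (level \<omega> (hit c (2 ^ k) \<omega>)) \<le> c + nu * w \<omega> + nu * w \<omega>" for k
      using level_0 w(2) sp
    proof eventually_elim
      case (elim \<omega>)
      have "nu * \<bar>W (f (hit c (2 ^ k) \<omega>)) \<omega>\<bar> \<le> nu * w \<omega>" using elim nu by (intro mult_left_mono) auto
      then have "\<bar>nu * W (f (hit c (2 ^ k) \<omega>)) \<omega>\<bar> \<le> nu * w \<omega>" using nu by (simp add: abs_mult)
      moreover have "0 \<le> (1 + lam) * hit c (2 ^ k) \<omega>" using lam hit_nonneg[of "2 ^ k" c \<omega>] by simp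
      moreover have "level \<omega> (hit c (2 ^ k) \<omega>) \<le> c" by (rule level_at_hit_le) (use elim assms in auto)
      ultimately show ?case unfolding level_def real_norm_def using assms by linarith
    qed
  qed (use m w in auto)
  moreover have "expectation (\<lambda>\<omega>. level \<omega> (hit c (2 ^ k) \<omega>)) = (1 + lam) * expectation (hit c (2 ^ k))" for k
    unfolding level_def using hit_integrable[of "2 ^ k" c] stopped_mean[of "2 ^ k" c] by simp
  ultimately show ?thesis by (simp add: prob_space)
qed

definition passage :: "real \<Rightarrow> 'a \<Rightarrow> real" where
  "passage c \<omega> = Inf {u. 0 \<le> u \<and> c < level \<omega> u}"

lemma level_unbounded: "AE \<omega> in M. \<forall>c. \<exists>u\<ge>0. c < level \<omega> u"
proof -
  have "AE \<omega> in M. \<forall>m::nat. \<exists>k. hit (real m) (2 ^ k) \<omega> < 2 ^ k"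
    by (subst AE_all_countable) (auto intro: hit_finite)
  moreover have "AE \<omega> in M. \<omega> \<in> space M" by simp
  ultimately show ?thesis
  proof eventually_elim
    case (elim \<omega>)
    show ?case
    proof
      fix c
      obtain m :: nat where m: "c < real m" using reals_Archimedean2 by blast
      obtain k where k: "hit (real m) (2 ^ k) \<omega> < 2 ^ k" using elim by blast
      have "real m \<le> level \<omega> (hit (real m) (2 ^ k) \<omega>)" by (rule level_at_hit[OF elim(2) _ k]) simp
      then show "\<exists>u\<ge>0. c < level \<omega> u" using m hit_nonneg[of "2 ^ k" "real m" \<omega>] by (intro exI[of _ "hit (real m) (2 ^ k) \<omega>"]) auto
    qed
  qed
qed

text \<open>The passage time over \<open>c\<close> lies between the hitting times of \<open>c\<close> and of any \<open>c' > c\<close>.\<close>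

lemma passage_mean:
  assumes c: "0 \<le> c" and m [measurable]: "passage c \<in> borel_measurable M"
  shows "integrable M (passage c)" "(1 + lam) * expectation (passage c) = c"
proof -
  have nn: "AE \<omega> in M. 0 \<le> passage c \<omega>"
    using level_unbounded by eventually_elim (auto simp: passage_def intro!: cInf_greatest)
  have upper: "(\<integral>\<^sup>+\<omega>. ennreal (passage c \<omega>) \<partial>M) \<le> ennreal (c' / (1 + lam))" if c': "c < c'" for c'
  proof -
    have [measurable]: "hit c' (2 ^ k) \<in> borel_measurable M" for k by (rule hit_measurable) simp
    have "AE \<omega> in M. \<exists>k. hit c' (2 ^ k) \<omega> < 2 ^ k" using c c' by (intro hit_finite) simp
    moreover have "AE \<omega> in M. \<omega> \<in> space M" by simp
    ultimately have "AE \<omega> in M. ennreal (passage c \<omega>) \<le> liminf (\<lambda>k. ennreal (hit c' (2 ^ k) \<omega>))"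
    proof eventually_elim
      case (elim \<omega>)
      then obtain k where k: "hit c' (2 ^ k) \<omega> < 2 ^ k" by blast
      have "c' \<le> level \<omega> (hit c' (2 ^ k) \<omega>)" by (rule level_at_hit[OF elim(2) _ k]) simp
      then have "passage c \<omega> \<le> hit c' (2 ^ k) \<omega>"
        unfolding passage_def using c' hit_nonneg[of "2 ^ k" c' \<omega>]
        by (intro cInf_lower) (auto intro!: bdd_belowI[of _ 0])
      then have "passage c \<omega> \<le> hit c' (2 ^ j) \<omega>" if "k \<le> j" for j using hit_stable[OF k that] by simp
      then show ?case
        by (intro Liminf_bounded) (auto simp: eventually_sequentially intro!: ennreal_leI)
    qed
    then have "(\<integral>\<^sup>+\<omega>. ennreal (passage c \<omega>) \<partial>M) \<le> (\<integral>\<^sup>+\<omega>. liminf (\<lambda>k. ennreal (hit c' (2 ^ k) \<omega>)) \<partial>M)"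
      by (rule nn_integral_mono_AE)
    also have "\<dots> \<le> liminf (\<lambda>k. \<integral>\<^sup>+\<omega>. ennreal (hit c' (2 ^ k) \<omega>) \<partial>M)" by (rule nn_integral_liminf) measurable
    also have "\<dots> \<le> liminf (\<lambda>k. ennreal (c' / (1 + lam)))"
    proof (intro Liminf_mono always_eventually allI)
      fix k
      have "expectation (hit c' (2 ^ k)) \<le> c' / (1 + lam)"
        using hit_mean_le[of "2 ^ k" c'] c c' lam by (simp add: field_simps)
      then show "(\<integral>\<^sup>+\<omega>. ennreal (hit c' (2 ^ k) \<omega>) \<partial>M) \<le> ennreal (c' / (1 + lam))"
        by (subst nn_integral_eq_integral) (auto simp: hit_integrable hit_nonneg intro: ennreal_leI)
    qed
    finally show ?thesis by (simp add: Liminf_const)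
  qed
  show i: "integrable M (passage c)"
    by (rule integrableI_nonneg[OF m nn]) (use upper[of "c + 1"] in \<open>auto intro: le_less_trans\<close>)
  have up: "(1 + lam) * expectation (passage c) \<le> c'" if "c < c'" for c'
  proof -
    have "ennreal (expectation (passage c)) \<le> ennreal (c' / (1 + lam))"
      using upper[OF that] by (simp add: nn_integral_eq_integral[OF i nn])
    then have "expectation (passage c) \<le> c' / (1 + lam)"
      using c that lam by (simp add: ennreal_le_iff)
    then show ?thesis using lam by (simp add: field_simps)
  qed
  have "expectation (hit c (2 ^ k)) \<le> expectation (passage c)" for k
  proof (rule integral_mono_AE)
    show "AE \<omega> in M. hit c (2 ^ k) \<omega> \<le> passage c \<omega>"
      using level_unbounded
    proof eventually_elim
      case (elim \<omega>)
      have "hit c (2 ^ k) \<omega> \<le> u" if "0 \<le> u" "c < level \<omega> u" for u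
        using hit_le[of "2 ^ k" u c \<omega>] hit_le_bound[of "2 ^ k" c \<omega>] that by (cases "u \<le> 2 ^ k") auto
      then show ?case unfolding passage_def using elim by (intro cInf_greatest) auto
    qed
  qed (use i hit_integrable in auto)
  then have "c \<le> (1 + lam) * expectation (passage c)"
    using lam by (intro LIMSEQ_le_const2[OF hit_mean_tendsto[OF c]]) (auto intro!: mult_left_mono)
  moreover have "(1 + lam) * expectation (passage c) \<le> c" by (rule dense_ge) (rule up)
  ultimately show "(1 + lam) * expectation (passage c) = c" by simp
qed

end

section \<open>Volterra equations driven by a stopped Brownian motion\<close>

lemma has_integral_reflect_shift:
  assumes "(K has_integral i) {a..b::real}" "a \<le> b"
  shows "((\<lambda>s. K (t - s)) has_integral (i::real)) {t - b..t - a}"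
proof -
  have "((\<lambda>x. K ((-1) *\<^sub>R x + t)) has_integral (1 / (\<bar>-1\<bar> ^ DIM(real))) *\<^sub>R i)
     ((\<lambda>x. (1 / (-1)) *\<^sub>R x + -((1 / (-1)) *\<^sub>R t)) ` cbox a b)"
    by (rule has_integral_affinity) (use assms in auto)
  moreover have "(\<lambda>x. (1 / (-1)) *\<^sub>R x + -((1 / (-1)) *\<^sub>R t)) ` cbox a b = {t - b..t - a}"
  proof -
    have "y \<in> (\<lambda>x. (1 / (-1)) *\<^sub>R x + -((1 / (-1)) *\<^sub>R t)) ` cbox a b" if "y \<in> {t - b..t - a}" for y
      by (rule image_eqI[of _ _ "t - y"]) (use that in auto)
    then show ?thesis by auto
  qed
  ultimately show ?thesis by simp
qed

locale kernel =
  fixes K :: "real \<Rightarrow> real"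
  assumes K_integrable: "\<And>b. 0 \<le> b \<Longrightarrow> K absolutely_integrable_on {0..b}" and K_nonneg: "\<And>t. 0 \<le> t \<Longrightarrow> 0 \<le> K t"
begin

definition mass :: "real \<Rightarrow> real" where "mass d = integral {0..d} K"

lemma K_on: "0 \<le> a \<Longrightarrow> K integrable_on {a..b}"
proof (cases "a \<le> b")
  case True
  assume "0 \<le> a"
  then have "K integrable_on {0..b}" using K_integrable[of b] True by (simp add: absolutely_integrable_on_def)
  then show ?thesis by (rule integrable_on_subinterval) (use \<open>0 \<le> a\<close> in auto)
qed (simp add: integrable_on_empty)

lemma mass_nonneg: "0 \<le> mass d"
  unfolding mass_def by (rule Henstock_Kurzweil_Integration.integral_nonneg[OF K_on]) (use K_nonneg in auto)

lemma mass_mono: "0 \<le> d \<Longrightarrow> d \<le> e \<Longrightarrow> mass d \<le> mass e"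
  unfolding mass_def by (rule integral_subset_le) (use K_on K_nonneg in auto)

lemma mass_split: "0 \<le> d \<Longrightarrow> d \<le> e \<Longrightarrow> integral {d..e} K = mass e - mass d"
  unfolding mass_def using Henstock_Kurzweil_Integration.integral_combine[of 0 d e K] K_on by simp

lemma reflected:
  assumes "0 \<le> a" "a \<le> b"
  shows "((\<lambda>s. K (t - s)) has_integral (integral {a..b} K)) {t - b..t - a}"
  by (rule has_integral_reflect_shift[OF integrable_integral[OF K_on]]) (use assms in auto)

lemma reflected_abs: "0 \<le> t \<Longrightarrow> (\<lambda>s. K (t - s)) absolutely_integrable_on {0..t}"
  using reflected[of 0 t t] K_nonneg
  by (intro nonnegative_absolutely_integrable_1) (auto simp: has_integral_integrable)

lemma convolution_abs:
  assumes "0 \<le> t" "continuous_on {0..t} u"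
  shows "(\<lambda>s. K (t - s) * u s) absolutely_integrable_on {0..t}"
proof -
  have "(\<lambda>s. u s * K (t - s)) absolutely_integrable_on {0..t}"
  proof (rule absolutely_integrable_bounded_measurable_product_real)
    show "u \<in> borel_measurable (lebesgue_on {0..t})" using assms(2) by (rule continuous_imp_measurable_on_sets_lebesgue) simp
    show "bounded (u ` {0..t})" by (intro compact_imp_bounded compact_continuous_image assms) simp
  qed (use reflected_abs[OF assms(1)] in auto)
  then show ?thesis by (simp add: mult.commute)
qed

text \<open>The convolution is an average of \<open>u\<close> with weights that concentrate on the last \<open>d\<close> units of time.\<close>

lemma convolution_lower:
  assumes d: "0 \<le> d" "d \<le> t" and u: "continuous_on {0..t} u"
    and near: "\<And>s. t - d \<le> s \<Longrightarrow> s \<le> t \<Longrightarrow> m \<le> u s" and far: "\<And>s. 0 \<le> s \<Longrightarrow> s \<le> t \<Longrightarrow> - C \<le> u s"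
  shows "m * mass d - C * (mass t - mass d) \<le> integral {0..t} (\<lambda>s. K (t - s) * u s)"
proof -
  have i: "(\<lambda>s. K (t - s) * u s) integrable_on {0..t}"
    using convolution_abs[of t u] d u by (simp add: absolutely_integrable_on_def)
  have sub: "(\<lambda>s. K (t - s) * u s) integrable_on {0..t - d}" "(\<lambda>s. K (t - s) * u s) integrable_on {t - d..t}"
    by (rule integrable_on_subinterval[OF i]; use d in auto)+
  have nearK: "((\<lambda>s. K (t - s)) has_integral mass d) {t - d..t}"
    using reflected[of 0 d t] d by (simp add: mass_def)
  have farK: "((\<lambda>s. K (t - s)) has_integral (mass t - mass d)) {0..t - d}"
    using reflected[of d t t] d mass_split[of d t] by simp
  have "((\<lambda>s. K (t - s) * m) has_integral mass d * m) {t - d..t}" by (rule has_integral_mult_left[OF nearK])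
  then have 1: "mass d * m \<le> integral {t - d..t} (\<lambda>s. K (t - s) * u s)"
    by (rule has_integral_le[OF _ integrable_integral[OF sub(2)]])
      (rule mult_left_mono; use near K_nonneg d in simp)
  have "((\<lambda>s. K (t - s) * (- C)) has_integral (mass t - mass d) * (- C)) {0..t - d}" by (rule has_integral_mult_left[OF farK])
  then have 2: "(mass t - mass d) * (- C) \<le> integral {0..t - d} (\<lambda>s. K (t - s) * u s)"
    by (rule has_integral_le[OF _ integrable_integral[OF sub(1)]])
      (rule mult_left_mono; use far K_nonneg d in simp)
  have "integral {0..t} (\<lambda>s. K (t - s) * u s) = integral {0..t - d} (\<lambda>s. K (t - s) * u s) + integral {t - d..t} (\<lambda>s. K (t - s) * u s)"
    using Henstock_Kurzweil_Integration.integral_combine[OF _ _ i, of "t - d"] d by simp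
  then show ?thesis using 1 2 by (simp add: algebra_simps)
qed

text \<open>The convolution with \<open>K\<close> up to time \<open>t\<close> as integration against a finite measure, to which Fubini
  applies.\<close>

definition kernel_measure :: "real \<Rightarrow> real measure" where
  "kernel_measure t = density lebesgue (\<lambda>s. ennreal (indicator {0..t} s * K (t - s)))"

lemma kernel_density_integrable: "0 \<le> t \<Longrightarrow> integrable lebesgue (\<lambda>s. indicator {0..t} s * K (t - s))"
  using reflected_abs[of t] by (simp add: set_integrable_def)

lemma finite_kernel_measure: "0 \<le> t \<Longrightarrow> finite_measure (kernel_measure t)"
proof
  assume t: "0 \<le> t"
  note i = kernel_density_integrable[OF t]
  have "emeasure (kernel_measure t) (space (kernel_measure t)) = (\<integral>\<^sup>+s. ennreal (indicator {0..t} s * K (t - s)) \<partial>lebesgue)"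
    unfolding kernel_measure_def using i by (subst emeasure_density) (auto simp: space_density)
  also have "\<dots> = ennreal (\<integral>s. indicator {0..t} s * K (t - s) \<partial>lebesgue)"
    by (rule nn_integral_eq_integral[OF i]) (auto simp: indicator_def K_nonneg)
  finally show "emeasure (kernel_measure t) (space (kernel_measure t)) \<noteq> \<infinity>" by simp
qed

lemma kernel_measure_integral:
  assumes t: "0 \<le> t" and u: "u \<in> borel_measurable lebesgue" "continuous_on {0..t} u"
  shows "(\<integral>s. u s \<partial>kernel_measure t) = integral {0..t} (\<lambda>s. K (t - s) * u s)"
proof -
  have "(\<integral>s. u s \<partial>kernel_measure t) = (\<integral>s. (indicator {0..t} s * K (t - s)) * u s \<partial>lebesgue)"
    unfolding kernel_measure_def
    by (rule integral_real_density) (use u kernel_density_integrable[OF t] in \<open>auto simp: indicator_def K_nonneg\<close>)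
  also have "\<dots> = (LINT s:{0..t}|lebesgue. K (t - s) * u s)" by (simp add: set_lebesgue_integral_def mult.assoc)
  also have "\<dots> = integral {0..t} (\<lambda>s. K (t - s) * u s)"
    by (rule set_lebesgue_integral_eq_integral(2)[OF convolution_abs[OF t u(2)]])
  finally show ?thesis .
qed

end



text \<open>Continuity in time exhibits the process as a limit of processes that are constant on small time
  intervals.\<close>

lemma joint_measurable:
  fixes V :: "'a \<Rightarrow> real \<Rightarrow> real"
  assumes m: "\<And>s. (\<lambda>\<omega>. V \<omega> s) \<in> borel_measurable M" and c: "\<And>\<omega>. \<omega> \<in> space M \<Longrightarrow> continuous_on UNIV (V \<omega>)"
  shows "(\<lambda>p. V (snd p) (fst p)) \<in> borel_measurable (borel \<Otimes>\<^sub>M M)"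
proof (rule borel_measurable_LIMSEQ_real)
  let ?r = "\<lambda>m s. of_int \<lfloor>s * real (Suc m)\<rfloor> / real (Suc m) :: real"
  show "(\<lambda>p. V (snd p) (?r m (fst p))) \<in> borel_measurable (borel \<Otimes>\<^sub>M M)" for m
  proof (rule measurable_compose_countable[where f = "\<lambda>i p. V (snd p) (of_int i / real (Suc m))" and g = "\<lambda>p. \<lfloor>fst p * real (Suc m)\<rfloor>"])
    show "(\<lambda>p. V (snd p) (of_int i / real (Suc m))) \<in> borel_measurable (borel \<Otimes>\<^sub>M M)" for i
      by (rule measurable_compose[OF measurable_snd m])
  qed measurable
  fix p :: "real \<times> 'a" assume "p \<in> space (borel \<Otimes>\<^sub>M M)"
  then have "snd p \<in> space M" by (auto simp: space_pair_measure)
  have "\<bar>?r m (fst p) - fst p\<bar> \<le> inverse (real (Suc m))" for m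
  proof -
    have "of_int \<lfloor>fst p * real (Suc m)\<rfloor> \<le> fst p * real (Suc m)" "fst p * real (Suc m) < of_int \<lfloor>fst p * real (Suc m)\<rfloor> + 1"
      by linarith+
    then have "\<bar>of_int \<lfloor>fst p * real (Suc m)\<rfloor> - fst p * real (Suc m)\<bar> \<le> 1" by linarith
    moreover have "?r m (fst p) - fst p = (of_int \<lfloor>fst p * real (Suc m)\<rfloor> - fst p * real (Suc m)) / real (Suc m)"
      by (simp add: diff_divide_distrib del: of_nat_Suc)
    ultimately show ?thesis by (simp add: abs_divide inverse_eq_divide divide_right_mono del: of_nat_Suc)
  qed
  then have "(\<lambda>m. ?r m (fst p) - fst p) \<longlonglongrightarrow> 0"
    by (intro Lim_null_comparison[OF _ LIMSEQ_inverse_real_of_nat] always_eventually) auto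
  then have "(\<lambda>m. ?r m (fst p)) \<longlonglongrightarrow> fst p" by (rule LIM_zero_cancel)
  then show "(\<lambda>m. V (snd p) (?r m (fst p))) \<longlonglongrightarrow> V (snd p) (fst p)"
    by (rule continuous_on_tendsto_compose[OF c[OF \<open>snd p \<in> space M\<close>]]) auto
qed



lemma own_martingale_moments:
  assumes P: "prob_space M" and mart: "own_martingale M T Z" and s: "0 \<le> s" "s \<le> t" "t \<le> T"
  shows "integral\<^sup>L M (Z s) = integral\<^sup>L M (Z t)" "(\<integral>\<omega>. \<bar>Z s \<omega>\<bar> \<partial>M) \<le> (\<integral>\<omega>. \<bar>Z t \<omega>\<bar> \<partial>M)"
proof -
  interpret prob_space M by fact
  let ?F = "natural_filtration M Z s"
  have int: "integrable M (Z r)" if "0 \<le> r" "r \<le> T" for r using mart that by (simp add: own_martingale_def)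
  have sub: "{Z r -` A \<inter> space M | r A. 0 \<le> r \<and> r \<le> s \<and> A \<in> sets borel} \<subseteq> sets M"
    using int s by (auto intro!: measurable_sets[of _ M borel])
  then have "{Z r -` A \<inter> space M | r A. 0 \<le> r \<and> r \<le> s \<and> A \<in> sets borel} \<subseteq> Pow (space M)"
    using sets.sets_into_space by blast
  then have "sets ?F = sigma_sets (space M) {Z r -` A \<inter> space M | r A. 0 \<le> r \<and> r \<le> s \<and> A \<in> sets borel}"
    "space ?F = space M" by (simp_all add: natural_filtration_def sets_measure_of space_measure_of)
  then have "subalgebra M ?F" using sets.sigma_sets_subset[OF sub] by (simp add: subalgebra_def)
  then interpret finite_measure_subalgebra M ?F by unfold_locales
  have t: "integrable M (Z t)" and si: "integrable M (Z s)" using int s by auto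
  have [measurable]: "Z t \<in> borel_measurable M" "Z s \<in> borel_measurable M" using t si by auto
  have eq: "AE \<omega> in M. real_cond_exp M ?F (Z t) \<omega> = Z s \<omega>" using mart s by (simp add: own_martingale_def)
  have "integral\<^sup>L M (Z t) = integral\<^sup>L M (real_cond_exp M ?F (Z t))" using real_cond_exp_int(2)[OF t] by simp
  also have "\<dots> = integral\<^sup>L M (Z s)" by (rule integral_cong_AE) (use eq in auto)
  finally show "integral\<^sup>L M (Z s) = integral\<^sup>L M (Z t)" by simp
  have "(\<integral>\<^sup>+\<omega>. ennreal \<bar>Z s \<omega>\<bar> \<partial>M) \<le> (\<integral>\<^sup>+\<omega>. nn_cond_exp M ?F (\<lambda>\<omega>. ennreal \<bar>Z t \<omega>\<bar>) \<omega> \<partial>M)"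
  proof (rule nn_integral_mono_AE)
    show "AE \<omega> in M. ennreal \<bar>Z s \<omega>\<bar> \<le> nn_cond_exp M ?F (\<lambda>\<omega>. ennreal \<bar>Z t \<omega>\<bar>) \<omega>"
      using eq real_cond_exp_abs[OF \<open>Z t \<in> borel_measurable M\<close>] by eventually_elim (auto intro: ennreal_leI)
  qed
  also have "\<dots> = (\<integral>\<^sup>+\<omega>. ennreal \<bar>Z t \<omega>\<bar> \<partial>M)"
    using nn_cond_exp_intg[of "\<lambda>_. 1" "\<lambda>\<omega>. ennreal \<bar>Z t \<omega>\<bar>"] by simp
  finally show "(\<integral>\<omega>. \<bar>Z s \<omega>\<bar> \<partial>M) \<le> (\<integral>\<omega>. \<bar>Z t \<omega>\<bar> \<partial>M)"
    using t si by (simp add: nn_integral_eq_integral)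
qed



locale volterra_solution = kernel K for K +
  fixes T :: real and G0 f :: "real \<Rightarrow> real" and lam nu :: real and M :: "'a measure" and W X :: "real \<Rightarrow> 'a \<Rightarrow> real"
  assumes T: "0 < T" and lam: "0 \<le> lam" and nu: "0 \<le> nu"
    and f_cont: "continuous_on {0..} f" and f_mono: "mono_on {0..} f" and f_0: "f 0 = 0"
    and solution: "weak_solution T G0 K f lam nu M W X"
begin

lemma brownian_ex: "\<exists>F. brownian M F W"
  using solution by (auto simp: weak_solution_def brownian_def)

sublocale prob_space M
proof -
  obtain F where "brownian M F W" using brownian_ex by blast
  then interpret brownian M F W .
  show "prob_space M" by unfold_locales
qed

lemma W_cont: "\<omega> \<in> space M \<Longrightarrow> continuous_on {0..} (\<lambda>t. W t \<omega>)"
  using brownian_ex brownian.W_cont by metis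

lemma W_0: "AE \<omega> in M. W 0 \<omega> = 0"
  using brownian_ex brownian.W_0 by metis

lemma f_nonneg: "0 \<le> x \<Longrightarrow> 0 \<le> f x"
  using mono_onD[OF f_mono, of 0 x] f_0 by simp

lemma X_measurable [measurable]: "0 \<le> t \<Longrightarrow> t \<le> T \<Longrightarrow> X t \<in> borel_measurable M"
  using solution by (auto simp: weak_solution_def)

lemma X_path:
  assumes "\<omega> \<in> space M"
  shows "X 0 \<omega> = 0" "mono_on {0..T} (\<lambda>t. X t \<omega>)" "continuous_on {0..T} (\<lambda>t. X t \<omega>)"
  using solution assms by (auto simp: weak_solution_def)

lemma X_le: "\<omega> \<in> space M \<Longrightarrow> 0 \<le> s \<Longrightarrow> s \<le> t \<Longrightarrow> t \<le> T \<Longrightarrow> X s \<omega> \<le> X t \<omega>"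
  using mono_onD[OF X_path(2)] by auto

lemma X_nonneg: "\<omega> \<in> space M \<Longrightarrow> 0 \<le> t \<Longrightarrow> t \<le> T \<Longrightarrow> 0 \<le> X t \<omega>"
  using X_le[of \<omega> 0 t] X_path(1) by simp

text \<open>The martingale that is part of a weak solution.\<close>

definition Z :: "real \<Rightarrow> 'a \<Rightarrow> real" where "Z t \<omega> = W (f (X t \<omega>)) \<omega>"

lemma Z_martingale: "own_martingale M T Z"
proof -
  have "Z = (\<lambda>t \<omega>. W (f (X t \<omega>)) \<omega>)" by (intro ext) (simp add: Z_def)
  then show ?thesis using solution by (auto simp: weak_solution_def)
qed

lemma Z_integrable: "0 \<le> t \<Longrightarrow> t \<le> T \<Longrightarrow> integrable M (Z t)"
  using Z_martingale by (simp add: own_martingale_def)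

lemma Z_mean:
  assumes "0 \<le> t" "t \<le> T" shows "expectation (Z t) = 0"
proof -
  have "AE \<omega> in M. Z 0 \<omega> = 0"
    using W_0 AE_space by eventually_elim (simp add: Z_def X_path f_0)
  then have "expectation (Z 0) = expectation (\<lambda>_. 0)"
    using Z_integrable[of 0] T by (intro integral_cong_AE) auto
  then show ?thesis using own_martingale_moments(1)[OF prob_space_axioms Z_martingale, of 0 t] assms by simp
qed

lemma Z_cont: "\<omega> \<in> space M \<Longrightarrow> continuous_on {0..T} (\<lambda>t. Z t \<omega>)"
  unfolding Z_def
  by (intro continuous_on_compose2[OF W_cont] continuous_on_compose2[OF f_cont] X_path)
    (auto intro!: f_nonneg X_nonneg)

lemma equation:
  "AE \<omega> in M. \<forall>t\<in>{0..T}. X t \<omega> = G0 t + integral {0..t} (\<lambda>s. K (t - s) * (nu * Z s \<omega> - lam * X s \<omega>))"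
proof -
  have "AE \<omega> in M. \<forall>t\<in>{0..T}. X t \<omega> = G0 t + (LINT s:{0..t}|lebesgue. K (t - s) * (- lam * X s \<omega> + nu * W (f (X s \<omega>)) \<omega>))"
    using solution by (auto simp: weak_solution_def)
  with AE_space show ?thesis
  proof eventually_elim
    case (elim \<omega>)
    show ?case
    proof
      fix t assume t: "t \<in> {0..T}"
      have "continuous_on {0..t} (\<lambda>s. nu * Z s \<omega> - lam * X s \<omega>)"
        using t by (intro continuous_intros continuous_on_subset[OF Z_cont[OF elim(1)]]
          continuous_on_subset[OF X_path(3)[OF elim(1)]]) auto
      then have "(LINT s:{0..t}|lebesgue. K (t - s) * (nu * Z s \<omega> - lam * X s \<omega>)) = integral {0..t} (\<lambda>s. K (t - s) * (nu * Z s \<omega> - lam * X s \<omega>))"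
        using t by (intro set_lebesgue_integral_eq_integral(2) convolution_abs) auto
      then show "X t \<omega> = G0 t + integral {0..t} (\<lambda>s. K (t - s) * (nu * Z s \<omega> - lam * X s \<omega>))"
        using elim(2) t by (simp add: Z_def algebra_simps)
    qed
  qed
qed

text \<open>Fubini applies because the absolute moments of the martingale are bounded by that at time \<open>T\<close>.\<close>

lemma martingale_convolution:
  assumes t: "0 \<le> t" "t \<le> T"
  shows "integrable M (\<lambda>\<omega>. integral {0..t} (\<lambda>s. K (t - s) * Z s \<omega>))"
    "expectation (\<lambda>\<omega>. integral {0..t} (\<lambda>s. K (t - s) * Z s \<omega>)) = 0"
proof -
  let ?R = "kernel_measure t"
  define V where "V \<omega> s = Z (max 0 (min T s)) \<omega>" for \<omega> s
  interpret R: finite_measure ?R by (rule finite_kernel_measure[OF t(1)])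
  interpret pair: pair_sigma_finite ?R M by unfold_locales
  have clip: "max 0 (min T s) \<in> {0..T}" for s using T by auto
  have Vi: "integrable M (\<lambda>\<omega>. V \<omega> s)" for s unfolding V_def using clip[of s] by (intro Z_integrable) auto
  have Vc: "continuous_on UNIV (V \<omega>)" if "\<omega> \<in> space M" for \<omega>
    unfolding V_def using clip
    by (intro continuous_on_compose2[OF Z_cont[OF that]] continuous_intros) auto
  have "(\<lambda>p. V (snd p) (fst p)) \<in> borel_measurable (borel \<Otimes>\<^sub>M M)"
    by (rule joint_measurable) (use Vi Vc in auto)
  moreover have "(\<lambda>p. p) \<in> measurable (?R \<Otimes>\<^sub>M M) (borel \<Otimes>\<^sub>M M)"
  proof -
    have "(\<lambda>x. x) \<in> measurable ?R borel"
      by (auto simp: measurable_def kernel_measure_def)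
    then have "(\<lambda>p. (fst p, snd p)) \<in> measurable (?R \<Otimes>\<^sub>M M) (borel \<Otimes>\<^sub>M M)"
      by (intro measurable_Pair measurable_snd measurable_compose[OF measurable_fst])
    then show ?thesis by simp
  qed
  ultimately have Vm: "(\<lambda>(s, \<omega>). V \<omega> s) \<in> borel_measurable (?R \<Otimes>\<^sub>M M)"
    by (auto simp: split_beta dest: measurable_compose)
  let ?B = "expectation (\<lambda>\<omega>. \<bar>Z T \<omega>\<bar>)"
  have bound: "expectation (\<lambda>\<omega>. \<bar>V \<omega> s\<bar>) \<le> ?B" for s
    unfolding V_def using clip[of s] by (intro own_martingale_moments(2)[OF prob_space_axioms Z_martingale]) auto
  have int: "integrable (?R \<Otimes>\<^sub>M M) (\<lambda>(s, \<omega>). V \<omega> s)"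
  proof (rule pair.Fubini_integrable[OF Vm])
    show "integrable ?R (\<lambda>s. \<integral>\<omega>. norm (case (s, \<omega>) of (s, \<omega>) \<Rightarrow> V \<omega> s) \<partial>M)"
    proof (rule R.integrable_const_bound[where B = ?B])
      show "(\<lambda>s. \<integral>\<omega>. norm (case (s, \<omega>) of (s, \<omega>) \<Rightarrow> V \<omega> s) \<partial>M) \<in> borel_measurable ?R"
        using Vm by measurable
      have "0 \<le> expectation (\<lambda>\<omega>. \<bar>V \<omega> s\<bar>)" for s by simp
      then show "AE s in ?R. norm (\<integral>\<omega>. norm (case (s, \<omega>) of (s, \<omega>) \<Rightarrow> V \<omega> s) \<partial>M) \<le> ?B"
        using bound by (intro AE_I2) simp
    qed
    show "AE s in ?R. integrable M (\<lambda>\<omega>. case (s, \<omega>) of (s, \<omega>) \<Rightarrow> V \<omega> s)" using Vi by simp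
  qed
  have path: "(\<integral>s. V \<omega> s \<partial>?R) = integral {0..t} (\<lambda>s. K (t - s) * Z s \<omega>)" if \<omega>: "\<omega> \<in> space M" for \<omega>
  proof -
    have "(\<integral>s. V \<omega> s \<partial>?R) = integral {0..t} (\<lambda>s. K (t - s) * V \<omega> s)"
    proof (rule kernel_measure_integral[OF t(1)])
      show "V \<omega> \<in> borel_measurable lebesgue"
        using borel_measurable_continuous_onI[OF Vc[OF \<omega>]] by (intro measurable_completion) simp
      show "continuous_on {0..t} (V \<omega>)" using Vc[OF \<omega>] by (rule continuous_on_subset) simp
    qed
    also have "\<dots> = integral {0..t} (\<lambda>s. K (t - s) * Z s \<omega>)"
      using t by (intro Henstock_Kurzweil_Integration.integral_cong) (auto simp: V_def)
    finally show ?thesis .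
  qed
  have "integrable M (\<lambda>\<omega>. \<integral>s. V \<omega> s \<partial>?R)" using pair.integrable_snd[OF int] by simp
  then show "integrable M (\<lambda>\<omega>. integral {0..t} (\<lambda>s. K (t - s) * Z s \<omega>))"
    by (simp add: path cong: Bochner_Integration.integrable_cong)
  have "expectation (\<lambda>\<omega>. integral {0..t} (\<lambda>s. K (t - s) * Z s \<omega>)) = expectation (\<lambda>\<omega>. \<integral>s. V \<omega> s \<partial>?R)"
    by (intro Bochner_Integration.integral_cong refl) (simp add: path)
  also have "\<dots> = (\<integral>s. expectation (\<lambda>\<omega>. V \<omega> s) \<partial>?R)"
    using pair.Fubini_integral[of "\<lambda>s \<omega>. V \<omega> s"] int by simp
  also have "\<dots> = 0"
  proof -
    have "expectation (\<lambda>\<omega>. V \<omega> s) = 0" for s unfolding V_def using clip[of s] by (intro Z_mean) auto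
    then show ?thesis by simp
  qed
  finally show "expectation (\<lambda>\<omega>. integral {0..t} (\<lambda>s. K (t - s) * Z s \<omega>)) = 0" .
qed

text \<open>On the last \<open>d\<close> units of time the solution is at least \<open>X (t - d)\<close>, by monotonicity.\<close>

lemma solution_upper:
  assumes "0 \<le> d" "d \<le> t" "t \<le> T"
  shows "AE \<omega> in M. X t \<omega> + lam * (mass d * X (t - d) \<omega>) \<le> G0 t + nu * integral {0..t} (\<lambda>s. K (t - s) * Z s \<omega>)"
  using equation AE_space
proof eventually_elim
  case (elim \<omega>)
  have t: "0 \<le> t" using assms by simp
  have cZ: "continuous_on {0..t} (\<lambda>s. Z s \<omega>)" using Z_cont[OF elim(2)] by (rule continuous_on_subset) (use assms in auto)
  have cX: "continuous_on {0..t} (\<lambda>s. X s \<omega>)" using X_path(3)[OF elim(2)] by (rule continuous_on_subset) (use assms in auto)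
  have iZ: "(\<lambda>s. K (t - s) * Z s \<omega>) integrable_on {0..t}" and iX: "(\<lambda>s. K (t - s) * X s \<omega>) integrable_on {0..t}"
    using convolution_abs[OF t cZ] convolution_abs[OF t cX] by (auto simp: absolutely_integrable_on_def)
  have "X t \<omega> = G0 t + integral {0..t} (\<lambda>s. nu * (K (t - s) * Z s \<omega>) - lam * (K (t - s) * X s \<omega>))"
    using elim(1) assms t by (simp add: algebra_simps)
  also have "integral {0..t} (\<lambda>s. nu * (K (t - s) * Z s \<omega>) - lam * (K (t - s) * X s \<omega>)) =
     nu * integral {0..t} (\<lambda>s. K (t - s) * Z s \<omega>) - lam * integral {0..t} (\<lambda>s. K (t - s) * X s \<omega>)"
    using iZ iX by (subst Henstock_Kurzweil_Integration.integral_diff) (auto intro: integrable_on_mult_right)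
  finally have eq: "X t \<omega> = G0 t + (nu * integral {0..t} (\<lambda>s. K (t - s) * Z s \<omega>) - lam * integral {0..t} (\<lambda>s. K (t - s) * X s \<omega>))" .
  have "X (t - d) \<omega> * mass d - 0 * (mass t - mass d) \<le> integral {0..t} (\<lambda>s. K (t - s) * X s \<omega>)"
    by (rule convolution_lower[OF assms(1,2) cX]) (use X_le[OF elim(2)] X_nonneg[OF elim(2)] assms in auto)
  then have "lam * (mass d * X (t - d) \<omega>) \<le> lam * integral {0..t} (\<lambda>s. K (t - s) * X s \<omega>)"
    using lam by (intro mult_left_mono) (auto simp: mult.commute)
  then show ?case using eq by linarith
qed

text \<open>The solution is non-negative and lies below the right-hand side of \<open>solution_upper\<close>,
  which is integrable.\<close>

lemma X_integrable:
  assumes "0 \<le> t" "t \<le> T" shows "integrable M (X t)"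
proof (rule Bochner_Integration.integrable_bound)
  let ?I = "\<lambda>\<omega>. integral {0..t} (\<lambda>s. K (t - s) * Z s \<omega>)"
  show "integrable M (\<lambda>\<omega>. G0 t + nu * ?I \<omega>)"
    using martingale_convolution(1)[OF assms] by (intro Bochner_Integration.integrable_add integrable_mult_right) auto
  show "AE \<omega> in M. norm (X t \<omega>) \<le> norm (G0 t + nu * ?I \<omega>)"
    using solution_upper[OF order_refl assms] AE_space
  proof eventually_elim
    case (elim \<omega>)
    have "0 \<le> X t \<omega>" by (rule X_nonneg[OF elim(2) assms])
    moreover have "0 \<le> lam * (mass 0 * X t \<omega>)" using lam mass_nonneg \<open>0 \<le> X t \<omega>\<close> by simp
    ultimately show ?case using elim(1) unfolding diff_zero real_norm_def by linarith
  qed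
qed (use assms in measurable)

lemma solution_mean:
  assumes "0 \<le> d" "d \<le> t" "t \<le> T"
  shows "expectation (X t) + lam * (mass d * expectation (X (t - d))) \<le> G0 t"
proof -
  let ?I = "\<lambda>\<omega>. integral {0..t} (\<lambda>s. K (t - s) * Z s \<omega>)"
  have t: "0 \<le> t" using assms by simp
  note I = martingale_convolution[OF t assms(3)]
  have iX: "integrable M (X t)" "integrable M (X (t - d))" using X_integrable assms t by auto
  have "expectation (X t) + lam * (mass d * expectation (X (t - d))) = expectation (\<lambda>\<omega>. X t \<omega> + lam * (mass d * X (t - d) \<omega>))"
    using iX by simp
  also have "\<dots> \<le> expectation (\<lambda>\<omega>. G0 t + nu * ?I \<omega>)"
    by (rule integral_mono_AE) (use iX I solution_upper[OF assms] in auto)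
  also have "\<dots> = G0 t" using I by (simp add: prob_space)
  finally show ?thesis .
qed

end

section \<open>Limits of clocks, kernels and passage paths\<close>

lemma locally_uniform_limitD:
  assumes "locally_uniform_limit fn f" "0 \<le> x" "0 < e"
  obtains d n0 where "0 < d" "\<And>n s r. n0 \<le> n \<Longrightarrow> 0 \<le> s \<Longrightarrow> 0 \<le> r \<Longrightarrow> \<bar>s - x\<bar> \<le> d \<Longrightarrow> \<bar>r - x\<bar> \<le> d \<Longrightarrow> \<bar>fn n s - f r\<bar> < e"
proof -
  let ?I = "\<lambda>\<delta>. {x-\<delta>..x+\<delta>} \<inter> {0::real..}"
  let ?S = "\<lambda>\<delta> n. SUP (s, r) \<in> ?I \<delta> \<times> ?I \<delta>. ereal \<bar>fn n s - f r\<bar>"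
  have "((\<lambda>\<delta>. limsup (?S \<delta>)) \<longlongrightarrow> 0) (at_right 0)"
    using assms unfolding locally_uniform_limit_def by blast
  then have "\<forall>\<^sub>F \<delta> in at_right 0. limsup (?S \<delta>) < ereal e"
    by (rule order_tendstoD) (use assms in simp)
  moreover have "\<forall>\<^sub>F \<delta> in at_right (0::real). 0 < \<delta>" by (rule eventually_at_right_less)
  ultimately have "\<forall>\<^sub>F \<delta> in at_right (0::real). 0 < \<delta> \<and> limsup (?S \<delta>) < ereal e" by eventually_elim simp
  then obtain \<delta> where d: "0 < \<delta>" "limsup (?S \<delta>) < ereal e"
    using eventually_happens[of _ "at_right (0::real)"] trivial_limit_at_right_real by blast
  then have "\<forall>\<^sub>F n in sequentially. ?S \<delta> n < ereal e" by (intro Limsup_lessD)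
  then obtain n0 where n0: "\<And>n. n0 \<le> n \<Longrightarrow> ?S \<delta> n < ereal e" by (auto simp: eventually_sequentially)
  show ?thesis
  proof (rule that[OF d(1)])
    fix n s r assume a: "n0 \<le> n" "0 \<le> s" "0 \<le> r" "\<bar>s - x\<bar> \<le> \<delta>" "\<bar>r - x\<bar> \<le> \<delta>"
    have "(s, r) \<in> ?I \<delta> \<times> ?I \<delta>" using a by (auto simp: abs_le_iff)
    then have "(case (s, r) of (s, r) \<Rightarrow> ereal \<bar>fn n s - f r\<bar>) \<le> ?S \<delta> n" by (rule SUP_upper)
    then have "(case (s, r) of (s, r) \<Rightarrow> ereal \<bar>fn n s - f r\<bar>) < ereal e" using n0[OF a(1)] by (rule le_less_trans)
    then show "\<bar>fn n s - f r\<bar> < e" by simp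
  qed
qed

lemma locally_uniform_limit_pointwise:
  assumes "locally_uniform_limit fn f" "0 \<le> x" shows "(\<lambda>n. fn n x) \<longlonglongrightarrow> f x"
proof (rule LIMSEQ_I)
  fix e :: real assume "0 < e"
  then obtain d n0 where "0 < d" "\<And>n s r. n0 \<le> n \<Longrightarrow> 0 \<le> s \<Longrightarrow> 0 \<le> r \<Longrightarrow> \<bar>s - x\<bar> \<le> d \<Longrightarrow> \<bar>r - x\<bar> \<le> d \<Longrightarrow> \<bar>fn n s - f r\<bar> < e"
    using locally_uniform_limitD[OF assms] by metis
  then show "\<exists>n0. \<forall>n\<ge>n0. norm (fn n x - f x) < e" using assms(2) by (intro exI[of _ n0]) auto
qed

text \<open>Two values of \<open>f\<close> near \<open>x\<close> are both close to one and the same value of some \<open>fn n\<close>.\<close>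

lemma locally_uniform_limit_continuous:
  assumes "locally_uniform_limit fn f" shows "continuous_on {0..} f"
  unfolding continuous_on_iff
proof (intro ballI allI impI)
  fix x e :: real assume x: "x \<in> {0..}" and "0 < e"
  then have e: "0 < e / 2" by simp
  obtain d n0 where d: "0 < d" "\<And>n s r. n0 \<le> n \<Longrightarrow> 0 \<le> s \<Longrightarrow> 0 \<le> r \<Longrightarrow> \<bar>s - x\<bar> \<le> d \<Longrightarrow> \<bar>r - x\<bar> \<le> d \<Longrightarrow> \<bar>fn n s - f r\<bar> < e / 2"
    using locally_uniform_limitD[OF assms _ e, of x] x by (metis atLeast_iff)
  have "dist (f r) (f x) < e" if "r \<in> {0..}" "dist r x < d" for r
  proof -
    have "\<bar>fn n0 x - f r\<bar> < e / 2" "\<bar>fn n0 x - f x\<bar> < e / 2"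
      using d that x by (auto simp: dist_real_def)
    then show ?thesis unfolding dist_real_def by linarith
  qed
  then show "\<exists>d>0. \<forall>r\<in>{0..}. dist r x < d \<longrightarrow> dist (f r) (f x) < e" using d(1) by blast
qed

lemma locally_uniform_limit_uniform:
  assumes "locally_uniform_limit fn f" "0 < e"
  shows "\<forall>\<^sub>F n in sequentially. \<forall>s\<in>{0..A}. \<bar>fn n s - f s\<bar> < e"
proof -
  have "\<forall>x\<in>{0..A}. \<exists>d n0. 0 < d \<and> (\<forall>n\<ge>n0. \<forall>s\<ge>0. \<bar>s - x\<bar> \<le> d \<longrightarrow> \<bar>fn n s - f s\<bar> < e)"
  proof
    fix x assume "x \<in> {0..A}"
    then obtain d n0 where "0 < d" "\<And>n s r. n0 \<le> n \<Longrightarrow> 0 \<le> s \<Longrightarrow> 0 \<le> r \<Longrightarrow> \<bar>s - x\<bar> \<le> d \<Longrightarrow> \<bar>r - x\<bar> \<le> d \<Longrightarrow> \<bar>fn n s - f r\<bar> < e"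
      using locally_uniform_limitD[OF assms(1) _ assms(2), of x] by (metis atLeastAtMost_iff)
    then show "\<exists>d n0. 0 < d \<and> (\<forall>n\<ge>n0. \<forall>s\<ge>0. \<bar>s - x\<bar> \<le> d \<longrightarrow> \<bar>fn n s - f s\<bar> < e)" by blast
  qed
  then obtain d n0 where d: "\<And>x. x \<in> {0..A} \<Longrightarrow> 0 < d x"
    "\<And>x n s. x \<in> {0..A} \<Longrightarrow> n0 x \<le> n \<Longrightarrow> 0 \<le> s \<Longrightarrow> \<bar>s - x\<bar> \<le> d x \<Longrightarrow> \<bar>fn n s - f s\<bar> < e" by metis
  have "{0..A} \<subseteq> (\<Union>x\<in>{0..A}. ball x (d x))" using d(1) by force
  then obtain D where D: "D \<subseteq> {0..A}" "finite D" "{0..A} \<subseteq> (\<Union>x\<in>D. ball x (d x))"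
    using compactE_image[OF compact_Icc, of "{0..A}" "\<lambda>x. ball x (d x)"] by (metis open_ball)
  have "\<forall>\<^sub>F n in sequentially. \<forall>x\<in>D. n0 x \<le> n"
    using D(2) by (intro eventually_ball_finite) (auto simp: eventually_ge_at_top)
  then show ?thesis
  proof eventually_elim
    case (elim n)
    show ?case
    proof
      fix s assume s: "s \<in> {0..A}"
      then obtain x where "x \<in> D" "s \<in> ball x (d x)" using D(3) by blast
      then show "\<bar>fn n s - f s\<bar> < e"
        using d(2)[of x n s] elim s D(1) by (auto simp: dist_real_def abs_minus_commute)
    qed
  qed
qed

text \<open>The mass of \<open>[0, d]\<close> lies between the integrals of a tent function on \<open>[0, d]\<close> and of the constant
  one, and both are continuous test functions with value one at \<open>0\<close>.\<close>

lemma kernel_mass_tendsto: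
  fixes K :: "nat \<Rightarrow> real \<Rightarrow> real"
  assumes T: "0 < T" and K: "\<And>n. kernel (K n)"
    and w: "weakly_converges (top_of_set {0..T}) (\<lambda>n. density (restrict_space lebesgue {0..T}) (\<lambda>t. ennreal (K n t)))
       (return (restrict_space borel {0..T}) 0)"
    and d: "0 < d" "d \<le> T"
  shows "(\<lambda>n. kernel.mass (K n) d) \<longlonglongrightarrow> 1"
proof -
  have test: "(\<lambda>n. integral {0..T} (\<lambda>s. K n s * h s)) \<longlonglongrightarrow> h 0" if h: "continuous_on {0..T} h" for h :: "real \<Rightarrow> real"
  proof -
    have "continuous_map (top_of_set {0..T}) euclideanreal h" using h by simp
    moreover have bh: "bounded (h ` {0..T})" by (intro compact_imp_bounded compact_continuous_image h) simp
    ultimately have "(\<lambda>n. \<integral>x. h x \<partial>density (restrict_space lebesgue {0..T}) (\<lambda>t. ennreal (K n t))) \<longlonglongrightarrow>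
        (\<integral>x. h x \<partial>return (restrict_space borel {0..T}) 0)"
      using w unfolding weakly_converges_def by simp
    moreover have "(\<integral>x. h x \<partial>return (restrict_space borel {0..T}) 0) = h 0"
      by (rule integral_return) (use T h in \<open>auto simp: space_restrict_space intro: borel_measurable_continuous_on_restrict\<close>)
    moreover have "(\<integral>x. h x \<partial>density (restrict_space lebesgue {0..T}) (\<lambda>t. ennreal (K n t))) = integral {0..T} (\<lambda>s. K n s * h s)" for n
    proof -
      interpret kernel "K n" by (rule K)
      have Km: "K n \<in> borel_measurable (lebesgue_on {0..T})"
        using K_integrable[of T] T absolutely_integrable_measurable[of "{0..T}" "K n"] by simp
      have hm: "h \<in> borel_measurable (lebesgue_on {0..T})" using h by (rule continuous_imp_measurable_on_sets_lebesgue) simp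
      have "(\<integral>x. h x \<partial>density (lebesgue_on {0..T}) (\<lambda>t. ennreal (K n t))) = (\<integral>x. K n x * h x \<partial>lebesgue_on {0..T})"
      proof (rule integral_real_density[OF Km _ hm], rule AE_I2)
        fix x assume "x \<in> space (lebesgue_on {0..T})"
        then have "0 \<le> x" by (simp add: space_restrict_space)
        then show "0 \<le> K n x" by (rule K_nonneg)
      qed
      also have "\<dots> = (LINT x:{0..T}|lebesgue. K n x * h x)"
        by (simp add: integral_restrict_space set_lebesgue_integral_def)
      also have "\<dots> = integral {0..T} (\<lambda>s. K n s * h s)"
      proof (rule set_lebesgue_integral_eq_integral(2))
        have "(\<lambda>s. h s * K n s) absolutely_integrable_on {0..T}"
          by (rule absolutely_integrable_bounded_measurable_product_real[OF hm]) (use bh K_integrable[of T] T in auto)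
        then show "set_integrable lebesgue {0..T} (\<lambda>x. K n x * h x)" by (simp add: mult.commute)
      qed
      finally show ?thesis .
    qed
    ultimately show ?thesis by simp
  qed
  have upper: "(\<lambda>n. kernel.mass (K n) T) \<longlonglongrightarrow> 1"
    using test[of "\<lambda>_. 1"] K by (simp add: kernel.mass_def[OF K])
  let ?h = "\<lambda>s. max 0 (1 - s / d)"
  have hc: "continuous_on {0..T} ?h" using d by (intro continuous_intros) auto
  have lower: "(\<lambda>n. integral {0..T} (\<lambda>s. K n s * ?h s)) \<longlonglongrightarrow> 1" using test[OF hc] by simp
  show ?thesis
  proof (rule tendsto_sandwich[OF _ _ lower upper]; rule always_eventually; rule allI)
    fix n
    interpret kernel "K n" by (rule K)
    show "mass d \<le> mass T" using d by (intro mass_mono) auto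
    have "(\<lambda>s. K n s * ?h s) absolutely_integrable_on {0..T}"
    proof -
      have "(\<lambda>s. ?h s * K n s) absolutely_integrable_on {0..T}"
        by (rule absolutely_integrable_bounded_measurable_product_real[OF continuous_imp_measurable_on_sets_lebesgue[OF hc]])
          (use K_integrable[of T] T hc in \<open>auto intro!: compact_imp_bounded compact_continuous_image\<close>)
      then show ?thesis by (simp add: mult.commute)
    qed
    then have i: "(\<lambda>s. K n s * ?h s) integrable_on {0..T}" by (simp add: absolutely_integrable_on_def)
    have sub: "(\<lambda>s. K n s * ?h s) integrable_on {0..d}" "(\<lambda>s. K n s * ?h s) integrable_on {d..T}"
      by (rule integrable_on_subinterval[OF i]; use d in auto)+
    have "integral {d..T} (\<lambda>s. K n s * ?h s) = integral {d..T} (\<lambda>s. 0)"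
      by (rule Henstock_Kurzweil_Integration.integral_cong) (use d in \<open>auto simp: max_def field_simps\<close>)
    moreover have "integral {0..d} (\<lambda>s. K n s * ?h s) \<le> mass d"
      unfolding mass_def
    proof (rule integral_le[OF sub(1) K_on])
      fix s assume "s \<in> {0..d}"
      then have "?h s \<le> 1" "0 \<le> K n s" using d K_nonneg by auto
      then show "K n s * ?h s \<le> K n s" by (simp add: mult_left_le)
    qed simp
    moreover have "integral {0..T} (\<lambda>s. K n s * ?h s) = integral {0..d} (\<lambda>s. K n s * ?h s) + integral {d..T} (\<lambda>s. K n s * ?h s)"
      using Henstock_Kurzweil_Integration.integral_combine[OF _ _ i, of d] d by simp
    ultimately show "integral {0..T} (\<lambda>s. K n s * ?h s) \<le> mass d" by simp
  qed
qed

text \<open>Passage times over increasing levels are right-continuous: if \<open>h\<close> exceeds \<open>G t\<close> at \<open>u\<close>, then by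
  continuity of \<open>G\<close> it also exceeds \<open>G s\<close> at \<open>u\<close>, for \<open>s\<close> slightly larger than \<open>t\<close>.\<close>

lemma inverse_increasing_cadlag:
  fixes h G :: "real \<Rightarrow> real"
  assumes T: "0 < T" and h: "\<And>c. \<exists>u\<ge>0. c < h u" and G: "continuous_on {0..T} G" "mono_on {0..T} G"
  shows "(\<lambda>t\<in>{0..T}. Inf {u. 0 \<le> u \<and> G t < h u}) \<in> increasing_cadlag_paths T"
proof -
  let ?H = "\<lambda>c. Inf {u. 0 \<le> u \<and> c < h u}" and ?x = "\<lambda>t\<in>{0..T}. Inf {u. 0 \<le> u \<and> G t < h u}"
  have bdd: "bdd_below {u. 0 \<le> u \<and> c < h u}" for c by (rule bdd_belowI[of _ 0]) simp
  have ne: "{u. 0 \<le> u \<and> c < h u} \<noteq> {}" for c using h by blast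
  have nn: "0 \<le> ?H c" for c by (rule cInf_greatest[OF ne]) simp
  have mono: "?H c \<le> ?H c'" if "c \<le> c'" for c c'
    by (rule cInf_superset_mono[OF ne bdd]) (use that in auto)
  have xm: "mono_on {0..T} ?x"
    by (intro mono_onI) (use mono mono_onD[OF G(2)] in auto)
  have right: "(?x \<longlongrightarrow> ?x t) (at_right t)" if t: "t \<in> {0..<T}" for t
  proof (rule order_tendstoI)
    have range: "\<forall>\<^sub>F s in at_right t. s \<in> {t<..<T}" using eventually_at_right_real t by auto
    fix a
    {
      assume "a < ?x t"
      from range show "\<forall>\<^sub>F s in at_right t. a < ?x s"
      proof eventually_elim
        case (elim s)
        have "?x t \<le> ?x s" by (rule mono_onD[OF xm]) (use elim t in auto)
        then show ?case using \<open>a < ?x t\<close> by simp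
      qed
    }
    {
      assume "?x t < a"
      then have "?H (G t) < a" using t by simp
      then obtain u where u: "0 \<le> u" "G t < h u" "u < a" using cInf_lessD[OF ne] by blast
      have "(G \<longlongrightarrow> G t) (at t within {0..T})" using G(1) t by (simp add: continuous_on)
      then have "(G \<longlongrightarrow> G t) (at t within {t<..<T})" by (rule tendsto_within_subset) (use t in auto)
      moreover have "at t within {t<..<T} = at_right t" using t by (intro at_within_nhd[of _ "{..<T}"]) auto
      ultimately have "\<forall>\<^sub>F s in at_right t. G s < h u" using order_tendstoD(2)[OF _ u(2)] by metis
      with range show "\<forall>\<^sub>F s in at_right t. ?x s < a"
      proof eventually_elim
        case (elim s)
        have "?H (G s) \<le> u" by (rule cInf_lower[OF _ bdd]) (use elim u in simp)
        then show ?case using u elim t by auto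
      qed
    }
  qed
  have left: "\<exists>l. (?x \<longlongrightarrow> l) (at_left t)" if t: "t \<in> {0<..T}" for t
  proof
    have ne': "?x ` {0..<t} \<noteq> {}" using t by auto
    have bdd': "bdd_above (?x ` {0..<t})"
      by (rule bdd_aboveI2[of _ _ "?x t"]) (use mono_onD[OF xm] t in auto)
    show "(?x \<longlongrightarrow> (SUP s\<in>{0..<t}. ?x s)) (at_left t)"
    proof (rule order_tendstoI)
      fix a
      {
        assume "a < (SUP s\<in>{0..<t}. ?x s)"
        then obtain r where r: "r \<in> {0..<t}" "a < ?x r" using less_cSUP_iff[of "{0..<t}" ?x a] bdd' t by auto
        have "\<forall>\<^sub>F s in at_left t. s \<in> {r<..<t}" using eventually_at_left_real r by auto
        then show "\<forall>\<^sub>F s in at_left t. a < ?x s"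
        proof eventually_elim
          case (elim s)
          have "?x r \<le> ?x s" by (rule mono_onD[OF xm]) (use elim r t in auto)
          then show ?case using r by simp
        qed
      }
      {
        assume a: "(SUP s\<in>{0..<t}. ?x s) < a"
        have "\<forall>\<^sub>F s in at_left t. s \<in> {0<..<t}" using eventually_at_left_real t by auto
        then show "\<forall>\<^sub>F s in at_left t. ?x s < a"
        proof eventually_elim
          case (elim s)
          have "?x s \<le> (SUP s\<in>{0..<t}. ?x s)" by (rule cSUP_upper[OF _ bdd']) (use elim in auto)
          then show ?case using a by simp
        qed
      }
    qed
  qed
  show ?thesis
    unfolding increasing_cadlag_paths_def cadlag_paths_def
    using right left xm nn by simp
qed

section \<open>A lower bound for the solutions, path by path\<close>

lemma exceed_event_measurable:
  fixes \<phi> :: "(real \<Rightarrow> real) \<Rightarrow> real \<Rightarrow> real"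
  assumes m: "\<And>s. s \<in> {0..A} \<Longrightarrow> (\<lambda>w. \<phi> w s) \<in> borel_measurable path_sigma"
    and c: "\<And>w. w \<in> continuous_paths \<Longrightarrow> continuous_on {0..A} (\<phi> w)"
  shows "{w \<in> continuous_paths. \<exists>s\<in>{0..A}. e < \<bar>\<phi> w s\<bar>} \<in> sets path_sigma"
proof -
  obtain D where D: "countable D" "D \<subseteq> {0..A}" "{0..A} \<subseteq> closure D" using separable[of "{0..A}"] by metis
  have cl: "closure D \<subseteq> {0..A}" by (rule closure_minimal[OF D(2)]) simp
  have "(\<exists>s\<in>{0..A}. e < \<bar>\<phi> w s\<bar>) \<longleftrightarrow> (\<exists>s\<in>D. e < \<bar>\<phi> w s\<bar>)" if w: "w \<in> continuous_paths" for w
  proof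
    assume ex: "\<exists>s\<in>{0..A}. e < \<bar>\<phi> w s\<bar>"
    show "\<exists>s\<in>D. e < \<bar>\<phi> w s\<bar>"
    proof (rule ccontr)
      assume "\<not> (\<exists>s\<in>D. e < \<bar>\<phi> w s\<bar>)"
      then have le: "\<forall>s\<in>D. \<bar>\<phi> w s\<bar> \<le> e" by (simp add: not_less)
      have "continuous_on (closure D) (\<lambda>s. \<bar>\<phi> w s\<bar>)"
        by (intro continuous_intros continuous_on_subset[OF c[OF w] cl])
      then have "\<bar>\<phi> w s\<bar> \<le> e" if "s \<in> {0..A}" for s
        using continuous_le_on_closure[of D "\<lambda>s. \<bar>\<phi> w s\<bar>" s e] le that D(3) by auto
      then show False using ex by force
    qed
  qed (use D(2) in auto)
  then have "{w \<in> continuous_paths. \<exists>s\<in>{0..A}. e < \<bar>\<phi> w s\<bar>} = {w \<in> space path_sigma. \<exists>s\<in>D. e < \<bar>\<phi> w s\<bar>}"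
    by auto
  also have "\<dots> \<in> sets path_sigma"
  proof (rule sets.sets_Collect_countable_Ex'[OF _ D(1)])
    fix s assume "s \<in> D"
    then have [measurable]: "(\<lambda>w. \<phi> w s) \<in> borel_measurable path_sigma" using m D(2) by auto
    show "{w \<in> space path_sigma. e < \<bar>\<phi> w s\<bar>} \<in> sets path_sigma" by measurable
  qed
  finally show ?thesis .
qed

text \<open>The setting of the limit theorem, with the weak convergence of the kernels replaced by the
  convergence of their masses near \<open>0\<close>, and with the uniform growth of the clocks made explicit.\<close>

locale volterra_limit =
  fixes T :: real
    and lam nu :: "nat \<Rightarrow> real" and lam' nu' :: real
    and f K G0 :: "nat \<Rightarrow> real \<Rightarrow> real" and f' G' :: "real \<Rightarrow> real"
    and M :: "nat \<Rightarrow> 'a measure" and W X :: "nat \<Rightarrow> real \<Rightarrow> 'a \<Rightarrow> real"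
    and N :: "'b measure" and B :: "real \<Rightarrow> 'b \<Rightarrow> real" and C :: real
  assumes T: "0 < T"
    and solution: "\<And>n. volterra_solution (K n) T (G0 n) (f n) (lam n) (nu n) (M n) (W n) (X n)"
    and G0_mono: "\<And>n. mono_on {0..} (G0 n)" and G0_0: "\<And>n. G0 n 0 = 0"
    and mass_tendsto: "\<And>d. 0 < d \<Longrightarrow> d \<le> T \<Longrightarrow> (\<lambda>n. kernel.mass (K n) d) \<longlonglongrightarrow> 1"
    and G0_tendsto: "\<And>t. t \<in> {0..T} \<Longrightarrow> (\<lambda>n. G0 n t) \<longlonglongrightarrow> G' t"
    and G'_cont: "continuous_on {0..T} G'"
    and f_limit: "locally_uniform_limit f f'"
    and growth: "\<And>n x. 0 \<le> x \<Longrightarrow> f n x \<le> C * (1 + x\<^sup>2)"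
    and lam_tendsto: "lam \<longlonglongrightarrow> lam'" and nu_tendsto: "nu \<longlonglongrightarrow> nu'"
    and brownian_B: "brownian_motion_wrt N (natural_filtration N B) B"
begin

lemma lam_nonneg: "0 \<le> lam n" and nu_nonneg: "0 \<le> nu n"
  using volterra_solution.lam[OF solution] volterra_solution.nu[OF solution] by auto

lemma lam'_nonneg: "0 \<le> lam'" and nu'_nonneg: "0 \<le> nu'"
  by (rule LIMSEQ_le_const[OF lam_tendsto] LIMSEQ_le_const[OF nu_tendsto]; use lam_nonneg nu_nonneg in blast)+

lemma f_cont: "continuous_on {0..} (f n)" and f_mono: "mono_on {0..} (f n)" and f_0: "f n 0 = 0"
  using volterra_solution.f_cont[OF solution] volterra_solution.f_mono[OF solution] volterra_solution.f_0[OF solution] by auto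

lemma f'_cont: "continuous_on {0..} f'"
  by (rule locally_uniform_limit_continuous[OF f_limit])

lemma f'_mono: "mono_on {0..} f'"
proof (rule mono_onI)
  fix x y :: real assume "x \<in> {0..}" "y \<in> {0..}" "x \<le> y"
  then show "f' x \<le> f' y"
    by (intro LIMSEQ_le[OF locally_uniform_limit_pointwise[OF f_limit] locally_uniform_limit_pointwise[OF f_limit]])
      (auto intro!: exI[of _ 0] mono_onD[OF f_mono])
qed

lemma f'_0: "f' 0 = 0"
  using LIMSEQ_unique[OF locally_uniform_limit_pointwise[OF f_limit, of 0]] f_0 by simp

lemma f'_growth: "0 \<le> x \<Longrightarrow> f' x \<le> C * (1 + x\<^sup>2)"
  by (rule LIMSEQ_le_const2[OF locally_uniform_limit_pointwise[OF f_limit]]) (use growth in auto)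

lemma f_nonneg: "0 \<le> x \<Longrightarrow> 0 \<le> f n x"
  by (rule volterra_solution.f_nonneg[OF solution])

lemma f'_nonneg: "0 \<le> x \<Longrightarrow> 0 \<le> f' x"
  using mono_onD[OF f'_mono, of 0 x] f'_0 by simp

lemma G'_0: "G' 0 = 0"
  using LIMSEQ_unique[OF G0_tendsto[of 0]] G0_0 T by simp

lemma G'_mono: "mono_on {0..T} G'"
proof (rule mono_onI)
  fix x y assume "x \<in> {0..T}" "y \<in> {0..T}" "x \<le> y"
  then show "G' x \<le> G' y"
    by (intro LIMSEQ_le[OF G0_tendsto G0_tendsto]) (auto intro!: exI[of _ 0] mono_onD[OF G0_mono])
qed

lemma G'_nonneg: "t \<in> {0..T} \<Longrightarrow> 0 \<le> G' t"
  using mono_onD[OF G'_mono, of 0 t] G'_0 T by auto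

text \<open>From here on the driving path is the argument \<open>w\<close> of deterministic functionals, so that one law, that
  of a Brownian path, governs the comparison for every \<open>n\<close>.\<close>

definition drift_path :: "(real \<Rightarrow> real) \<Rightarrow> real \<Rightarrow> real" where
  "drift_path w s = nu' * w (f' s) - lam' * s"

definition drift_path_n :: "nat \<Rightarrow> (real \<Rightarrow> real) \<Rightarrow> real \<Rightarrow> real" where
  "drift_path_n n w s = nu n * w (f n s) - lam n * s"

text \<open>The passage time of \<open>(1 + lam') * u - nu' * w (f' u)\<close> over \<open>c\<close>, written with the forcing that is
  subtracted from \<open>u\<close>.\<close>

definition pass :: "real \<Rightarrow> (real \<Rightarrow> real) \<Rightarrow> real" where
  "pass c w = Inf {u. 0 \<le> u \<and> c < u - drift_path w u}"

lemma drift_path_cont: "w \<in> continuous_paths \<Longrightarrow> continuous_on {0..} (drift_path w)"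
  unfolding drift_path_def continuous_paths_def
  by (intro continuous_intros continuous_on_compose2[OF _ f'_cont, of "{0..}"]) (auto intro: f'_nonneg)

lemma drift_path_n_cont: "w \<in> continuous_paths \<Longrightarrow> continuous_on {0..} (drift_path_n n w)"
  unfolding drift_path_n_def continuous_paths_def
  by (intro continuous_intros continuous_on_compose2[OF _ f_cont, of "{0..}"]) (auto intro: f_nonneg)

lemma drift_path_measurable: "0 \<le> s \<Longrightarrow> (\<lambda>w. drift_path w s) \<in> borel_measurable path_sigma"
  unfolding drift_path_def using path_sigma_eval[OF f'_nonneg] by measurable

lemma drift_path_n_measurable: "0 \<le> s \<Longrightarrow> (\<lambda>w. drift_path_n n w s) \<in> borel_measurable path_sigma"
  unfolding drift_path_n_def using path_sigma_eval[OF f_nonneg] by measurable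

text \<open>Passing over \<open>c\<close> before \<open>a\<close> is an open condition, so it can be tested at rational times. The second
  disjunct takes care of paths that never pass, for which \<open>pass\<close> is the infimum of the empty set.\<close>

lemma pass_measurable [measurable]: "pass c \<in> borel_measurable path_sigma"
  unfolding borel_measurable_iff_less
proof
  fix a
  let ?g = "\<lambda>w u. u - drift_path w u"
  have rat: "(\<exists>u. 0 \<le> u \<and> u < b \<and> c < ?g w u) \<longleftrightarrow> (\<exists>q\<in>\<rat> \<inter> {0..}. q < b \<and> c < ?g w q)"
    if w: "w \<in> continuous_paths" for w b
  proof
    assume "\<exists>u. 0 \<le> u \<and> u < b \<and> c < ?g w u"
    then obtain u where u: "0 \<le> u" "u < b" "c < ?g w u" by blast
    have "continuous_on {0..} (?g w)" using drift_path_cont[OF w] by (intro continuous_intros)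
    moreover have "0 < ?g w u - c" using u by simp
    ultimately obtain d where d: "0 < d" "\<And>v. 0 \<le> v \<Longrightarrow> \<bar>v - u\<bar> < d \<Longrightarrow> \<bar>?g w v - ?g w u\<bar> < ?g w u - c"
      using u(1) unfolding continuous_on_iff dist_real_def by (metis atLeast_iff)
    obtain q where q: "q \<in> \<rat>" "u < q" "q < min b (u + d)"
      using Rats_dense_in_real[of u "min b (u + d)"] u d(1) by auto
    have "\<bar>?g w q - ?g w u\<bar> < ?g w u - c" using q u by (intro d(2)) auto
    then have "c < ?g w q" by linarith
    then show "\<exists>q\<in>\<rat> \<inter> {0..}. q < b \<and> c < ?g w q" using q u by (intro bexI[of _ q]) auto
  qed auto
  have bdd: "bdd_below {u. 0 \<le> u \<and> c < ?g w u}" for w by (rule bdd_belowI[of _ 0]) simp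
  have eq: "pass c w < a \<longleftrightarrow> (\<exists>q\<in>\<rat> \<inter> {0..}. q < a \<and> c < ?g w q) \<or>
      (\<not> (\<exists>q\<in>\<rat> \<inter> {0..}. c < ?g w q) \<and> Inf ({} :: real set) < a)" if w: "w \<in> continuous_paths" for w
  proof (cases "{u. 0 \<le> u \<and> c < ?g w u} = {}")
    case True
    then have "\<And>u. 0 \<le> u \<Longrightarrow> \<not> c < ?g w u" by blast
    then show ?thesis unfolding pass_def True by auto
  next
    case False
    then obtain u where u: "0 \<le> u" "c < ?g w u" by blast
    then have "\<exists>q\<in>\<rat> \<inter> {0..}. c < ?g w q" using rat[OF w, of "u + 1"] by auto
    then show ?thesis unfolding pass_def cInf_less_iff[OF False bdd] using rat[OF w, of a] by auto
  qed
  have Q: "countable (\<rat> \<inter> {0::real..})" using countable_rat by blast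
  have ev: "{w \<in> space path_sigma. c < ?g w q} \<in> sets path_sigma" if "q \<in> \<rat> \<inter> {0..}" for q
  proof -
    have [measurable]: "(\<lambda>w. drift_path w q) \<in> borel_measurable path_sigma" using that by (intro drift_path_measurable) auto
    show ?thesis by measurable
  qed
  have "{w \<in> space path_sigma. pass c w < a} = {w \<in> space path_sigma. (\<exists>q\<in>\<rat> \<inter> {0..}. q < a \<and> c < ?g w q) \<or>
      (\<not> (\<exists>q\<in>\<rat> \<inter> {0..}. c < ?g w q) \<and> Inf ({} :: real set) < a)}"
    using eq by auto
  also have "\<dots> \<in> sets path_sigma"
    by (intro sets.sets_Collect_disj sets.sets_Collect_conj sets.sets_Collect_neg sets.sets_Collect_const
        sets.sets_Collect_countable_Ex'[OF _ Q] ev)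
  finally show "{w \<in> space path_sigma. pass c w < a} \<in> sets path_sigma" .
qed

lemma pass_nonneg_le:
  assumes "0 \<le> u" "c < u - drift_path w u" shows "pass c w \<le> u"
  unfolding pass_def by (rule cInf_lower) (use assms in \<open>auto intro!: bdd_belowI[of _ 0]\<close>)

text \<open>The paths that pass over every level; Brownian paths are almost surely of this kind.\<close>

definition good :: "(real \<Rightarrow> real) set" where
  "good = {w \<in> continuous_paths. \<forall>c. \<exists>u\<ge>0. c < u - drift_path w u}"

lemma pass_nonneg: "w \<in> good \<Longrightarrow> 0 \<le> pass c w"
  unfolding pass_def by (rule cInf_greatest) (auto simp: good_def)

lemma pass_mono: "w \<in> good \<Longrightarrow> c \<le> c' \<Longrightarrow> pass c w \<le> pass c' w"
  unfolding pass_def by (rule cInf_superset_mono) (auto simp: good_def intro!: bdd_belowI[of _ 0])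

lemma good_sets: "good \<in> sets path_sigma"
proof -
  have "{w \<in> continuous_paths. \<exists>u\<ge>0. c < u - drift_path w u} = (\<Union>A::nat. {w \<in> continuous_paths. \<exists>u\<in>{0..real A}. 0 < \<bar>max 0 (u - drift_path w u - c)\<bar>})" for c
  proof (intro set_eqI iffI)
    fix w assume "w \<in> {w \<in> continuous_paths. \<exists>u\<ge>0. c < u - drift_path w u}"
    then obtain u where "w \<in> continuous_paths" "0 \<le> u" "c < u - drift_path w u" by blast
    moreover obtain A :: nat where "u \<le> real A" using real_arch_simple by blast
    ultimately show "w \<in> (\<Union>A::nat. {w \<in> continuous_paths. \<exists>u\<in>{0..real A}. 0 < \<bar>max 0 (u - drift_path w u - c)\<bar>})"
      by (intro UN_I[of A] CollectI conjI bexI[of _ u]) auto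
  next
    fix w assume "w \<in> (\<Union>A::nat. {w \<in> continuous_paths. \<exists>u\<in>{0..real A}. 0 < \<bar>max 0 (u - drift_path w u - c)\<bar>})"
    then obtain u where "w \<in> continuous_paths" "0 \<le> u" "0 < \<bar>max 0 (u - drift_path w u - c)\<bar>" by auto
    then show "w \<in> {w \<in> continuous_paths. \<exists>u\<ge>0. c < u - drift_path w u}"
      by (intro CollectI conjI exI[of _ u]) (auto simp: max_def split: if_splits)
  qed
  moreover have "{w \<in> continuous_paths. \<exists>u\<in>{0..real A}. 0 < \<bar>max 0 (u - drift_path w u - c)\<bar>} \<in> sets path_sigma" for A c
  proof (rule exceed_event_measurable)
    fix s assume "s \<in> {0..real A}"
    then have [measurable]: "(\<lambda>w. drift_path w s) \<in> borel_measurable path_sigma" by (intro drift_path_measurable) auto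
    show "(\<lambda>w. max 0 (s - drift_path w s - c)) \<in> borel_measurable path_sigma" by measurable
  next
    fix w assume "w \<in> continuous_paths"
    then show "continuous_on {0..real A} (\<lambda>u. max 0 (u - drift_path w u - c))"
      by (intro continuous_intros continuous_on_subset[OF drift_path_cont]) auto
  qed
  ultimately have ev: "{w \<in> continuous_paths. \<exists>u\<ge>0. c < u - drift_path w u} \<in> sets path_sigma" for c
    by (simp add: sets.countable_UN)
  have "good = (\<Inter>m::nat. {w \<in> continuous_paths. \<exists>u\<ge>0. real m < u - drift_path w u})"
  proof (intro set_eqI iffI)
    fix w assume w: "w \<in> (\<Inter>m::nat. {w \<in> continuous_paths. \<exists>u\<ge>0. real m < u - drift_path w u})"
    have "\<exists>u\<ge>0. c < u - drift_path w u" for c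
    proof -
      obtain m :: nat where m: "c \<le> real m" using real_arch_simple by blast
      obtain u where "0 \<le> u" "real m < u - drift_path w u" using w by blast
      then show ?thesis using m by (intro exI[of _ u]) auto
    qed
    then show "w \<in> good" using w by (auto simp: good_def)
  qed (auto simp: good_def)
  then show ?thesis using ev by (simp add: sets.countable_INT)
qed

sublocale B: drifted_clock N "natural_filtration N B" B f' lam' nu' C
  by unfold_locales (use brownian_B f'_cont f'_mono f'_0 f'_growth lam'_nonneg nu'_nonneg in auto)

definition wiener :: "(real \<Rightarrow> real) measure" where
  "wiener = distr N path_sigma B.sample_path"

sublocale wiener: prob_space wiener
  unfolding wiener_def by (rule B.prob_space_distr[OF B.sample_path_measurable])

lemma space_wiener: "space wiener = continuous_paths" and sets_wiener: "sets wiener = sets path_sigma"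
  by (simp_all add: wiener_def)

lemma drift_B: "0 \<le> u \<Longrightarrow> u - drift_path (B.sample_path \<omega>) u = B.level \<omega> u"
  using f'_nonneg[of u] by (simp add: drift_path_def B.level_def B.sample_path_def algebra_simps)

lemma pass_B: "pass c (B.sample_path \<omega>) = B.passage c \<omega>"
proof -
  have "{u. 0 \<le> u \<and> c < u - drift_path (B.sample_path \<omega>) u} = {u. 0 \<le> u \<and> c < B.level \<omega> u}"
    using drift_B by auto
  then show ?thesis by (simp add: pass_def B.passage_def)
qed

lemma good_B: "AE \<omega> in N. B.sample_path \<omega> \<in> good"
  using B.level_unbounded AE_space
proof eventually_elim
  case (elim \<omega>)
  then show ?case using B.sample_path_continuous[of \<omega>] drift_B[of _ \<omega>] unfolding good_def by fastforce
qed

lemma good_wiener: "AE w in wiener. w \<in> good"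
proof -
  have "{w \<in> space path_sigma. w \<in> good} = good" by (auto simp: good_def)
  then show ?thesis unfolding wiener_def by (subst AE_distr_iff) (use good_B good_sets in auto)
qed

lemma pass_mean:
  assumes "0 \<le> c"
  shows "integrable wiener (pass c)" "(1 + lam') * (\<integral>w. pass c w \<partial>wiener) = c"
proof -
  have eq: "(\<lambda>\<omega>. pass c (B.sample_path \<omega>)) = B.passage c" by (simp add: pass_B fun_eq_iff)
  have m: "B.passage c \<in> borel_measurable N"
    using measurable_compose[OF B.sample_path_measurable pass_measurable[of c]] by (simp add: eq)
  show "integrable wiener (pass c)"
    unfolding wiener_def using B.passage_mean(1)[OF assms m]
    by (subst integrable_distr_eq) (auto simp: eq)
  show "(1 + lam') * (\<integral>w. pass c w \<partial>wiener) = c"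
    unfolding wiener_def using B.passage_mean(2)[OF assms m]
    by (subst integral_distr) (auto simp: eq)
qed

definition noise :: "nat \<Rightarrow> 'a \<Rightarrow> real \<Rightarrow> real" where
  "noise n = brownian.sample_path (W n)"

lemma noise_measurable [measurable]: "noise n \<in> measurable (M n) path_sigma"
proof -
  obtain F where "brownian (M n) F (W n)" using volterra_solution.brownian_ex[OF solution] by blast
  then interpret brownian "M n" F "W n" .
  show ?thesis unfolding noise_def by (rule sample_path_measurable)
qed

lemma noise_law: "distr (M n) path_sigma (noise n) = wiener"
proof -
  obtain F where F: "brownian (M n) F (W n)" using volterra_solution.brownian_ex[OF solution] by blast
  show ?thesis unfolding noise_def wiener_def by (rule brownian_law_unique[OF F B.brownian_axioms])
qed

lemma noise_eval: "0 \<le> t \<Longrightarrow> noise n \<omega> t = W n t \<omega>"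
proof -
  obtain F where "brownian (M n) F (W n)" using volterra_solution.brownian_ex[OF solution] by blast
  then interpret brownian "M n" F "W n" .
  show "0 \<le> t \<Longrightarrow> noise n \<omega> t = W n t \<omega>" by (simp add: noise_def sample_path_def)
qed

lemma noise_prob:
  assumes "S \<in> sets path_sigma"
  shows "{\<omega> \<in> space (M n). noise n \<omega> \<in> S} \<in> sets (M n)"
    "measure (M n) {\<omega> \<in> space (M n). noise n \<omega> \<in> S} = measure wiener S"
proof -
  show "{\<omega> \<in> space (M n). noise n \<omega> \<in> S} \<in> sets (M n)"
    using measurable_sets[OF noise_measurable assms, of n] by (simp add: vimage_def Int_def conj_commute)
  show "measure (M n) {\<omega> \<in> space (M n). noise n \<omega> \<in> S} = measure wiener S"
    unfolding noise_law[of n, symmetric]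
    by (subst measure_distr[OF noise_measurable assms]) (auto intro: arg_cong[where f = "measure (M n)"])
qed

lemma drift_bounded:
  assumes "0 < \<rho>"
  obtains c where "0 < c" "{w \<in> continuous_paths. \<exists>s\<in>{0..A}. c < \<bar>drift_path w s\<bar>} \<in> sets path_sigma"
    "measure wiener {w \<in> continuous_paths. \<exists>s\<in>{0..A}. c < \<bar>drift_path w s\<bar>} \<le> \<rho>"
proof -
  let ?S = "\<lambda>k::nat. {w \<in> continuous_paths. \<exists>s\<in>{0..A}. real k < \<bar>drift_path w s\<bar>}"
  have cont: "continuous_on {0..A} (drift_path w)" if "w \<in> continuous_paths" for w
    using drift_path_cont[OF that] by (rule continuous_on_subset) auto
  have S: "?S k \<in> sets path_sigma" for k
    by (rule exceed_event_measurable[OF drift_path_measurable cont]) auto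
  have dec: "decseq ?S" by (rule decseq_SucI) force
  have "(\<Inter>k. ?S k) = {}"
  proof (rule equals0I)
    fix w assume w: "w \<in> (\<Inter>k. ?S k)"
    then have "bounded (drift_path w ` {0..A})" by (intro compact_imp_bounded compact_continuous_image cont) auto
    then obtain b where b: "\<And>s. s \<in> {0..A} \<Longrightarrow> \<bar>drift_path w s\<bar> \<le> b" unfolding bounded_iff by force
    obtain k :: nat where "b \<le> real k" using real_arch_simple by blast
    moreover have "w \<in> ?S k" using w by blast
    ultimately show False using b by force
  qed
  moreover have "(\<lambda>k. measure wiener (?S k)) \<longlonglongrightarrow> measure wiener (\<Inter>k. ?S k)"
    by (rule wiener.finite_Lim_measure_decseq[OF _ dec]) (use S sets_wiener in auto)
  ultimately have "(\<lambda>k. measure wiener (?S k)) \<longlonglongrightarrow> 0" by simp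
  then have "\<forall>\<^sub>F k in sequentially. measure wiener (?S k) < \<rho>" using assms by (rule order_tendstoD(2))
  then have "\<forall>\<^sub>F k in sequentially. measure wiener (?S k) < \<rho> \<and> 0 < k"
    using eventually_gt_at_top[of 0] by eventually_elim simp
  then obtain k where "measure wiener (?S k) < \<rho>" "0 < k" by (auto simp: eventually_sequentially)
  then show ?thesis using that[of "real k"] S by simp
qed

text \<open>The clocks converge uniformly on compact intervals, and \<open>w\<close> is uniformly continuous there.\<close>

lemma drift_path_n_uniform:
  assumes w: "w \<in> continuous_paths" and e: "0 < e"
  shows "\<forall>\<^sub>F n in sequentially. \<forall>s\<in>{0..A}. \<bar>drift_path_n n w s - drift_path w s\<bar> \<le> e"
proof (cases "0 \<le> A")
  case True
  define R where "R = f' A + 1"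
  have wc: "continuous_on {0..R} w" using w by (auto simp: continuous_paths_def elim: continuous_on_subset)
  have "bounded (w ` {0..R})" by (intro compact_imp_bounded compact_continuous_image wc) auto
  then obtain b where b: "\<And>s. s \<in> {0..R} \<Longrightarrow> \<bar>w s\<bar> \<le> b" unfolding bounded_iff by force
  define e1 where "e1 = (e / 3) / (nu' + 1)"
  have e1: "0 < e1" using e nu'_nonneg by (simp add: e1_def add_nonneg_pos)
  have "uniformly_continuous_on {0..R} w" by (intro compact_uniformly_continuous wc) auto
  then obtain d where d: "0 < d" "\<And>s r. s \<in> {0..R} \<Longrightarrow> r \<in> {0..R} \<Longrightarrow> \<bar>s - r\<bar> < d \<Longrightarrow> \<bar>w s - w r\<bar> < e1"
    using e1 unfolding uniformly_continuous_on_def dist_real_def by metis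
  have "\<forall>\<^sub>F n in sequentially. \<forall>s\<in>{0..A}. \<bar>f n s - f' s\<bar> < min d 1"
    using d(1) by (intro locally_uniform_limit_uniform[OF f_limit]) simp
  moreover have "\<forall>\<^sub>F n in sequentially. nu n < nu' + 1" by (rule order_tendstoD(2)[OF nu_tendsto]) simp
  moreover have "\<forall>\<^sub>F n in sequentially. \<bar>nu n - nu'\<bar> * b < e / 3"
  proof (rule order_tendstoD(2))
    have "(\<lambda>n. \<bar>nu n - nu'\<bar> * b) \<longlonglongrightarrow> \<bar>nu' - nu'\<bar> * b" by (intro tendsto_intros nu_tendsto)
    then show "(\<lambda>n. \<bar>nu n - nu'\<bar> * b) \<longlonglongrightarrow> 0" by simp
  qed (use e in simp)
  moreover have "\<forall>\<^sub>F n in sequentially. \<bar>lam n - lam'\<bar> * A < e / 3"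
  proof (rule order_tendstoD(2))
    have "(\<lambda>n. \<bar>lam n - lam'\<bar> * A) \<longlonglongrightarrow> \<bar>lam' - lam'\<bar> * A" by (intro tendsto_intros lam_tendsto)
    then show "(\<lambda>n. \<bar>lam n - lam'\<bar> * A) \<longlonglongrightarrow> 0" by simp
  qed (use e in simp)
  ultimately show ?thesis
  proof eventually_elim
    case (elim n)
    show ?case
    proof
      fix s assume s: "s \<in> {0..A}"
      have "f' s \<le> f' A" by (rule mono_onD[OF f'_mono]) (use s in auto)
      moreover have "\<bar>f n s - f' s\<bar> < d" "\<bar>f n s - f' s\<bar> < 1" using elim(1) s by auto
      moreover have "0 \<le> f n s" "0 \<le> f' s" using f_nonneg f'_nonneg s by auto
      ultimately have r: "f n s \<in> {0..R}" "f' s \<in> {0..R}" "\<bar>f n s - f' s\<bar> < d" by (auto simp: R_def)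
      have "\<bar>w (f n s) - w (f' s)\<bar> < e1" by (rule d(2)[OF r])
      then have "nu n * \<bar>w (f n s) - w (f' s)\<bar> \<le> (nu' + 1) * e1"
        using elim(2) nu_nonneg[of n] by (intro mult_mono) auto
      moreover have "(nu' + 1) * e1 = e / 3" using nu'_nonneg unfolding e1_def by (subst nonzero_mult_div_cancel_left[symmetric, of "nu' + 1" "e / 3"]) auto
      ultimately have 1: "\<bar>nu n * (w (f n s) - w (f' s))\<bar> \<le> e / 3" using nu_nonneg[of n] by (simp add: abs_mult)
      have "\<bar>nu n - nu'\<bar> * \<bar>w (f' s)\<bar> \<le> \<bar>nu n - nu'\<bar> * b" using b[OF r(2)] by (intro mult_left_mono) auto
      then have 2: "\<bar>(nu n - nu') * w (f' s)\<bar> \<le> e / 3" using elim(3) by (simp add: abs_mult)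
      have "\<bar>lam n - lam'\<bar> * s \<le> \<bar>lam n - lam'\<bar> * A" using s by (intro mult_left_mono) auto
      then have 3: "\<bar>(lam n - lam') * s\<bar> \<le> e / 3" using elim(4) s by (simp add: abs_mult)
      have "drift_path_n n w s - drift_path w s =
         nu n * (w (f n s) - w (f' s)) + (nu n - nu') * w (f' s) - (lam n - lam') * s"
        by (simp add: drift_path_n_def drift_path_def algebra_simps)
      then show "\<bar>drift_path_n n w s - drift_path w s\<bar> \<le> e" using 1 2 3 by linarith
    qed
  qed
qed simp

lemma drift_path_n_close:
  assumes e: "0 < e"
  shows "{w \<in> continuous_paths. \<exists>s\<in>{0..A}. e < \<bar>drift_path_n n w s - drift_path w s\<bar>} \<in> sets path_sigma"
    "(\<lambda>n. measure wiener {w \<in> continuous_paths. \<exists>s\<in>{0..A}. e < \<bar>drift_path_n n w s - drift_path w s\<bar>}) \<longlonglongrightarrow> 0"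
proof -
  let ?S = "\<lambda>n. {w \<in> continuous_paths. \<exists>s\<in>{0..A}. e < \<bar>drift_path_n n w s - drift_path w s\<bar>}"
  show S: "?S n \<in> sets path_sigma" for n
  proof (rule exceed_event_measurable)
    fix s assume "s \<in> {0..A}"
    then show "(\<lambda>w. drift_path_n n w s - drift_path w s) \<in> borel_measurable path_sigma"
      by (intro borel_measurable_diff drift_path_measurable drift_path_n_measurable) auto
  next
    fix w assume "w \<in> continuous_paths"
    then show "continuous_on {0..A} (\<lambda>s. drift_path_n n w s - drift_path w s)"
      by (intro continuous_intros continuous_on_subset[OF drift_path_cont] continuous_on_subset[OF drift_path_n_cont]) auto
  qed
  have "(\<lambda>n. \<integral>w. indicator (?S n) w \<partial>wiener) \<longlonglongrightarrow> (\<integral>w. (0::real) \<partial>wiener)"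
  proof (rule integral_dominated_convergence[where w = "\<lambda>_. 1"])
    show "AE w in wiener. (\<lambda>n. indicator (?S n) w :: real) \<longlonglongrightarrow> 0"
    proof (rule AE_I2, rule tendsto_eventually)
      fix w assume "w \<in> space wiener"
      then have "\<forall>\<^sub>F n in sequentially. \<forall>s\<in>{0..A}. \<bar>drift_path_n n w s - drift_path w s\<bar> \<le> e"
        using e by (intro drift_path_n_uniform) (simp_all add: space_wiener)
      then show "\<forall>\<^sub>F n in sequentially. (indicator (?S n) w :: real) = 0"
        by eventually_elim (auto simp: indicator_def not_less)
    qed
    show "(\<lambda>w. indicator (?S n) w :: real) \<in> borel_measurable wiener" for n
      using S sets_wiener by (intro borel_measurable_indicator) auto
  qed (auto simp: indicator_def)
  moreover have "(\<integral>w. indicator (?S n) w \<partial>wiener) = measure wiener (?S n)" for n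
  proof -
    have "?S n \<inter> space wiener = ?S n" by (auto simp: space_wiener)
    then show ?thesis by simp
  qed
  ultimately show "(\<lambda>n. measure wiener (?S n)) \<longlonglongrightarrow> 0" by simp
qed

end

context volterra_limit
begin

text \<open>Choose a window \<open>[r - d, r]\<close> near \<open>t\<close> in which \<open>x\<close> gains at most \<open>\<epsilon>\<close>, and let \<open>z\<close> be the place between
  \<open>x (r - d)\<close> and \<open>x r\<close> where the forcing is smallest. The convolution at \<open>r\<close> is at least this smallest
  value, up to errors from the mass of the kernel outside \<open>[0, d]\<close>. So the equation gives
  \<open>x r \<ge> G' t + drift_path w z\<close> up to multiples of \<open>\<epsilon>\<close>, and as \<open>z\<close> is within \<open>\<epsilon>\<close> of \<open>x r\<close> the level
  at \<open>z\<close> exceeds \<open>c\<close>: the passage over \<open>c\<close> happens no later than \<open>z \<le> x r \<le> x t\<close>.\<close>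

lemma passage_below_solution:
  fixes n :: nat and x w :: "real \<Rightarrow> real"
  assumes w: "w \<in> continuous_paths" and x: "continuous_on {0..T} x" "mono_on {0..T} x" "x 0 = 0" "x T \<le> A"
    and eq: "\<And>r. r \<in> {0..T} \<Longrightarrow> x r = G0 n r + integral {0..r} (\<lambda>s. K n (r - s) * drift_path_n n w (x s))"
    and near: "\<And>s. s \<in> {0..A} \<Longrightarrow> \<bar>drift_path_n n w s - drift_path w s\<bar> \<le> \<epsilon>"
    and bound: "\<And>s. s \<in> {0..A} \<Longrightarrow> \<bar>drift_path w s\<bar> \<le> b"
    and grid: "0 < J" "A \<le> \<epsilon> * real J" "0 < d" "real J * d \<le> t" "t \<le> T"
    and G: "\<And>j. j < J \<Longrightarrow> G' t - 2 * \<epsilon> \<le> G0 n (t - real j * d)"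
    and mass: "\<bar>kernel.mass (K n) d - 1\<bar> * (b + \<epsilon>) \<le> \<epsilon>" "(kernel.mass (K n) T - kernel.mass (K n) d) * (b + \<epsilon>) \<le> \<epsilon>"
    and c: "c < G' t - 6 * \<epsilon>" and \<epsilon>: "0 < \<epsilon>" "0 \<le> b"
  shows "pass c w \<le> x t"
proof -
  interpret V: volterra_solution "K n" T "G0 n" "f n" "lam n" "nu n" "M n" "W n" "X n" by (rule solution)
  have xle: "x s \<le> x r" if "0 \<le> s" "s \<le> r" "r \<le> T" for s r
    using mono_onD[OF x(2)] that by auto
  have jd: "real j * d \<le> t" if "j \<le> J" for j
  proof -
    have "real j * d \<le> real J * d" using that grid by (intro mult_right_mono) auto
    then show ?thesis using grid by linarith
  qed
  have xpos: "0 \<le> x s" "x s \<le> A" if "0 \<le> s" "s \<le> T" for s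
    using xle[of 0 s] xle[of s T] x that by auto
  \<comment> \<open>A non-decreasing path that gains at most \<open>A\<close> over \<open>J\<close> windows of length \<open>d\<close> gains at
    most \<open>\<epsilon>\<close> over one of them. On that window the path is almost constant.\<close>
  have "\<exists>j<J. x (t - real j * d) - x (t - real (Suc j) * d) \<le> \<epsilon>"
  proof (rule ccontr)
    assume "\<not> ?thesis"
    then have big: "\<epsilon> < x (t - real j * d) - x (t - real (Suc j) * d)" if "j < J" for j
      using that by (simp add: not_le del: of_nat_Suc)
    have "\<epsilon> * real J = (\<Sum>j<J. \<epsilon>)" by simp
    also have "\<dots> < (\<Sum>j<J. x (t - real j * d) - x (t - real (Suc j) * d))"
      using grid(1) big by (intro sum_strict_mono) auto
    also have "\<dots> = x (t - real 0 * d) - x (t - real J * d)" by (rule sum_lessThan_telescope')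
    also have "\<dots> \<le> A"
    proof -
      have "0 \<le> real J * d" using grid by simp
      then have "0 \<le> t" "0 \<le> t - real J * d" "t - real J * d \<le> T" using grid by linarith+
      then show ?thesis using xpos[of t] xpos[of "t - real J * d"] grid(5) by simp
    qed
    finally show False using grid(2) by simp
  qed
  then obtain j where j: "j < J" "x (t - real j * d) - x (t - real (Suc j) * d) \<le> \<epsilon>" by blast
  define r where "r = t - real j * d"
  have r: "d \<le> r" "r \<le> t" "r \<in> {0..T}" and rd: "r - d = t - real (Suc j) * d"
  proof -
    have "0 \<le> real j * d" using grid by simp
    moreover have "real (Suc j) * d = real j * d + d" by (simp add: algebra_simps)
    moreover have "real (Suc j) * d \<le> t" by (rule jd) (use j(1) in simp)
    ultimately show "d \<le> r" "r \<le> t" "r \<in> {0..T}" "r - d = t - real (Suc j) * d"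
      unfolding r_def atLeastAtMost_iff using grid by linarith+
  qed
  have rdT: "0 \<le> r - d" "r - d \<le> r" "r - d \<le> T" "0 \<le> r" "r \<le> T" using r grid by auto
  have wn: "continuous_on {x (r - d)..x r} (drift_path_n n w)"
    by (rule continuous_on_subset[OF drift_path_n_cont[OF w]]) (use xpos(1)[OF rdT(1,3)] in auto)
  have "x (r - d) \<le> x r" by (rule xle[OF rdT(1,2,5)])
  then obtain z where z: "x (r - d) \<le> z" "z \<le> x r" "\<And>y. x (r - d) \<le> y \<Longrightarrow> y \<le> x r \<Longrightarrow> drift_path_n n w z \<le> drift_path_n n w y"
    using continuous_attains_inf[OF _ _ wn] by auto
  let ?m = "drift_path_n n w z"
  have zA: "z \<in> {0..A}" using z(1,2) xpos(1)[OF rdT(1,3)] xpos(2)[OF rdT(4,5)] by simp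
  have nb: "\<bar>drift_path_n n w s\<bar> \<le> b + \<epsilon>" if "s \<in> {0..A}" for s
    using near[OF that] bound[OF that] by linarith
  have rT: "0 \<le> r" "r \<le> T" using r by auto
  have xr: "x s \<in> {0..A}" if "0 \<le> s" "s \<le> r" for s using xpos[of s] that rT by auto
  have u: "continuous_on {0..r} (\<lambda>s. drift_path_n n w (x s))"
    by (rule continuous_on_compose2[OF drift_path_n_cont[OF w] continuous_on_subset[OF x(1)]]) (use rT xr in auto)
  have "?m * V.mass d - (b + \<epsilon>) * (V.mass r - V.mass d) \<le> integral {0..r} (\<lambda>s. K n (r - s) * drift_path_n n w (x s))"
  proof (rule V.convolution_lower[OF _ r(1) u])
    show "?m \<le> drift_path_n n w (x s)" if "r - d \<le> s" "s \<le> r" for s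
      using xle[of "r - d" s] xle[of s r] that r rT by (intro z(3)) auto
    show "- (b + \<epsilon>) \<le> drift_path_n n w (x s)" if "0 \<le> s" "s \<le> r" for s
      using nb[OF xr[OF that]] by linarith
  qed (use grid in simp)
  moreover have "(b + \<epsilon>) * (V.mass r - V.mass d) \<le> (V.mass T - V.mass d) * (b + \<epsilon>)"
    using V.mass_mono[OF rT] \<epsilon> by (simp add: mult.commute mult_left_mono)
  moreover have "?m - \<epsilon> \<le> ?m * V.mass d"
  proof -
    have "\<bar>?m * (V.mass d - 1)\<bar> \<le> (b + \<epsilon>) * \<bar>V.mass d - 1\<bar>"
      unfolding abs_mult using nb[OF zA] by (intro mult_right_mono) auto
    then have "\<bar>?m * (V.mass d - 1)\<bar> \<le> \<epsilon>" using mass(1) by (simp add: mult.commute)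
    then show ?thesis by (simp add: algebra_simps abs_le_iff)
  qed
  moreover have "G' t - 2 * \<epsilon> \<le> G0 n r" unfolding r_def by (rule G[OF j(1)])
  ultimately have "G' t - 4 * \<epsilon> + ?m \<le> x r" using eq[OF r(3)] mass(2) by linarith
  moreover have "drift_path w z \<le> ?m + \<epsilon>" using near[OF zA] by (simp add: abs_le_iff)
  moreover have "x r - \<epsilon> \<le> z" using j(2) z(1) unfolding rd[symmetric] r_def[symmetric] by linarith
  ultimately have "c < z - drift_path w z" using c by linarith
  then have "pass c w \<le> z" using zA by (intro pass_nonneg_le) auto
  also have "z \<le> x r" by (rule z)
  also have "x r \<le> x t" using r rT grid(5) by (intro xle) auto
  finally show ?thesis .
qed

lemma solution_measurable [measurable]: "t \<in> {0..T} \<Longrightarrow> X n t \<in> borel_measurable (M n)"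
  using volterra_solution.X_measurable[OF solution, of t n] by simp

lemma pass_noise_measurable [measurable]: "(\<lambda>\<omega>. pass c (noise n \<omega>)) \<in> borel_measurable (M n)"
  using measurable_compose[OF noise_measurable pass_measurable] .

text \<open>Markov's inequality, as the mean of the solution is at most \<open>G0 n T\<close>.\<close>

lemma tail_small:
  assumes "0 < \<rho>"
  obtains A where "0 < A" "\<forall>\<^sub>F n in sequentially. measure (M n) {\<omega> \<in> space (M n). A \<le> X n T \<omega>} \<le> \<rho>"
proof (rule that)
  let ?A = "(G' T + 1) / \<rho>"
  show A: "0 < ?A" using G'_nonneg[of T] T assms by (simp add: add_nonneg_pos)
  have "\<forall>\<^sub>F n in sequentially. G0 n T < G' T + 1"
    using T by (intro order_tendstoD(2)[OF G0_tendsto]) auto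
  then show "\<forall>\<^sub>F n in sequentially. measure (M n) {\<omega> \<in> space (M n). ?A \<le> X n T \<omega>} \<le> \<rho>"
  proof eventually_elim
    case (elim n)
    interpret V: volterra_solution "K n" T "G0 n" "f n" "lam n" "nu n" "M n" "W n" "X n" by (rule solution)
    have "0 \<le> V.expectation (X n T)"
      using T by (intro integral_nonneg_AE AE_I2 V.X_nonneg) auto
    then have "0 \<le> lam n * (V.mass 0 * V.expectation (X n (T - 0)))" using lam_nonneg V.mass_nonneg by simp
    then have E: "V.expectation (X n T) \<le> G' T + 1" using V.solution_mean[of 0 T] elim T by simp
    have "measure (M n) {\<omega> \<in> space (M n). ?A \<le> X n T \<omega>} \<le> V.expectation (X n T) / ?A"
      by (rule integral_Markov_inequality_measure[where A = "{}"])
        (use A T V.X_integrable V.X_nonneg in auto)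
    also have "\<dots> \<le> (G' T + 1) / ?A" using E A by (intro divide_right_mono) auto
    also have "\<dots> = \<rho>" using G'_nonneg[of T] T assms by (simp add: field_simps)
    finally show ?case .
  qed
qed

text \<open>The hypotheses of \<open>passage_below_solution\<close> hold off three events: the solution exceeds \<open>A\<close>, the
  limit forcing exceeds \<open>b\<close>, or the forcing differs from its limit by more than \<open>\<epsilon>\<close>. The order of the
  choices matters: \<open>A\<close>, then \<open>b\<close>, then the window length \<open>d\<close>, and \<open>n\<close> last.\<close>

lemma passage_below_whp:
  assumes t: "0 < t" "t \<le> T" and c: "c < G' t" and \<rho>: "0 < \<rho>"
  shows "\<forall>\<^sub>F n in sequentially. measure (M n) {\<omega> \<in> space (M n). X n t \<omega> < pass c (noise n \<omega>)} \<le> \<rho>"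
proof -
  define \<epsilon> where "\<epsilon> = (G' t - c) / 7"
  have \<epsilon>: "0 < \<epsilon>" "c < G' t - 6 * \<epsilon>" using c by (auto simp: \<epsilon>_def field_simps)
  obtain A where A: "0 < A" "\<forall>\<^sub>F n in sequentially. measure (M n) {\<omega> \<in> space (M n). A \<le> X n T \<omega>} \<le> \<rho> / 3"
    using tail_small[of "\<rho> / 3"] \<rho> by auto
  obtain b where b: "0 < b" "{w \<in> continuous_paths. \<exists>s\<in>{0..A}. b < \<bar>drift_path w s\<bar>} \<in> sets path_sigma"
    "measure wiener {w \<in> continuous_paths. \<exists>s\<in>{0..A}. b < \<bar>drift_path w s\<bar>} \<le> \<rho> / 3"
    using drift_bounded[of "\<rho> / 3" A] \<rho> by auto
  have "(G' \<longlongrightarrow> G' t) (at t within {0..T})" using G'_cont t by (simp add: continuous_on)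
  then have "\<forall>\<^sub>F s in at t within {0..T}. G' t - \<epsilon> < G' s" by (rule order_tendstoD(1)) (use \<epsilon> in simp)
  then obtain d0 where d0: "0 < d0" "\<And>s. s \<in> {0..T} \<Longrightarrow> s \<noteq> t \<Longrightarrow> dist s t < d0 \<Longrightarrow> G' t - \<epsilon> < G' s"
    unfolding eventually_at by blast
  define d1 where "d1 = min (d0 / 2) t"
  have d1: "0 < d1" "d1 < d0" "d1 \<le> t" using d0(1) t by (auto simp: d1_def)
  obtain J where J: "A / \<epsilon> < real J" using reals_Archimedean2 by blast
  then have J0: "0 < J" using A(1) \<epsilon>(1) by (metis divide_pos_pos less_trans of_nat_0_less_iff)
  define d where "d = d1 / real J"
  have d: "0 < d" "real J * d = d1" using d1 J0 by (auto simp: d_def)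
  have dT: "d \<le> T"
  proof -
    have "1 * d \<le> real J * d" using d(1) J0 by (intro mult_right_mono) auto
    then show ?thesis using d(2) d1 t by simp
  qed
  have jd: "real j * d \<le> d1" if "j < J" for j
    using mult_right_mono[of "real j" "real J" d] that d by simp
  have G'j: "G' t - \<epsilon> \<le> G' (t - real j * d)" if "j < J" for j
  proof (cases "j = 0")
    case False
    have "G' t - \<epsilon> < G' (t - real j * d)"
    proof (rule d0(2))
      have "0 < real j * d" using d False by simp
      then show "t - real j * d \<in> {0..T}" "t - real j * d \<noteq> t" "dist (t - real j * d) t < d0"
        unfolding dist_real_def atLeastAtMost_iff using jd[OF that] d1 t by linarith+
    qed
    then show ?thesis by simp
  qed (use \<epsilon> in simp)
  have Gn: "\<forall>\<^sub>F n in sequentially. \<forall>j\<in>{..<J}. G' (t - real j * d) - \<epsilon> < G0 n (t - real j * d)"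
  proof (rule eventually_ball_finite)
    show "\<forall>j\<in>{..<J}. \<forall>\<^sub>F n in sequentially. G' (t - real j * d) - \<epsilon> < G0 n (t - real j * d)"
    proof
      fix j assume "j \<in> {..<J}"
      moreover have "0 \<le> real j * d" using d by simp
      ultimately have "t - real j * d \<in> {0..T}" using jd[of j] d1 t by auto
      then show "\<forall>\<^sub>F n in sequentially. G' (t - real j * d) - \<epsilon> < G0 n (t - real j * d)"
        by (intro order_tendstoD(1)[OF G0_tendsto]) (use \<epsilon> in auto)
    qed
  qed simp
  have m1: "\<forall>\<^sub>F n in sequentially. \<bar>kernel.mass (K n) d - 1\<bar> * (b + \<epsilon>) < \<epsilon>"
  proof (rule order_tendstoD(2))
    have "(\<lambda>n. \<bar>kernel.mass (K n) d - 1\<bar> * (b + \<epsilon>)) \<longlonglongrightarrow> \<bar>1 - 1\<bar> * (b + \<epsilon>)"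
      by (intro tendsto_intros mass_tendsto d dT)
    then show "(\<lambda>n. \<bar>kernel.mass (K n) d - 1\<bar> * (b + \<epsilon>)) \<longlonglongrightarrow> 0" by simp
  qed (rule \<epsilon>)
  have m2: "\<forall>\<^sub>F n in sequentially. (kernel.mass (K n) T - kernel.mass (K n) d) * (b + \<epsilon>) < \<epsilon>"
  proof (rule order_tendstoD(2))
    have "(\<lambda>n. (kernel.mass (K n) T - kernel.mass (K n) d) * (b + \<epsilon>)) \<longlonglongrightarrow> (1 - 1) * (b + \<epsilon>)"
      by (intro tendsto_intros mass_tendsto d dT T order_refl)
    then show "(\<lambda>n. (kernel.mass (K n) T - kernel.mass (K n) d) * (b + \<epsilon>)) \<longlonglongrightarrow> 0" by simp
  qed (rule \<epsilon>)
  let ?D = "\<lambda>n. {w \<in> continuous_paths. \<exists>s\<in>{0..A}. \<epsilon> < \<bar>drift_path_n n w s - drift_path w s\<bar>}"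
  let ?S = "{w \<in> continuous_paths. \<exists>s\<in>{0..A}. b < \<bar>drift_path w s\<bar>}"
  have "\<forall>\<^sub>F n in sequentially. measure wiener (?D n) < \<rho> / 3"
    using drift_path_n_close(2)[OF \<epsilon>(1), of A] by (rule order_tendstoD(2)) (use \<rho> in simp)
  with A(2) Gn m1 m2 show ?thesis
  proof eventually_elim
    case (elim n)
    interpret V: volterra_solution "K n" T "G0 n" "f n" "lam n" "nu n" "M n" "W n" "X n" by (rule solution)
    let ?E1 = "{\<omega> \<in> space (M n). A \<le> X n T \<omega>}" and ?E2 = "{\<omega> \<in> space (M n). noise n \<omega> \<in> ?S}"
      and ?E3 = "{\<omega> \<in> space (M n). noise n \<omega> \<in> ?D n}" and ?H = "{\<omega> \<in> space (M n). X n t \<omega> < pass c (noise n \<omega>)}"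
    have [measurable]: "X n T \<in> borel_measurable (M n)" "X n t \<in> borel_measurable (M n)" using T t by auto
    have E1: "?E1 \<in> sets (M n)" by measurable
    note E2 = noise_prob[OF b(2), of n] and E3 = noise_prob[OF drift_path_n_close(1)[OF \<epsilon>(1), of A n], of n]
    have "AE \<omega> in M n. \<omega> \<in> ?H \<longrightarrow> \<omega> \<in> ?E1 \<union> (?E2 \<union> ?E3)"
      using V.equation AE_space
    proof eventually_elim
      case (elim \<omega>)
      show ?case
      proof (rule impI, rule ccontr)
        assume H: "\<omega> \<in> ?H" and no: "\<omega> \<notin> ?E1 \<union> (?E2 \<union> ?E3)"
        have w: "noise n \<omega> \<in> continuous_paths" using measurable_space[OF noise_measurable elim(2)] by simp
        have "pass c (noise n \<omega>) \<le> X n t \<omega>"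
        proof (rule passage_below_solution[OF w V.X_path(3)[OF elim(2)] V.X_path(2)[OF elim(2)] V.X_path(1)[OF elim(2)]])
          show "X n T \<omega> \<le> A" using no elim(2) by auto
          show "\<bar>drift_path_n n (noise n \<omega>) s - drift_path (noise n \<omega>) s\<bar> \<le> \<epsilon>" if "s \<in> {0..A}" for s
            using no elim(2) w that by (force simp: not_less)
          show "\<bar>drift_path (noise n \<omega>) s\<bar> \<le> b" if "s \<in> {0..A}" for s
            using no elim(2) w that by (force simp: not_less)
          show "X n r \<omega> = G0 n r + integral {0..r} (\<lambda>s. K n (r - s) * drift_path_n n (noise n \<omega>) (X n s \<omega>))" if "r \<in> {0..T}" for r
          proof -
            have "X n r \<omega> = G0 n r + integral {0..r} (\<lambda>s. K n (r - s) * (nu n * V.Z s \<omega> - lam n * X n s \<omega>))"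
              using elim(1) that by blast
            also have "integral {0..r} (\<lambda>s. K n (r - s) * (nu n * V.Z s \<omega> - lam n * X n s \<omega>)) =
               integral {0..r} (\<lambda>s. K n (r - s) * drift_path_n n (noise n \<omega>) (X n s \<omega>))"
            proof (rule Henstock_Kurzweil_Integration.integral_cong)
              fix s assume "s \<in> {0..r}"
              then have "0 \<le> f n (X n s \<omega>)" using that V.X_nonneg[OF elim(2), of s] by (intro f_nonneg) auto
              then show "K n (r - s) * (nu n * V.Z s \<omega> - lam n * X n s \<omega>) = K n (r - s) * drift_path_n n (noise n \<omega>) (X n s \<omega>)"
                by (simp add: V.Z_def drift_path_n_def noise_eval)
            qed
            finally show ?thesis .
          qed
          show "A \<le> \<epsilon> * real J" using J \<epsilon>(1) by (simp add: field_simps)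
          show "real J * d \<le> t" using d d1 by simp
          show "G' t - 2 * \<epsilon> \<le> G0 n (t - real j * d)" if "j < J" for j
            using G'j[OF that] \<open>\<forall>j\<in>{..<J}. G' (t - real j * d) - \<epsilon> < G0 n (t - real j * d)\<close> that by force
        qed (use J0 d t \<epsilon> b \<open>\<bar>kernel.mass (K n) d - 1\<bar> * (b + \<epsilon>) < \<epsilon>\<close> \<open>(kernel.mass (K n) T - kernel.mass (K n) d) * (b + \<epsilon>) < \<epsilon>\<close> in auto)
        then show False using H by simp
      qed
    qed
    then have "measure (M n) ?H \<le> measure (M n) (?E1 \<union> (?E2 \<union> ?E3))"
      using E1 E2(1) E3(1) by (intro V.finite_measure_mono_AE) auto
    also have "\<dots> \<le> measure (M n) ?E1 + (measure (M n) ?E2 + measure (M n) ?E3)"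
      using E1 E2(1) E3(1) by (intro order_trans[OF measure_Un_le] add_left_mono measure_Un_le) auto
    also have "\<dots> \<le> \<rho> / 3 + (\<rho> / 3 + \<rho> / 3)"
      using elim E2(2) E3(2) b(3) by (intro add_mono) auto
    finally show ?case by simp
  qed
qed

end

section \<open>Equality in the mean\<close>

context volterra_limit
begin

text \<open>Truncated passage times are bounded, so an exceptional event of small probability changes their mean
  by little; the law of the passage time decides, once for all \<open>n\<close>, where to truncate.\<close>

lemma truncated_pass_mean:
  assumes "0 \<le> c" "0 < \<eta>"
  obtains R where "0 < R" "c / (1 + lam') - \<eta> \<le> (\<integral>w. min R (pass c w) \<partial>wiener)"
proof -
  note pm = pass_mean[OF assms(1)]
  have pos: "0 < 1 + lam'" using lam'_nonneg by simp
  have [measurable]: "pass c \<in> borel_measurable wiener" using pm(1) by simp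
  have "(\<lambda>k. \<integral>w. min (real k) (pass c w) \<partial>wiener) \<longlonglongrightarrow> (\<integral>w. pass c w \<partial>wiener)"
  proof (rule integral_dominated_convergence[where w = "\<lambda>w. pass c w"])
    show "AE w in wiener. (\<lambda>k. min (real k) (pass c w)) \<longlonglongrightarrow> pass c w"
    proof (rule AE_I2, rule tendsto_eventually)
      fix w
      obtain k :: nat where "pass c w \<le> real k" using real_arch_simple by blast
      then show "\<forall>\<^sub>F k in sequentially. min (real k) (pass c w) = pass c w"
        by (intro eventually_sequentiallyI[of k]) auto
    qed
    show "AE w in wiener. norm (min (real k) (pass c w)) \<le> pass c w" for k
      using good_wiener by eventually_elim (use pass_nonneg in auto)
  qed (use pm in auto)
  moreover have "(\<integral>w. pass c w \<partial>wiener) = c / (1 + lam')" using pm(2) pos by (simp add: field_simps)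
  ultimately have "\<forall>\<^sub>F k in sequentially. c / (1 + lam') - \<eta> < (\<integral>w. min (real k) (pass c w) \<partial>wiener)"
    by (intro order_tendstoD(1)) (use assms(2) in auto)
  then have "\<forall>\<^sub>F k in sequentially. c / (1 + lam') - \<eta> < (\<integral>w. min (real k) (pass c w) \<partial>wiener) \<and> 0 < k"
    using eventually_gt_at_top[of 0] by eventually_elim simp
  then obtain k where "c / (1 + lam') - \<eta> < (\<integral>w. min (real k) (pass c w) \<partial>wiener)" "0 < k"
    by (auto simp: eventually_sequentially)
  then show ?thesis by (intro that[of "real k"]) auto
qed

lemma good_noise: "AE \<omega> in M n. noise n \<omega> \<in> good"
proof -
  have "{w \<in> space path_sigma. w \<in> good} = good" by (auto simp: good_def)
  then show ?thesis
    using good_wiener unfolding noise_law[of n, symmetric]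
    by (subst (asm) AE_distr_iff) (use good_sets in auto)
qed

lemma noise_integral:
  assumes "g \<in> borel_measurable path_sigma"
  shows "(\<integral>\<omega>. g (noise n \<omega>) \<partial>M n) = (\<integral>w. g w \<partial>wiener)" "integrable (M n) (\<lambda>\<omega>. g (noise n \<omega>)) \<longleftrightarrow> integrable wiener (g :: _ \<Rightarrow> real)"
  unfolding noise_law[of n, symmetric] using assms by (auto simp: integral_distr integrable_distr_eq)

lemma lower_mean:
  assumes t: "0 < t" "t \<le> T" and c: "0 \<le> c" "c < G' t" and \<eta>: "0 < \<eta>"
  shows "\<forall>\<^sub>F n in sequentially. c / (1 + lam') - \<eta> \<le> (\<integral>\<omega>. X n t \<omega> \<partial>M n)"
proof -
  obtain R where R: "0 < R" "c / (1 + lam') - \<eta> / 2 \<le> (\<integral>w. min R (pass c w) \<partial>wiener)"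
    using truncated_pass_mean[OF c(1), of "\<eta> / 2"] \<eta> by auto
  have "0 < \<eta> / (2 * R)" using R \<eta> by simp
  from passage_below_whp[OF t c(2) this] show ?thesis
  proof eventually_elim
    case (elim n)
    interpret V: volterra_solution "K n" T "G0 n" "f n" "lam n" "nu n" "M n" "W n" "X n" by (rule solution)
    let ?H = "{\<omega> \<in> space (M n). X n t \<omega> < pass c (noise n \<omega>)}"
    have [measurable]: "X n t \<in> borel_measurable (M n)" using t by auto
    have H: "?H \<in> sets (M n)" by measurable
    have iH: "integrable (M n) (indicator ?H :: _ \<Rightarrow> real)"
      by (rule integrable_real_indicator[OF H]) (simp add: V.emeasure_eq_measure)
    have im: "integrable wiener (\<lambda>w. min R (pass c w))"
      using pass_mean(1)[OF c(1)] by (intro Bochner_Integration.integrable_min) auto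
    have mm: "(\<lambda>w. min R (pass c w)) \<in> borel_measurable path_sigma" by measurable
    have ia: "integrable (M n) (\<lambda>\<omega>. min R (pass c (noise n \<omega>)))" using noise_integral(2)[OF mm] im by simp
    have "(\<integral>w. min R (pass c w) \<partial>wiener) - R * measure (M n) ?H = (\<integral>\<omega>. min R (pass c (noise n \<omega>)) - R * indicator ?H \<omega> \<partial>M n)"
      using noise_integral(1)[OF mm, of n] ia iH by (simp add: Int_absorb2 Collect_conj_eq)
    also have "\<dots> \<le> (\<integral>\<omega>. X n t \<omega> \<partial>M n)"
    proof (rule integral_mono)
      fix \<omega> assume "\<omega> \<in> space (M n)"
      then show "min R (pass c (noise n \<omega>)) - R * indicator ?H \<omega> \<le> X n t \<omega>"
        using V.X_nonneg[of \<omega> t] t by (auto simp: indicator_def min_def)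
    qed (use ia iH V.X_integrable t in auto)
    finally have "(\<integral>w. min R (pass c w) \<partial>wiener) - R * measure (M n) ?H \<le> (\<integral>\<omega>. X n t \<omega> \<partial>M n)" .
    moreover have "R * measure (M n) ?H \<le> R * (\<eta> / (2 * R))" using elim R by (intro mult_left_mono) auto
    ultimately show ?case using R by simp
  qed
qed

lemma mean_le_G0: "t \<in> {0..T} \<Longrightarrow> (\<integral>\<omega>. X n t \<omega> \<partial>M n) \<le> G0 n t"
proof -
  assume t: "t \<in> {0..T}"
  interpret V: volterra_solution "K n" T "G0 n" "f n" "lam n" "nu n" "M n" "W n" "X n" by (rule solution)
  have "0 \<le> V.expectation (X n t)"
    using t by (intro integral_nonneg_AE AE_I2 V.X_nonneg) auto
  then have "0 \<le> lam n * (V.mass 0 * V.expectation (X n (t - 0)))" using lam_nonneg V.mass_nonneg by simp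
  then show ?thesis using V.solution_mean[of 0 t] t by simp
qed

text \<open>In the mean the equation reads \<open>E X\<^sub>t + lam * E X\<^bsub>t - d\<^esub> \<le> G t\<close> up to the mass of the kernel, so the lower
  bound for \<open>E X\<^bsub>t - d\<^esub>\<close> becomes an upper bound for \<open>E X\<^sub>t\<close>. Looking back in time, and not ahead, this
  includes \<open>t = T\<close>.\<close>

lemma upper_mean:
  assumes t: "0 < t" "t \<le> T" and G: "0 < G' t" and \<eta>: "0 < \<eta>"
  shows "\<forall>\<^sub>F n in sequentially. (\<integral>\<omega>. X n t \<omega> \<partial>M n) \<le> G' t / (1 + lam') + \<eta>"
proof -
  define \<eta>1 where "\<eta>1 = min (G' t / 2) (\<eta> / 4 / (1 + lam'))"
  have pos: "0 < 1 + lam'" using lam'_nonneg by simp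
  have \<eta>1: "0 < \<eta>1" "\<eta>1 < G' t" using G \<eta> pos by (auto simp: \<eta>1_def)
  have \<eta>1': "(1 + lam') * \<eta>1 \<le> \<eta> / 4"
  proof -
    have "(1 + lam') * \<eta>1 \<le> (1 + lam') * (\<eta> / 4 / (1 + lam'))" using pos by (intro mult_left_mono) (auto simp: \<eta>1_def)
    also have "\<dots> = \<eta> / 4" using pos by (subst nonzero_mult_div_cancel_left[symmetric, of "1 + lam'" "\<eta> / 4"]) auto
    finally show ?thesis .
  qed
  define q where "q = (G' t - \<eta>1) / (1 + lam') - \<eta>1"
  have "(G' \<longlongrightarrow> G' t) (at t within {0..T})" using G'_cont t by (simp add: continuous_on)
  then have "\<forall>\<^sub>F s in at t within {0..T}. G' t - \<eta>1 < G' s" by (rule order_tendstoD(1)) (use \<eta>1 in simp)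
  then obtain d0 where d0: "0 < d0" "\<And>s. s \<in> {0..T} \<Longrightarrow> s \<noteq> t \<Longrightarrow> dist s t < d0 \<Longrightarrow> G' t - \<eta>1 < G' s"
    unfolding eventually_at by blast
  define d where "d = min (d0 / 2) (t / 2)"
  have d: "0 < d" "d < d0" "d < t" using d0(1) t by (auto simp: d_def)
  have "G' t - \<eta>1 < G' (t - d)" using d t by (intro d0(2)) (auto simp: dist_real_def)
  then have "\<forall>\<^sub>F n in sequentially. q \<le> (\<integral>\<omega>. X n (t - d) \<omega> \<partial>M n)"
    unfolding q_def using d t \<eta>1 by (intro lower_mean) auto
  moreover have "\<forall>\<^sub>F n in sequentially. G0 n t - lam n * (kernel.mass (K n) d * q) < G' t / (1 + lam') + \<eta>"
  proof (rule order_tendstoD(2))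
    show "(\<lambda>n. G0 n t - lam n * (kernel.mass (K n) d * q)) \<longlonglongrightarrow> G' t - lam' * (1 * q)"
      by (intro tendsto_intros G0_tendsto lam_tendsto mass_tendsto) (use d t in auto)
    have "G' t - lam' * (1 * q) = G' t / (1 + lam') + (lam' * \<eta>1 / (1 + lam') + lam' * \<eta>1)"
    proof -
      define a b where "a = G' t / (1 + lam')" and "b = \<eta>1 / (1 + lam')"
      have "q = a - b - \<eta>1" by (simp add: q_def a_def b_def diff_divide_distrib)
      then have "G' t - lam' * (1 * q) = (1 + lam') * a - lam' * (a - b - \<eta>1)" using pos by (simp add: a_def)
      also have "\<dots> = a + (lam' * b + lam' * \<eta>1)" by (simp add: algebra_simps)
      finally show ?thesis by (simp add: a_def b_def)
    qed
    also have "lam' * \<eta>1 / (1 + lam') \<le> (1 + lam') * \<eta>1"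
    proof -
      have "lam' * \<eta>1 / (1 + lam') \<le> lam' * \<eta>1 / 1" using lam'_nonneg \<eta>1 by (intro divide_left_mono) auto
      then show ?thesis using \<eta>1 by (simp add: algebra_simps)
    qed
    also have "lam' * \<eta>1 \<le> (1 + lam') * \<eta>1" using \<eta>1 by simp
    finally show "G' t - lam' * (1 * q) < G' t / (1 + lam') + \<eta>" using \<eta>1' \<eta> by linarith
  qed
  ultimately show ?thesis
  proof eventually_elim
    case (elim n)
    interpret V: volterra_solution "K n" T "G0 n" "f n" "lam n" "nu n" "M n" "W n" "X n" by (rule solution)
    have "V.mass d * q \<le> V.mass d * V.expectation (X n (t - d))" using elim(1) V.mass_nonneg by (intro mult_left_mono)
    then have "lam n * (V.mass d * q) \<le> lam n * (V.mass d * V.expectation (X n (t - d)))"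
      using lam_nonneg by (rule mult_left_mono)
    moreover have "V.expectation (X n t) + lam n * (V.mass d * V.expectation (X n (t - d))) \<le> G0 n t"
      using d t by (intro V.solution_mean) auto
    ultimately show ?case using elim(2) by linarith
  qed
qed

text \<open>For \<open>c\<close> slightly below \<open>G' t\<close> the solution and the passage time over \<open>G' t\<close> both dominate the passage
  time over \<open>c\<close>, with high probability and almost surely, respectively. All three means are nearly equal, so by
  Markov's inequality the variables are close. If \<open>G' t = 0\<close> there is no such level \<open>c\<close>, but then both
  variables are non-negative with mean close to zero.\<close>

lemma solution_close_to_passage:
  assumes t: "t \<in> {0..T}" and e: "0 < e" and \<rho>: "0 < \<rho>"
  shows "\<forall>\<^sub>F n in sequentially. measure (M n) {\<omega> \<in> space (M n). e < \<bar>X n t \<omega> - pass (G' t) (noise n \<omega>)\<bar>} \<le> \<rho>"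
proof (cases "G' t = 0")
  case True
  have "\<forall>\<^sub>F n in sequentially. G0 n t < e * \<rho>"
    using G0_tendsto[OF t] by (rule order_tendstoD(2)) (use True e \<rho> in simp)
  then show ?thesis
  proof eventually_elim
    case (elim n)
    interpret V: volterra_solution "K n" T "G0 n" "f n" "lam n" "nu n" "M n" "W n" "X n" by (rule solution)
    have [measurable]: "X n t \<in> borel_measurable (M n)" using t by auto
    note pm = pass_mean[OF order_refl]
    have ip: "integrable (M n) (\<lambda>\<omega>. pass 0 (noise n \<omega>))" using noise_integral(2)[OF pass_measurable] pm(1) by simp
    have ep: "(\<integral>\<omega>. pass 0 (noise n \<omega>) \<partial>M n) = 0" using noise_integral(1)[OF pass_measurable, of n 0] pm(2) lam'_nonneg by auto
    have iX: "integrable (M n) (X n t)" using t by (intro V.X_integrable) auto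
    have "measure (M n) {\<omega> \<in> space (M n). e < \<bar>X n t \<omega> - pass (G' t) (noise n \<omega>)\<bar>} \<le>
        measure (M n) {\<omega> \<in> space (M n). e \<le> \<bar>X n t \<omega> - pass 0 (noise n \<omega>)\<bar>}"
      unfolding True by (intro V.finite_measure_mono) auto
    also have "\<dots> \<le> (\<integral>\<omega>. \<bar>X n t \<omega> - pass 0 (noise n \<omega>)\<bar> \<partial>M n) / e"
      by (rule integral_Markov_inequality_measure[where A = "{}"]) (use e iX ip in auto)
    also have "\<dots> \<le> (\<integral>\<omega>. X n t \<omega> + pass 0 (noise n \<omega>) \<partial>M n) / e"
    proof (intro divide_right_mono integral_mono_AE)
      show "AE \<omega> in M n. \<bar>X n t \<omega> - pass 0 (noise n \<omega>)\<bar> \<le> X n t \<omega> + pass 0 (noise n \<omega>)"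
        using good_noise AE_space
      proof eventually_elim
        case (elim \<omega>)
        have "0 \<le> pass 0 (noise n \<omega>)" "0 \<le> X n t \<omega>" using pass_nonneg[OF elim(1)] V.X_nonneg[OF elim(2)] t by auto
        then show ?case by (simp add: abs_le_iff)
      qed
    qed (use e iX ip in auto)
    also have "\<dots> = (\<integral>\<omega>. X n t \<omega> \<partial>M n) / e" using iX ip ep by simp
    also have "\<dots> \<le> (e * \<rho>) / e" using mean_le_G0[OF t, of n] elim e by (intro divide_right_mono) auto
    finally show ?case using e by simp
  qed
next
  case False
  then have G: "0 < G' t" using G'_nonneg[OF t] by simp
  have t': "0 < t" "t \<le> T" using t G G'_0 by (auto simp: le_less)
  define \<eta> where "\<eta> = e * \<rho> / 20"
  have \<eta>: "0 < \<eta>" using e \<rho> by (simp add: \<eta>_def)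
  define \<delta> where "\<delta> = min (G' t) (2 * \<eta>)"
  define c where "c = G' t - \<delta>"
  have c: "0 \<le> c" "c < G' t" "G' t - c \<le> 2 * \<eta>" using G \<eta> by (auto simp: c_def \<delta>_def)
  have pos: "0 < 1 + lam'" using lam'_nonneg by simp
  have div_le: "(G' t - c) / (1 + lam') \<le> 2 * \<eta>"
  proof -
    have "(G' t - c) / (1 + lam') \<le> (G' t - c) / 1" using c lam'_nonneg by (intro divide_left_mono) auto
    then show ?thesis using c(3) by simp
  qed
  obtain R where R: "0 < R" "c / (1 + lam') - \<eta> \<le> (\<integral>w. min R (pass c w) \<partial>wiener)"
    using truncated_pass_mean[OF c(1) \<eta>] .
  have "0 < min (\<rho> / 2) (\<eta> / R)" using \<rho> \<eta> R by simp
  from passage_below_whp[OF t' c(2) this] upper_mean[OF t' G \<eta>] show ?thesis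
  proof eventually_elim
    case (elim n)
    interpret V: volterra_solution "K n" T "G0 n" "f n" "lam n" "nu n" "M n" "W n" "X n" by (rule solution)
    let ?H = "{\<omega> \<in> space (M n). X n t \<omega> < pass c (noise n \<omega>)}"
    have [measurable]: "X n t \<in> borel_measurable (M n)" using t by auto
    have H: "?H \<in> sets (M n)" by measurable
    have iH: "integrable (M n) (indicator ?H :: _ \<Rightarrow> real)"
      by (rule integrable_real_indicator[OF H]) (simp add: V.emeasure_eq_measure)
    have im: "integrable wiener (\<lambda>w. min R (pass c w))"
      using pass_mean(1)[OF c(1)] by (intro Bochner_Integration.integrable_min) auto
    have mm: "(\<lambda>w. min R (pass c w)) \<in> borel_measurable path_sigma" by measurable
    have ia: "integrable (M n) (\<lambda>\<omega>. min R (pass c (noise n \<omega>)))" using noise_integral(2)[OF mm] im by simp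
    have ip: "integrable (M n) (\<lambda>\<omega>. pass c' (noise n \<omega>))"
      and ep: "(\<integral>\<omega>. pass c' (noise n \<omega>) \<partial>M n) = c' / (1 + lam')" if "0 \<le> c'" for c'
      using noise_integral[OF pass_measurable, of n c'] pass_mean[OF that] pos by (auto simp: field_simps)
    have iX: "integrable (M n) (X n t)" using t by (intro V.X_integrable) auto
    have Gt: "0 \<le> G' t" using G by simp
    \<comment> \<open>Off the exceptional event this bounds the distance; the summand \<open>R * indicator\<close> keeps it
      non-negative on that event.\<close>
    let ?Y = "\<lambda>\<omega>. (X n t \<omega> - min R (pass c (noise n \<omega>)) + R * indicator ?H \<omega>) + (pass (G' t) (noise n \<omega>) - pass c (noise n \<omega>))"
    have iY: "integrable (M n) ?Y" using iX ia iH ip[OF c(1)] ip[OF Gt] by auto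
    have pt: "AE \<omega> in M n. 0 \<le> ?Y \<omega> \<and> (\<omega> \<notin> ?H \<longrightarrow> \<bar>X n t \<omega> - pass (G' t) (noise n \<omega>)\<bar> \<le> ?Y \<omega>)"
      using good_noise AE_space
    proof eventually_elim
      case (elim \<omega>)
      have "pass c (noise n \<omega>) \<le> pass (G' t) (noise n \<omega>)" using c(2) by (intro pass_mono[OF elim(1)]) simp
      moreover have "0 \<le> X n t \<omega>" using t by (intro V.X_nonneg[OF elim(2)]) auto
      ultimately show ?case using R(1) elim(2) by (cases "X n t \<omega> < pass c (noise n \<omega>)") (auto simp: min_def abs_le_iff)
    qed
    have "(\<integral>\<omega>. ?Y \<omega> \<partial>M n) = (\<integral>\<omega>. X n t \<omega> \<partial>M n) - (\<integral>w. min R (pass c w) \<partial>wiener) + R * measure (M n) ?H + (G' t / (1 + lam') - c / (1 + lam'))"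
      using iX ia iH ip[OF c(1)] ip[OF Gt] ep[OF c(1)] ep[OF Gt] noise_integral(1)[OF mm, of n]
      by (simp add: Int_absorb2 Collect_conj_eq)
    also have "R * measure (M n) ?H \<le> R * (\<eta> / R)" using elim(1) R by (intro mult_left_mono) auto
    finally have EY: "(\<integral>\<omega>. ?Y \<omega> \<partial>M n) \<le> 10 * \<eta>"
      using elim(2) R div_le \<eta> by (simp add: diff_divide_distrib)
    have "measure (M n) {\<omega> \<in> space (M n). e < \<bar>X n t \<omega> - pass (G' t) (noise n \<omega>)\<bar>} \<le>
       measure (M n) (?H \<union> {\<omega> \<in> space (M n). e \<le> ?Y \<omega>})"
    proof (rule V.finite_measure_mono_AE)
      show "AE \<omega> in M n. \<omega> \<in> {\<omega> \<in> space (M n). e < \<bar>X n t \<omega> - pass (G' t) (noise n \<omega>)\<bar>} \<longrightarrow> \<omega> \<in> ?H \<union> {\<omega> \<in> space (M n). e \<le> ?Y \<omega>}"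
        using pt
      proof eventually_elim
        case (elim \<omega>)
        show ?case
        proof (rule impI, rule ccontr)
          assume a: "\<omega> \<in> {\<omega> \<in> space (M n). e < \<bar>X n t \<omega> - pass (G' t) (noise n \<omega>)\<bar>}"
            and b: "\<omega> \<notin> ?H \<union> {\<omega> \<in> space (M n). e \<le> ?Y \<omega>}"
          then have "\<bar>X n t \<omega> - pass (G' t) (noise n \<omega>)\<bar> \<le> ?Y \<omega>" using elim by blast
          moreover have "e < \<bar>X n t \<omega> - pass (G' t) (noise n \<omega>)\<bar>" "\<not> e \<le> ?Y \<omega>" using a b by blast+
          ultimately show False by linarith
        qed
      qed
      show "?H \<union> {\<omega> \<in> space (M n). e \<le> ?Y \<omega>} \<in> sets (M n)" by measurable
    qed
    also have "\<dots> \<le> measure (M n) ?H + measure (M n) {\<omega> \<in> space (M n). e \<le> ?Y \<omega>}"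
      by (rule measure_Un_le) measurable
    also have "measure (M n) {\<omega> \<in> space (M n). e \<le> ?Y \<omega>} \<le> (\<integral>\<omega>. ?Y \<omega> \<partial>M n) / e"
    proof (rule integral_Markov_inequality_measure[where A = "{}"])
      show "AE \<omega> in M n. 0 \<le> ?Y \<omega>" using pt by eventually_elim blast
    qed (use e iY in auto)
    also have "(\<integral>\<omega>. ?Y \<omega> \<partial>M n) / e \<le> 10 * \<eta> / e" using EY e by (intro divide_right_mono) auto
    also have "10 * \<eta> / e = \<rho> / 2" using e by (simp add: \<eta>_def)
    finally show ?case using elim(1) by linarith
  qed
qed

end

section \<open>The limit theorem\<close>

context volterra_limit
begin

text \<open>The limit as a functional of the driving path. On the null set of paths that are not \<open>good\<close> an
  arbitrary element of the path space is taken.\<close>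

definition limit_path :: "(real \<Rightarrow> real) \<Rightarrow> (real \<Rightarrow> real) \<times> (real \<Rightarrow> real)" where
  "limit_path w = (if w \<in> good then (\<lambda>s\<in>{0..}. drift_path w s, \<lambda>t\<in>{0..T}. pass (G' t) w)
     else (SOME p. p \<in> path_space T))"

lemma limit_path_good: "w \<in> good \<Longrightarrow> limit_path w \<in> path_space T"
proof -
  assume w: "w \<in> good"
  then have wc: "w \<in> continuous_paths" by (simp add: good_def)
  have "(\<lambda>s\<in>{0..}. drift_path w s) \<in> continuous_paths"
    using drift_path_cont[OF wc] continuous_on_cong[of "{0..}" "{0..}" "\<lambda>s\<in>{0..}. drift_path w s" "drift_path w"]
    by (simp add: continuous_paths_def)
  moreover have "(\<lambda>t\<in>{0..T}. pass (G' t) w) \<in> increasing_cadlag_paths T"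
    unfolding pass_def
    by (rule inverse_increasing_cadlag[OF T _ G'_cont G'_mono]) (use w in \<open>auto simp: good_def\<close>)
  ultimately show ?thesis using w by (simp add: limit_path_def path_space_def)
qed

lemma limit_path_space: "limit_path w \<in> path_space T"
proof (cases "w \<in> good")
  case False
  have "wiener.prob good = 1" using good_wiener good_sets sets_wiener by (subst wiener.prob_eq_1) auto
  then have "good \<noteq> {}" by auto
  then have "\<exists>p. p \<in> path_space T" using limit_path_good by blast
  then have "(SOME p. p \<in> path_space T) \<in> path_space T" by (rule someI_ex)
  then show ?thesis using False by (simp add: limit_path_def)
qed (rule limit_path_good)

lemma limit_path_measurable: "limit_path \<in> measurable path_sigma (borel_of (path_topology T))"
proof (rule path_measurable[OF T limit_path_space])
  note [measurable] = good_sets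
  fix s :: real assume s: "0 \<le> s"
  have [measurable]: "(\<lambda>w. drift_path w s) \<in> borel_measurable path_sigma" using s by (rule drift_path_measurable)
  have "(\<lambda>w. fst (limit_path w) s) = (\<lambda>w. if w \<in> good then drift_path w s else fst (SOME p. p \<in> path_space T) s)"
    using s by (auto simp: limit_path_def)
  then show "(\<lambda>w. fst (limit_path w) s) \<in> borel_measurable path_sigma" by simp
next
  note [measurable] = good_sets
  fix t assume t: "t \<in> {0..T}"
  have "(\<lambda>w. snd (limit_path w) t) = (\<lambda>w. if w \<in> good then pass (G' t) w else snd (SOME p. p \<in> path_space T) t)"
    using t by (auto simp: limit_path_def)
  then show "(\<lambda>w. snd (limit_path w) t) \<in> borel_measurable path_sigma" by simp
qed

definition prelimit :: "nat \<Rightarrow> 'a \<Rightarrow> (real \<Rightarrow> real) \<times> (real \<Rightarrow> real)" where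
  "prelimit n \<omega> = (forcing (nu n) (lam n) (f n) (W n) \<omega>, \<lambda>t\<in>{0..T}. X n t \<omega>)"

lemma forcing_noise: "forcing (nu n) (lam n) (f n) (W n) \<omega> = (\<lambda>s\<in>{0..}. drift_path_n n (noise n \<omega>) s)"
  unfolding forcing_def drift_path_n_def by (intro restrict_ext) (simp add: noise_eval f_nonneg)

lemma noise_continuous: "\<omega> \<in> space (M n) \<Longrightarrow> noise n \<omega> \<in> continuous_paths"
  using measurable_space[OF noise_measurable] by simp

lemma solution_increasing_cadlag:
  assumes \<omega>: "\<omega> \<in> space (M n)"
  shows "(\<lambda>t\<in>{0..T}. X n t \<omega>) \<in> increasing_cadlag_paths T" "continuous_on {0..T} (\<lambda>t\<in>{0..T}. X n t \<omega>)"
proof -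
  interpret V: volterra_solution "K n" T "G0 n" "f n" "lam n" "nu n" "M n" "W n" "X n" by (rule solution)
  let ?x = "\<lambda>t\<in>{0..T}. X n t \<omega>"
  show c: "continuous_on {0..T} ?x"
    using V.X_path(3)[OF \<omega>] continuous_on_cong[of "{0..T}" "{0..T}" ?x "\<lambda>t. X n t \<omega>"] by simp
  have lim: "(?x \<longlongrightarrow> ?x t) (at t within {0..T})" if "t \<in> {0..T}" for t using c that by (simp only: continuous_on)
  have "(?x \<longlongrightarrow> ?x t) (at_right t)" if t: "t \<in> {0..<T}" for t
  proof -
    have "(?x \<longlongrightarrow> ?x t) (at t within {t..T})" by (rule tendsto_within_subset[OF lim]) (use t in auto)
    then show ?thesis using at_within_Icc_at_right[of t T] t by simp
  qed
  moreover have "(?x \<longlongrightarrow> ?x t) (at_left t)" if t: "t \<in> {0<..T}" for t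
  proof -
    have "(?x \<longlongrightarrow> ?x t) (at t within {0..t})" by (rule tendsto_within_subset[OF lim]) (use t in auto)
    then show ?thesis using at_within_Icc_at_left[of 0 t] t by simp
  qed
  moreover have "mono_on {0..T} ?x" by (intro mono_onI) (use V.X_le[OF \<omega>] in auto)
  moreover have "0 \<le> ?x t" if "t \<in> {0..T}" for t using V.X_nonneg[OF \<omega>] that by auto
  ultimately show "?x \<in> increasing_cadlag_paths T"
    unfolding increasing_cadlag_paths_def cadlag_paths_def by blast
qed

lemma forcing_continuous: "\<omega> \<in> space (M n) \<Longrightarrow> forcing (nu n) (lam n) (f n) (W n) \<omega> \<in> continuous_paths"
  unfolding forcing_noise
  using drift_path_n_cont[OF noise_continuous, of \<omega> n n]
    continuous_on_cong[of "{0..}" "{0..}" "\<lambda>s\<in>{0..}. drift_path_n n (noise n \<omega>) s" "drift_path_n n (noise n \<omega>)"]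
  by (simp add: continuous_paths_def)

lemma prelimit_space: "\<omega> \<in> space (M n) \<Longrightarrow> prelimit n \<omega> \<in> path_space T"
  using forcing_continuous solution_increasing_cadlag by (simp add: prelimit_def path_space_def)

lemma prelimit_measurable: "prelimit n \<in> measurable (M n) (borel_of (path_topology T))"
proof (rule path_measurable[OF T prelimit_space])
  fix s :: real assume s: "0 \<le> s"
  have "(\<lambda>\<omega>. fst (prelimit n \<omega>) s) = (\<lambda>\<omega>. drift_path_n n (noise n \<omega>) s)"
    using s by (simp add: prelimit_def forcing_noise)
  then show "(\<lambda>\<omega>. fst (prelimit n \<omega>) s) \<in> borel_measurable (M n)"
    using measurable_compose[OF noise_measurable drift_path_n_measurable[OF s]] by simp
next
  fix t assume t: "t \<in> {0..T}"
  then have "(\<lambda>\<omega>. snd (prelimit n \<omega>) t) = X n t" by (simp add: prelimit_def)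
  then show "(\<lambda>\<omega>. snd (prelimit n \<omega>) t) \<in> borel_measurable (M n)" using solution_measurable[OF t] by simp
qed

text \<open>By \<open>levy_close_grid\<close> it is enough to compare the monotone components at the \<open>m + 1\<close> points of a grid of
  mesh at most \<open>e\<close>; each of them contributes an event of small probability.\<close>

lemma prelimit_close:
  assumes e: "0 < e"
  shows "\<forall>\<^sub>F n in sequentially. \<exists>Bad\<in>sets (M n). measure (M n) Bad \<le> e \<and>
    (\<forall>\<omega>\<in>space (M n) - Bad. path_dist T (prelimit n \<omega>) (limit_path (noise n \<omega>)) \<le> e)"
proof -
  obtain m where m: "T / e < real m" using reals_Archimedean2 by blast
  then have m0: "0 < m" using T e by (metis divide_pos_pos less_trans of_nat_0_less_iff)
  have mesh: "T / real m \<le> e" using m m0 e by (simp add: field_simps)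
  define g where "g i = real i * T / real m" for i
  have g: "g i \<in> {0..T}" if "i \<le> m" for i using that T m0 by (auto simp: g_def field_simps)
  define \<rho> where "\<rho> = e / (2 * (real m + 1))"
  have \<rho>: "0 < \<rho>" "real (Suc m) * \<rho> = e / 2" using e by (auto simp: \<rho>_def field_simps)
  let ?D = "\<lambda>n. {w \<in> continuous_paths. \<exists>s\<in>{0..1/e}. e < \<bar>drift_path_n n w s - drift_path w s\<bar>}"
  let ?P = "\<lambda>n i. {\<omega> \<in> space (M n). e < \<bar>X n (g i) \<omega> - pass (G' (g i)) (noise n \<omega>)\<bar>}"
  have "\<forall>\<^sub>F n in sequentially. measure wiener (?D n) < e / 2"
    using drift_path_n_close(2)[OF e] by (rule order_tendstoD(2)) (use e in simp)
  moreover have "\<forall>\<^sub>F n in sequentially. \<forall>i\<in>{..m}. measure (M n) (?P n i) \<le> \<rho>"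
    by (rule eventually_ball_finite) (use solution_close_to_passage[OF g e \<rho>(1)] in auto)
  ultimately show ?thesis
  proof eventually_elim
    case (elim n)
    interpret V: volterra_solution "K n" T "G0 n" "f n" "lam n" "nu n" "M n" "W n" "X n" by (rule solution)
    let ?E = "{\<omega> \<in> space (M n). noise n \<omega> \<in> ?D n}" and ?N = "{\<omega> \<in> space (M n). noise n \<omega> \<in> continuous_paths - good}"
    note E = noise_prob[OF drift_path_n_close(1)[OF e, of "1/e" n], of n]
    have "continuous_paths - good \<in> sets path_sigma" using sets.compl_sets[OF good_sets] by simp
    note N = noise_prob[OF this, of n]
    have "measure wiener (continuous_paths - good) = 0"
    proof -
      have "wiener.prob good = 1" using good_wiener good_sets sets_wiener by (subst wiener.prob_eq_1) auto
      then show ?thesis using wiener.prob_compl[of good] good_sets sets_wiener by (simp add: space_wiener)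
    qed
    then have N0: "measure (M n) ?N = 0" using N(2) by simp
    have P: "?P n i \<in> sets (M n)" if "i \<le> m" for i
    proof -
      have [measurable]: "X n (g i) \<in> borel_measurable (M n)" using g[OF that] by (rule solution_measurable)
      show ?thesis by measurable
    qed
    have U: "(\<Union>i\<in>{..m}. ?P n i) \<in> sets (M n)" using P by (intro sets.finite_UN) auto
    let ?Bad = "?E \<union> (?N \<union> (\<Union>i\<in>{..m}. ?P n i))"
    have "measure (M n) (\<Union>i\<in>{..m}. ?P n i) \<le> (\<Sum>i\<in>{..m}. measure (M n) (?P n i))"
      using P by (intro V.finite_measure_subadditive_finite) auto
    also have "\<dots> \<le> (\<Sum>i\<in>{..m}. \<rho>)" using elim(2) by (intro sum_mono) auto
    also have "\<dots> = e / 2" using \<rho>(2) by simp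
    finally have PU: "measure (M n) (\<Union>i\<in>{..m}. ?P n i) \<le> e / 2" .
    have "measure (M n) ?Bad \<le> measure (M n) ?E + (measure (M n) ?N + measure (M n) (\<Union>i\<in>{..m}. ?P n i))"
      using E(1) N(1) U by (intro order_trans[OF measure_Un_le] add_left_mono measure_Un_le) auto
    also have "\<dots> \<le> e" using E(2) elim(1) N0 PU by simp
    finally have "measure (M n) ?Bad \<le> e" .
    moreover have "?Bad \<in> sets (M n)" using E(1) N(1) U by auto
    moreover have "path_dist T (prelimit n \<omega>) (limit_path (noise n \<omega>)) \<le> e" if \<omega>: "\<omega> \<in> space (M n) - ?Bad" for \<omega>
    proof (rule path_dist_le[OF _ e])
      have sp: "\<omega> \<in> space (M n)" using \<omega> by simp
      note w = noise_continuous[OF sp]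
      have good: "noise n \<omega> \<in> good" using \<omega> w by auto
      have lp: "limit_path (noise n \<omega>) = (\<lambda>s\<in>{0..}. drift_path (noise n \<omega>) s, \<lambda>t\<in>{0..T}. pass (G' t) (noise n \<omega>))"
        using good by (simp add: limit_path_def)
      show "path_close T e (prelimit n \<omega>) (limit_path (noise n \<omega>))"
        unfolding path_close_def
      proof (intro conjI ballI)
        fix s assume s: "s \<in> {0..1/e}"
        have "\<bar>drift_path_n n (noise n \<omega>) s - drift_path (noise n \<omega>) s\<bar> \<le> e"
        proof (rule ccontr)
          assume "\<not> ?thesis"
          then have "noise n \<omega> \<in> ?D n" using w s by (auto simp: not_le)
          then show False using \<omega> sp by blast
        qed
        then show "\<bar>fst (prelimit n \<omega>) s - fst (limit_path (noise n \<omega>)) s\<bar> \<le> e"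
          using s by (simp add: prelimit_def forcing_noise lp)
      next
        show "levy_close T e (snd (prelimit n \<omega>)) (snd (limit_path (noise n \<omega>)))"
        proof (rule levy_close_grid[OF T _ _ m0 mesh])
          show "snd (prelimit n \<omega>) \<in> increasing_cadlag_paths T"
            using solution_increasing_cadlag(1)[OF sp] by (simp add: prelimit_def)
          show "snd (limit_path (noise n \<omega>)) \<in> increasing_cadlag_paths T"
            using limit_path_space[of "noise n \<omega>"] by (auto simp: path_space_def)
          fix i assume i: "i \<le> m"
          have "\<bar>X n (g i) \<omega> - pass (G' (g i)) (noise n \<omega>)\<bar> \<le> e"
          proof (rule ccontr)
            assume "\<not> ?thesis"
            then have "\<omega> \<in> ?P n i" using sp by (simp add: not_le)
            then show False using \<omega> i by blast
          qed
          then show "\<bar>snd (prelimit n \<omega>) (real i * T / real m) - snd (limit_path (noise n \<omega>)) (real i * T / real m)\<bar> \<le> e"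
            using g[OF i] unfolding g_def prelimit_def lp by simp
        qed
      qed
    qed
    ultimately show ?case by blast
  qed
qed

lemma limit_path_B:
  "AE \<omega> in N. limit_path (B.sample_path \<omega>) = (forcing nu' lam' f' B \<omega>, first_passage T G' nu' lam' f' B \<omega>)"
  using good_B
proof eventually_elim
  case (elim \<omega>)
  have "(\<lambda>s\<in>{0..}. drift_path (B.sample_path \<omega>) s) = forcing nu' lam' f' B \<omega>"
    unfolding forcing_def drift_path_def by (intro restrict_ext) (simp add: B.sample_path_def f'_nonneg)
  moreover have "{u. 0 \<le> u \<and> c < u - drift_path (B.sample_path \<omega>) u} = {s. 0 \<le> s \<and> c < (1 + lam') * s - nu' * B (f' s) \<omega>}" for c
    using drift_B by (auto simp: B.level_def)
  ultimately show ?case using elim by (simp add: limit_path_def pass_def first_passage_def)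
qed

lemma prelimit_converges:
  "converges_in_law (path_topology T) M prelimit N
     (\<lambda>\<omega>. (forcing nu' lam' f' B \<omega>, first_passage T G' nu' lam' f' B \<omega>))"
proof -
  interpret pseudometric "path_space T" "path_dist T" by (rule pseudometric_path_dist[OF T])
  let ?Y = "\<lambda>\<omega>. limit_path (B.sample_path \<omega>)"
  have Y: "?Y \<in> measurable N (borel_of (path_topology T))"
    by (rule measurable_compose[OF B.sample_path_measurable limit_path_measurable])
  have law: "distr N (borel_of (path_topology T)) ?Y = distr wiener (borel_of (path_topology T)) limit_path"
    unfolding wiener_def by (subst distr_distr[OF limit_path_measurable B.sample_path_measurable]) (simp add: o_def)
  have law_n: "distr (M n) (borel_of (path_topology T)) (\<lambda>\<omega>. limit_path (noise n \<omega>)) = distr wiener (borel_of (path_topology T)) limit_path" for n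
    unfolding noise_law[of n, symmetric] by (subst distr_distr[OF limit_path_measurable noise_measurable]) (simp add: o_def)
  have "weakly_converges (path_topology T) (\<lambda>n. distr (M n) (borel_of (path_topology T)) (prelimit n))
     (distr N (borel_of (path_topology T)) ?Y)"
    unfolding path_topology_def
  proof (rule weakly_converges_of_close)
    show "prob_space (M n)" for n
    proof -
      interpret V: volterra_solution "K n" T "G0 n" "f n" "lam n" "nu n" "M n" "W n" "X n" by (rule solution)
      show ?thesis by (rule V.prob_space_axioms)
    qed
    show "prob_space (distr N (borel_of E) ?Y)"
      using B.prob_space_distr[OF Y] by (simp add: path_topology_def)
    show "prelimit n \<in> measurable (M n) (borel_of E)" for n
      using prelimit_measurable[of n] by (simp add: path_topology_def)
    show "(\<lambda>\<omega>. limit_path (noise n \<omega>)) \<in> measurable (M n) (borel_of E)" for n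
      using measurable_compose[OF noise_measurable limit_path_measurable] by (simp add: path_topology_def)
    show "distr (M n) (borel_of E) (\<lambda>\<omega>. limit_path (noise n \<omega>)) = distr N (borel_of E) ?Y" for n
      using law law_n[of n] by (simp add: path_topology_def)
  qed (rule prelimit_close)
  then show ?thesis
    unfolding converges_in_law_def
    using prelimit_measurable Y limit_path_B by (intro exI[of _ prelimit] exI[of _ ?Y]) simp
qed

lemma decorate_prelimit:
  assumes "\<omega> \<in> space (M n)"
  shows "decorate T (prelimit n \<omega>) = embed_path T (\<lambda>t\<in>{0..T}. nu n * W n (f n (X n t \<omega>)) \<omega> - lam n * X n t \<omega>)"
proof -
  interpret V: volterra_solution "K n" T "G0 n" "f n" "lam n" "nu n" "M n" "W n" "X n" by (rule solution)
  have "(\<lambda>t\<in>{0..T}. forcing (nu n) (lam n) (f n) (W n) \<omega> ((\<lambda>t\<in>{0..T}. X n t \<omega>) t)) =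
      (\<lambda>t\<in>{0..T}. nu n * W n (f n (X n t \<omega>)) \<omega> - lam n * X n t \<omega>)"
    by (intro restrict_ext) (use V.X_nonneg[OF assms] in \<open>simp add: forcing_def\<close>)
  then show ?thesis
    unfolding prelimit_def using decorate_continuous_path[OF T forcing_continuous[OF assms] solution_increasing_cadlag[OF assms]] by simp
qed

text \<open>A continuous function that starts at most at \<open>c\<close> and exceeds it later is equal to \<open>c\<close> at its first passage time over \<open>c\<close>.
  This identifies the base path of the limit with \<open>X\<^sup>* - G'\<close>.\<close>

lemma drift_at_pass:
  assumes w: "w \<in> good" and c: "0 \<le> c" "drift_path w 0 = 0"
  shows "drift_path w (pass c w) = pass c w - c"
proof -
  let ?g = "\<lambda>u. u - drift_path w u" and ?p = "pass c w"
  have wc: "w \<in> continuous_paths" using w by (simp add: good_def)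
  have p0: "0 \<le> ?p" by (rule pass_nonneg[OF w])
  have gc: "continuous_on {0..} ?g" using drift_path_cont[OF wc] by (intro continuous_intros)
  have "?g ?p \<le> c"
  proof (cases "?p = 0")
    case True
    then show ?thesis using c by simp
  next
    case False
    then have pos: "0 < ?p" using p0 by simp
    have "continuous_on {0..?p} ?g" using gc by (rule continuous_on_subset) auto
    then have "(?g \<longlongrightarrow> ?g ?p) (at ?p within {0..?p})" using pos by (simp add: continuous_on)
    then have "(?g \<longlongrightarrow> ?g ?p) (at_left ?p)" using at_within_Icc_at_left[OF pos] by simp
    moreover have "\<forall>\<^sub>F u in at_left ?p. ?g u \<le> c"
      using eventually_at_left_real[OF pos]
    proof eventually_elim
      case (elim u)
      then show ?case using pass_nonneg_le[of u c w] by (cases "c < u - drift_path w u") auto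
    qed
    ultimately show ?thesis by (rule tendsto_upperbound) (simp add: trivial_limit_at_left_real)
  qed
  moreover have "c \<le> ?g ?p"
  proof (rule ccontr)
    assume "\<not> c \<le> ?g ?p"
    then have "0 < c - ?g ?p" by simp
    then obtain d where d: "0 < d" "\<And>v. 0 \<le> v \<Longrightarrow> \<bar>v - ?p\<bar> < d \<Longrightarrow> \<bar>?g v - ?g ?p\<bar> < c - ?g ?p"
      using gc p0 unfolding continuous_on_iff dist_real_def by (metis atLeast_iff)
    have "{u. 0 \<le> u \<and> c < ?g u} \<noteq> {}" using w by (auto simp: good_def)
    then obtain u where u: "0 \<le> u" "c < ?g u" "u < ?p + d"
      using cInf_lessD[of "{u. 0 \<le> u \<and> c < ?g u}" "?p + d"] d(1) by (auto simp: pass_def)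
    then have "?p \<le> u" by (intro pass_nonneg_le) auto
    then have "\<bar>?g u - ?g ?p\<bar> < c - ?g ?p" using u by (intro d(2)) auto
    then show False using u by linarith
  qed
  ultimately show ?thesis by simp
qed

lemma decorate_limit:
  "AE \<omega> in N. decorate T (forcing nu' lam' f' B \<omega>, first_passage T G' nu' lam' f' B \<omega>) =
     (let F = forcing nu' lam' f' B \<omega>; x = first_passage T G' nu' lam' f' B \<omega>
      in (\<lambda>t\<in>{0..T}. x t - G' t, jump_decoration T G' F x))"
  using limit_path_B good_B B.W_0
proof eventually_elim
  case (elim \<omega>)
  let ?w = "B.sample_path \<omega>" and ?F = "forcing nu' lam' f' B \<omega>" and ?x = "first_passage T G' nu' lam' f' B \<omega>"
  have lp: "?F = (\<lambda>s\<in>{0..}. drift_path ?w s)" "?x = (\<lambda>t\<in>{0..T}. pass (G' t) ?w)"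
    using elim(1,2) by (auto simp: limit_path_def)
  have xc: "?x \<in> increasing_cadlag_paths T"
    using limit_path_good[OF elim(2)] elim(1) by (simp add: path_space_def)
  have d0: "drift_path ?w 0 = 0" using elim(3) by (simp add: drift_path_def f'_0 B.sample_path_def)
  have Fx: "?F (?x t) = ?x t - G' t" if t: "t \<in> {0..T}" for t
    using drift_at_pass[OF elim(2) G'_nonneg[OF t] d0] pass_nonneg[OF elim(2), of "G' t"] t by (simp add: lp)
  have "?F ` {left_limit ?x t..?x t} = (if t \<in> jump_times T ?x then ?F ` {left_limit ?x t..?x t} else {?x t - G' t})"
    if t: "t \<in> {0..T}" for t
  proof (cases "t \<in> jump_times T ?x")
    case False
    then have "left_limit ?x t = ?x t" using t by (auto simp: jump_times_def left_limit_def)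
    then show ?thesis using False Fx[OF t] by simp
  qed simp
  then have "snd (decorate T (?F, ?x)) = jump_decoration T G' ?F ?x"
    unfolding decorate_def jump_decoration_def snd_conv fst_conv by (intro restrict_ext) blast
  moreover have "fst (decorate T (?F, ?x)) = (\<lambda>t\<in>{0..T}. ?x t - G' t)"
    unfolding decorate_def snd_conv fst_conv by (intro restrict_ext Fx)
  ultimately show ?case unfolding Let_def by (metis prod.collapse)
qed

end

lemma converges_in_law_cong_AE:
  assumes "converges_in_law E M Z N Z'" "\<And>n. AE \<omega> in M n. Z n \<omega> = V n \<omega>" "AE \<omega> in N. Z' \<omega> = V' \<omega>"
  shows "converges_in_law E M V N V'"
proof -
  obtain Y Y' where Y: "\<And>n. Y n \<in> measurable (M n) (borel_of E)" "\<And>n. AE \<omega> in M n. Y n \<omega> = Z n \<omega>"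
    and Y': "Y' \<in> measurable N (borel_of E)" "AE \<omega> in N. Y' \<omega> = Z' \<omega>"
    and w: "weakly_converges E (\<lambda>n. distr (M n) (borel_of E) (Y n)) (distr N (borel_of E) Y')"
    using assms(1) unfolding converges_in_law_def by blast
  have "AE \<omega> in M n. Y n \<omega> = V n \<omega>" for n using Y(2)[of n] assms(2)[of n] by eventually_elim simp
  moreover have "AE \<omega> in N. Y' \<omega> = V' \<omega>" using Y'(2) assms(3) by eventually_elim simp
  ultimately show ?thesis unfolding converges_in_law_def using Y(1) Y'(1) w
    by (intro exI[of _ Y] exI[of _ Y']) simp
qed

theorem theorem3p12:
  fixes T :: real
    and lam nu :: "nat \<Rightarrow> real" and lam' nu' :: real
    and f K G\<^sub>0 :: "nat \<Rightarrow> real \<Rightarrow> real" and f' G' :: "real \<Rightarrow> real"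
    and M :: "nat \<Rightarrow> 'a measure" and W X :: "nat \<Rightarrow> real \<Rightarrow> 'a \<Rightarrow> real"
    and N :: "'b measure" and B :: "real \<Rightarrow> 'b \<Rightarrow> real"
  assumes "T > 0"
    and "\<And>n. lam n \<ge> 0" and "\<And>n. nu n \<ge> 0"
    and "\<And>n. C1_linear_growth (f n)"
    and "\<And>n. mono_on {0..} (f n)" and "\<And>n. f n 0 = 0"
    and "\<And>n b. b \<ge> 0 \<Longrightarrow> K n absolutely_integrable_on {0..b}"
    and "\<And>n t. t \<ge> 0 \<Longrightarrow> K n t \<ge> 0"
    and "\<And>n. mono_on {0..} (G\<^sub>0 n)" and "\<And>n. G\<^sub>0 n 0 = 0"
    and "\<And>n. weak_solution T (G\<^sub>0 n) (K n) (f n) (lam n) (nu n) (M n) (W n) (X n)"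
    and "weakly_converges (top_of_set {0..T})
           (\<lambda>n. density (restrict_space lebesgue {0..T}) (\<lambda>t. ennreal (K n t)))
           (return (restrict_space borel {0..T}) 0)"
    and "\<And>t. t \<in> {0..T} \<Longrightarrow> (\<lambda>n. G\<^sub>0 n t) \<longlonglongrightarrow> G' t"
    and "continuous_on {0..T} G'"
    and "locally_uniform_limit f f'"
    and "bdd_above {f n x / (1 + x\<^sup>2) | n x. x \<ge> 0}"
    and "lam \<longlonglongrightarrow> lam'" and "nu \<longlonglongrightarrow> nu'"
    and "standard_brownian_motion N B"
  shows "converges_in_law (D_circ_topology T)
           M (\<lambda>n \<omega>. (forcing (nu n) (lam n) (f n) (W n) \<omega>, \<lambda>t\<in>{0..T}. X n t \<omega>))
           N (\<lambda>\<omega>. (forcing nu' lam' f' B \<omega>, first_passage T G' nu' lam' f' B \<omega>))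
       \<and> converges_in_law (decorated_topology T)
           M (\<lambda>n \<omega>. embed_path T
                (\<lambda>t\<in>{0..T}. nu n * W n (f n (X n t \<omega>)) \<omega> - lam n * X n t \<omega>))
           N (\<lambda>\<omega>. let F = forcing nu' lam' f' B \<omega>;
                      x = first_passage T G' nu' lam' f' B \<omega>
                  in (\<lambda>t\<in>{0..T}. x t - G' t, jump_decoration T G' F x))"
proof -
  obtain C where C: "\<And>y. y \<in> {f n x / (1 + x\<^sup>2) | n x. x \<ge> 0} \<Longrightarrow> y \<le> C"
    using assms(16) unfolding bdd_above_def by blast
  have growth: "f n x \<le> C * (1 + x\<^sup>2)" if "0 \<le> x" for n x
  proof -
    have "f n x / (1 + x\<^sup>2) \<le> C" using that by (intro C) blast
    moreover have "0 < 1 + x\<^sup>2" by (simp add: add_pos_nonneg)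
    ultimately show ?thesis by (simp add: pos_divide_le_eq)
  qed
  have f_cont: "continuous_on {0..} (f n)" for n
    using assms(4)[of n] unfolding C1_linear_growth_def continuous_on_eq_continuous_within
    by (metis DERIV_continuous atLeast_iff)
  have kernel: "kernel (K n)" for n by unfold_locales (use assms(7,8) in auto)
  have "volterra_solution (K n) T (G\<^sub>0 n) (f n) (lam n) (nu n) (M n) (W n) (X n)" for n
    unfolding volterra_solution_def volterra_solution_axioms_def using kernel f_cont assms by blast
  then interpret volterra_limit T lam nu lam' nu' f K G\<^sub>0 f' G' M W X N B C
    using kernel_mass_tendsto[OF assms(1) kernel assms(12)] growth assms(19) f_cont
    by unfold_locales (use assms in \<open>auto simp: standard_brownian_motion_def\<close>)
  have "converges_in_law (D_circ_topology T) M prelimit N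
      (\<lambda>\<omega>. (forcing nu' lam' f' B \<omega>, first_passage T G' nu' lam' f' B \<omega>))"
    using converges_in_law_continuous_map[OF prelimit_converges id_continuous_D_circ[OF T]] by simp
  moreover have "prelimit = (\<lambda>n \<omega>. (forcing (nu n) (lam n) (f n) (W n) \<omega>, \<lambda>t\<in>{0..T}. X n t \<omega>))"
    by (simp add: prelimit_def fun_eq_iff)
  moreover have "converges_in_law (decorated_topology T)
           M (\<lambda>n \<omega>. embed_path T
                (\<lambda>t\<in>{0..T}. nu n * W n (f n (X n t \<omega>)) \<omega> - lam n * X n t \<omega>))
           N (\<lambda>\<omega>. let F = forcing nu' lam' f' B \<omega>;
                      x = first_passage T G' nu' lam' f' B \<omega>
                  in (\<lambda>t\<in>{0..T}. x t - G' t, jump_decoration T G' F x))"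
    by (rule converges_in_law_cong_AE[OF converges_in_law_continuous_map[OF prelimit_converges decorate_continuous[OF T]]
          AE_I2[OF decorate_prelimit] decorate_limit])
  ultimately show ?thesis by simp
qed

end
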